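(* Let $\mathfrak A\subset\mathcal A^{\mathbb Z^D}$ be a subshift of finite type, let $\Phi:\mathcal A^{\mathbb Z^D}\to\mathcal A^{\mathbb Z^D}$ be a cellular automaton with $\Phi(\mathfrak A)\subseteq\mathfrak A$, and let $(\mathcal G,+)$ be an abelian group. (a) Suppose $\mathfrak A$ is basepoint-free in codimension $(k+1)$. If $\pi_k\Phi:\pi_k(\mathfrak A)\to\pi_k(\mathfrak A)$ is injective, then every homotopy defect of codimension $(k+1)$ is $\Phi$-persistent. (b) If $\mathcal H_k\Phi:\mathcal H_k(\mathfrak A,\mathcal G)\to\mathcal H_k(\mathfrak A,\mathcal G)$ is injective, then every homology defect of codimension $(k+1)$ is $\Phi$-persistent. (c) If $\mathcal H^k\Phi:\mathcal H^k(\mathfrak A,\mathcal G)\to\mathcal H^k(\mathfrak A,\mathcal G)$ is surjective, then every cohomology defect of codimension $(k+1)$ is $\Phi$-persistent.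
   Context: **Subshifts.** $\mathcal A$ is a finite alphabet, $D\ge1$; $\sigma^{\mathsf v}(\mathbf a)_{\mathsf z}=a_{\mathsf z+\mathsf v}$; a subshift is a closed shift-invariant subset of $\mathcal A^{\mathbb Z^D}$ (product topology). $\mathbb B(r)=\{-r,\dots,r\}^D$, $\mathbb B(\mathsf z,r)=\mathsf z+\mathbb B(r)$; patterns on translates of a set are identified with patterns on the set; $\mathfrak A_{(r)}=\{\mathbf a_{\mathbb B(r)}:\mathbf a\in\mathfrak A\}$. $\mathfrak A$ is a subshift of finite type of radius $R$ if $\mathfrak A=\{\mathbf a:\mathbf a_{\mathbb B(\mathsf z,R)}\in\mathfrak A_{(R)}\ \forall\mathsf z\}$. A cellular automaton is a continuous shift-commuting self-map; it has radius $q$ if $\Phi(\mathbf a)_{\mathsf z}=\phi(\mathbf a_{\mathbb B(\mathsf z,q)})$ for a local rule $\phi$. **Defects.** $\mathcal F_{\mathbf a}(\mathsf z)=\max\{r\in\mathbb N:\mathbf a_{\mathbb B(\mathsf z,r)}\in\mathfrak A_{(r)}\}\in\mathbb N\cup\{\infty\}$; $\widetilde{\mathfrak A}=\{\mathbf a:\sup_{\mathsf z}\mathcal F_{\mathbf a}(\mathsf z)=\infty\}$; $\mathbb G_r(\mathbf a)=\{\mathsf z:\mathcal F_{\mathbf a}(\mathsf z)\ge r\}$. $\mathbf a$ is defective if $\mathbf a\in\widetilde{\mathfrak A}\setminus\mathfrak A$; its defect is $\Phi$-persistent if $\Phi^t(\mathbf a)$ is defective for all $t\in\mathbb N$. For $\mathbb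 Y\subset\mathbb Z^D$, $\mathbf Y$ is the smallest closed set containing $\mathbb Y$ and all unit cubes $\mathsf z+[0,1]^D$ whose corners are all in $\mathbb Y$; homotopy and (co)homology of $\mathbb Y$ mean those of $\mathbf Y$. **Groups of $\mathbb G_\infty(\mathbf a)$.** A connected component $\mathbb Y$ of $\mathbb G_r(\mathbf a)$ (connectedness via nearest-neighbour steps) is projective if it meets $\mathbb G_s(\mathbf a)$ for all $s\ge r$. Suppose that for some $r_0$, $\mathbb G_{r_0}(\mathbf a)$ contains a unique projective component $\mathbb Y$; then for $r>r_0$, $\mathbb Y_r:=\mathbb Y\cap\mathbb G_r(\mathbf a)$ is the unique projective component of $\mathbb G_r(\mathbf a)$. A proper base ray is a continuous path $\omega:[0,\infty)\to\mathbf Y_{r_0}\subset\mathbb R^D$ with $|\omega(t)|\to\infty$ as $t\to\infty$. For $r>r_0$, $\pi_k(\mathbb Y_r,\omega):=\pi_k(\mathbb Y_r,\mathsf y)$, where $\mathsf y\in\mathbb Y_r\cap\omega[0,\infty)$ is any point (different choices being identified along the segment of $\omega$ between them). Then $\pi_k[\mathbb G_\infty(\mathbf a),\omega]:=\varprojlim_r\pi_k(\mathbb Y_r,\omega)$, via the inclusions $\mathbb Y_{r+1}\subset\mathbb Y_r$. $\mathbf a$ has a defect of projective codimension $(k+1)$ if $\pi_k[\mathbb G_\infty(\mathbf a),\omega]$ is nontrivial (and of projective codimension one if, for some $R\geq 0$, $\mathbb G_R(\mathbf a)$ has at least two projective components). Analogously $\mathcal H_k[\mathbb G_\infty(\mathbf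 a),\mathcal G]:=\varprojlim_r\mathcal H_k[\mathbb G_r(\mathbf a),\mathcal G]$ and $\mathcal H^k[\mathbb G_\infty(\mathbf a),\mathcal G]:=\varinjlim_r\mathcal H^k[\mathbb G_r(\mathbf a),\mathcal G]$, via the inclusions $\mathbb G_{r+1}(\mathbf a)\subset\mathbb G_r(\mathbf a)$. **Tile complexes.** For $1\le i\le D$ let $\partial_i^+\mathbb B(r)=\{\mathsf u\in\mathbb B(r):u_i>-r\}$, $\partial_i^-\mathbb B(r)=\{\mathsf u\in\mathbb B(r):u_i<r\}$. For $r\ge R$ ($R$ the radius of $\mathfrak A$), the tile complex $\mathbf X_r$ is the cell complex obtained from the disjoint union of unit $D$-cubes $\square_{\mathsf z}\mathbf c$ ($\mathsf z\in\mathbb Z^D$, $\mathbf c\in\mathfrak A_{(r)}$), $\square_{\mathsf z}\mathbf c$ being a copy of $\mathsf z+[0,1]^D$, by gluing the upper face of $\square_{\mathsf z}\mathbf c$ orthogonal to the unit vector $\mathsf e_i$ to the lower face of $\square_{\mathsf z+\mathsf e_i}\mathbf c'$ orthogonal to $\mathsf e_i$ if and only if $\mathbf c_{\partial_i^+\mathbb B(r)}=\mathbf c'_{\partial_i^-\mathbb B(r)}$ (index sets identified by translation). $\Pi_r:\mathbf X_r\to\mathbb R^D$ is the natural projection, $\Pi_r^0:\mathbf X_r^0\to\mathbb Z^D$ its restriction to vertices. For $\mathbf a\in\widetilde{\mathfrak A}$ there is a continuous section $\varsigma^r_{\mathbf a}:\mathbb G_r(\mathbf a)\to\mathbf X_r$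 of $\Pi_r$ (defined on the cube union of $\mathbb G_r(\mathbf a)$), sending the cube $\mathsf z+[0,1]^D$ to $\square_{\mathsf z}\mathbf a_{\mathbb B(\mathsf z,r)}$. The cellular map $\zeta_r:\mathbf X_{r+1}\to\mathbf X_r$ sends $\square_{\mathsf z}\mathbf c$ to $\square_{\mathsf z}\mathbf c_{\mathbb B(r)}$. For $\mathbf c\in\mathfrak A$, $x_r(\mathbf c)$ is the corner of $\square_0\mathbf c_{\mathbb B(r)}$ over $0$. **Groups of $\mathfrak A$.** For $\mathbf c\in\mathfrak A$, $\pi_k(\mathfrak A,\mathbf c):=\varprojlim_r\pi_k(\mathbf X_r,x_r(\mathbf c))$; also $\mathcal H_k(\mathfrak A,\mathcal G):=\varprojlim_r\mathcal H_k(\mathbf X_r,\mathcal G)$ and $\mathcal H^k(\mathfrak A,\mathcal G):=\varinjlim_r\mathcal H^k(\mathbf X_r,\mathcal G)$ for $k\in\{0,\dots,D\}$ (all maps induced by the $\zeta_r$). $\mathfrak A$ is basepoint-free in codimension $k+1$ if one of the following holds: (i) $\Pi^0_r$ is injective for all large enough $r$; (ii) $(\mathfrak A,\sigma)$ is topologically weakly mixing (i.e. $(\mathfrak A\times\mathfrak A,\sigma\times\sigma)$ is topologically transitive), $k=1$, and $\pi_1(\mathfrak A,\mathbf c)$ is abelian; (iii) $(\mathfrak A,\sigma)$ is topologically weakly mixing and $\pi_1(\mathfrak A,\mathbf c)$ is trivial. Then the groups $\pi_k(\mathfrak A,\mathbf c)$ are canonically isomorphic for different $\mathbf c\in\mathfrak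 A$, and $\pi_k(\mathfrak A)$ means $\pi_k(\mathfrak A,\mathbf c)$ with $\mathbf c\in\mathfrak A$ arbitrary. **Induced maps and signatures.** If $\Phi$ has radius $q$, the cellular maps $\Phi_*:\mathbf X_{r+q}\to\mathbf X_r$, $\square_{\mathsf z}\mathbf c\mapsto\square_{\mathsf z}\Phi(\mathbf c)$ (where $\Phi(\mathbf c)\in\mathfrak A_{(r)}$ for $\mathbf c\in\mathfrak A_{(r+q)}$), induce in the limit $\pi_k\Phi$, $\mathcal H_k\Phi$, $\mathcal H^k\Phi$. If $\mathbf a\in\widetilde{\mathfrak A}$ has a defect of projective codimension $(k+1)$, the sections $\varsigma^r_{\mathbf a}$ induce in the limit the $k$th homotopy, homology and cohomology signatures $\pi_k\mathbf a:\pi_k[\mathbb G_\infty(\mathbf a),\omega]\to\pi_k(\mathfrak A)$ (when $\mathfrak A$ is basepoint-free in codimension $k+1$), $\mathcal H_k\mathbf a:\mathcal H_k[\mathbb G_\infty(\mathbf a),\mathcal G]\to\mathcal H_k(\mathfrak A,\mathcal G)$, $\mathcal H^k\mathbf a:\mathcal H^k(\mathfrak A,\mathcal G)\to\mathcal H^k[\mathbb G_\infty(\mathbf a),\mathcal G]$. $\mathbf a$ has a homotopy (resp. homology, cohomology) defect of codimension $(k+1)$ if $\pi_k\mathbf a$ (resp. $\mathcal H_k\mathbf a$, $\mathcal H^k\mathbf a$) is nontrivial; "every such defect is $\Phi$-persistent" means that every such $\mathbf a$ has a $\Phi$-persistent defect.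
   Formalization: Only k ≥ 1 is covered: at k = 0 parts (b), (c) fail (golden mean shift, Φ = 0, a = …0110…) and (a) is undefined. Injectivity of π_kΦ is taken at every c in 𝔄, and π_k a is formed via paths joining base points. *)

theory Defs
  imports "HOL-Analysis.Analysis" "HOL-Homology.Homology"
begin

section \<open>Subshifts and cellular automata\<close>

text \<open>
  The lattice \<open>\<int>\<^sup>D\<close> is \<^typ>\<open>int ^ 'd\<close> with \<open>D = CARD('d) \<ge> 1\<close>; the alphabet is a type of class
  \<^class>\<open>finite\<close>.  A pattern on a lat_box is a function restricted to that lat_box (hence
  \<^const>\<open>undefined\<close> outside), which makes patterns on translated boxes equal when they agree up to
  translation.
\<close>

type_synonym ('d, 'a) config = "int ^ 'd \<Rightarrow> 'a"

definition shift :: "int ^ ('d::finite) \<Rightarrow> ('d, 'a) config \<Rightarrow> ('d, 'a) config" where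
  "shift v a = (\<lambda>z. a (z + v))"

definition lat_box :: "nat \<Rightarrow> (int ^ ('d::finite)) set" where
  "lat_box r = {u. \<forall>i. \<bar>u $ i\<bar> \<le> int r}"

definition pattern_at :: "('d::finite, 'a) config \<Rightarrow> int ^ 'd \<Rightarrow> nat \<Rightarrow> ('d, 'a) config" where
  "pattern_at a z r = restrict (shift z a) (lat_box r)"

definition patterns :: "('d::finite, 'a) config set \<Rightarrow> nat \<Rightarrow> ('d, 'a) config set" where
  "patterns \<AA> r = (\<lambda>a. restrict a (lat_box r)) ` \<AA>"

definition config_topology :: "('d::finite, 'a) config topology" where
  "config_topology = product_topology (\<lambda>_. discrete_topology UNIV) UNIV"

definition subshift :: "('d::finite, 'a) config set \<Rightarrow> bool" where
  "subshift \<AA> \<longleftrightarrow> closedin config_topology \<AA> \<and> (\<forall>v. shift v ` \<AA> = \<AA>)"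

definition subshift_finite_type :: "('d::finite, 'a) config set \<Rightarrow> nat \<Rightarrow> bool" where
  "subshift_finite_type \<AA> R \<longleftrightarrow>
     subshift \<AA> \<and> \<AA> = {a. \<forall>z. pattern_at a z R \<in> patterns \<AA> R}"

definition cellular_automaton :: "(('d::finite, 'a) config \<Rightarrow> ('d, 'a) config) \<Rightarrow> bool" where
  "cellular_automaton \<Phi> \<longleftrightarrow>
     continuous_map config_topology config_topology \<Phi> \<and>
     (\<forall>v a. \<Phi> (shift v a) = shift v (\<Phi> a))"

definition has_radius :: "(('d::finite, 'a) config \<Rightarrow> ('d, 'a) config) \<Rightarrow> nat \<Rightarrow> bool" where
  "has_radius \<Phi> q \<longleftrightarrow> (\<exists>\<phi>. \<forall>a z. \<Phi> a z = \<phi> (pattern_at a z q))"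

definition topologically_transitive :: "'x topology \<Rightarrow> ('v \<Rightarrow> 'x \<Rightarrow> 'x) \<Rightarrow> bool" where
  "topologically_transitive X T \<longleftrightarrow>
     (\<forall>U V. openin X U \<and> U \<noteq> {} \<and> openin X V \<and> V \<noteq> {} \<longrightarrow> (\<exists>v. T v ` U \<inter> V \<noteq> {}))"

definition weakly_mixing :: "('d::finite, 'a) config set \<Rightarrow> bool" where
  "weakly_mixing \<AA> \<longleftrightarrow>
     topologically_transitive
       (prod_topology (subtopology config_topology \<AA>) (subtopology config_topology \<AA>))
       (\<lambda>v. map_prod (shift v) (shift v))"


section \<open>Defects\<close>

text \<open>
  The supremum is taken in the extended reals, so that \<open>\<F>\<^sub>a(z) = -\<infinity>\<close> if not even the single
  symbol at \<open>z\<close> is admissible; such \<open>z\<close> belong to no \<open>\<GG>\<^sub>r(a)\<close>, not even to \<open>\<GG>\<^sub>0(a)\<close>.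
\<close>

definition adm_radius :: "('d::finite, 'a) config set \<Rightarrow> ('d, 'a) config \<Rightarrow> int ^ 'd \<Rightarrow> ereal" where
  "adm_radius \<AA> a z = (SUP r \<in> {r. pattern_at a z r \<in> patterns \<AA> r}. ereal (real r))"

definition tilde :: "('d::finite, 'a) config set \<Rightarrow> ('d, 'a) config set" where
  "tilde \<AA> = {a. (SUP z. adm_radius \<AA> a z) = \<infinity>}"

definition good :: "('d::finite, 'a) config set \<Rightarrow> ('d, 'a) config \<Rightarrow> nat \<Rightarrow> (int ^ 'd) set" where
  "good \<AA> a r = {z. adm_radius \<AA> a z \<ge> ereal (real r)}"

definition defective :: "('d::finite, 'a) config set \<Rightarrow> ('d, 'a) config \<Rightarrow> bool" where
  "defective \<AA> a \<longleftrightarrow> a \<in> tilde \<AA> - \<AA>"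

definition persistent ::
  "(('d::finite, 'a) config \<Rightarrow> ('d, 'a) config) \<Rightarrow> ('d, 'a) config set \<Rightarrow> ('d, 'a) config \<Rightarrow> bool" where
  "persistent \<Phi> \<AA> a \<longleftrightarrow> (\<forall>t. defective \<AA> ((\<Phi> ^^ t) a))"

definition nn_adjacent :: "int ^ ('d::finite) \<Rightarrow> int ^ 'd \<Rightarrow> bool" where
  "nn_adjacent u v \<longleftrightarrow> (\<exists>i. v = u + axis i 1 \<or> u = v + axis i 1)"

definition nn_component :: "(int ^ ('d::finite)) set \<Rightarrow> (int ^ 'd) set \<Rightarrow> bool" where
  "nn_component G Y \<longleftrightarrow>
     (\<exists>z\<in>G. Y = {w. (z, w) \<in> {(u, v). u \<in> G \<and> v \<in> G \<and> nn_adjacent u v}\<^sup>*})"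

definition projective_component ::
  "('d::finite, 'a) config set \<Rightarrow> ('d, 'a) config \<Rightarrow> nat \<Rightarrow> (int ^ 'd) set \<Rightarrow> bool" where
  "projective_component \<AA> a r Y \<longleftrightarrow>
     nn_component (good \<AA> a r) Y \<and> (\<forall>s\<ge>r. Y \<inter> good \<AA> a s \<noteq> {})"

definition lattice_pt :: "int ^ ('d::finite) \<Rightarrow> real ^ 'd" where
  "lattice_pt z = (\<chi> i. real_of_int (z $ i))"

definition unit_cube :: "int ^ ('d::finite) \<Rightarrow> (real ^ 'd) set" where
  "unit_cube z = {p. \<forall>i. real_of_int (z $ i) \<le> p $ i \<and> p $ i \<le> real_of_int (z $ i) + 1}"

definition corners :: "int ^ ('d::finite) \<Rightarrow> (int ^ 'd) set" where
  "corners z = {w. \<forall>i. w $ i = z $ i \<or> w $ i = z $ i + 1}"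

text \<open>This union is locally finite, hence closed; edges and faces lying in no full cube are absent.\<close>

definition cube_union :: "(int ^ ('d::finite)) set \<Rightarrow> (real ^ 'd) set" where
  "cube_union Y = lattice_pt ` Y \<union> \<Union> (unit_cube ` {z. corners z \<subseteq> Y})"


section \<open>Homotopy groups\<close>

text \<open>
  \<open>\<pi>\<^sub>k(X, x)\<close>, for \<open>k \<ge> 1\<close>: maps of the \<open>k\<close>-cube sending its boundary to \<open>x\<close>, modulo homotopy
  relative to the boundary, multiplied by concatenation in the coordinate \<open>0\<close>.
\<close>

definition kcube :: "nat \<Rightarrow> (nat \<Rightarrow> real) topology" where
  "kcube k = product_topology (\<lambda>_. top_of_set {0..1}) {..<k}"

definition kcube_bd :: "nat \<Rightarrow> (nat \<Rightarrow> real) set" where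
  "kcube_bd k = {u \<in> topspace (kcube k). \<exists>i<k. u i = 0 \<or> u i = 1}"

definition spheroid :: "nat \<Rightarrow> 'x topology \<Rightarrow> 'x \<Rightarrow> ((nat \<Rightarrow> real) \<Rightarrow> 'x) \<Rightarrow> bool" where
  "spheroid k X x f \<longleftrightarrow> continuous_map (kcube k) X f \<and> (\<forall>u\<in>kcube_bd k. f u = x)"

definition spheroid_class ::
  "nat \<Rightarrow> 'x topology \<Rightarrow> 'x \<Rightarrow> ((nat \<Rightarrow> real) \<Rightarrow> 'x) \<Rightarrow> ((nat \<Rightarrow> real) \<Rightarrow> 'x) set" where
  "spheroid_class k X x f =
     {g. homotopic_with (\<lambda>h. \<forall>u\<in>kcube_bd k. h u = x) (kcube k) X f g}"

definition spheroid_concat ::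
  "((nat \<Rightarrow> real) \<Rightarrow> 'x) \<Rightarrow> ((nat \<Rightarrow> real) \<Rightarrow> 'x) \<Rightarrow> (nat \<Rightarrow> real) \<Rightarrow> 'x" where
  "spheroid_concat f g u =
     (if u 0 \<le> 1/2 then f (u(0 := 2 * u 0)) else g (u(0 := 2 * u 0 - 1)))"

definition homotopy_group ::
  "nat \<Rightarrow> 'x topology \<Rightarrow> 'x \<Rightarrow> ((nat \<Rightarrow> real) \<Rightarrow> 'x) set monoid" where
  "homotopy_group k X x =
     \<lparr>carrier = spheroid_class k X x ` Collect (spheroid k X x),
      mult = (\<lambda>A B. \<Union>f\<in>A. \<Union>g\<in>B. spheroid_class k X x (spheroid_concat f g)),
      one = spheroid_class k X x (\<lambda>_. x)\<rparr>"

text \<open>The map induced by \<open>f\<close> on homotopy groups; \<open>Y\<close> and \<open>y\<close> are the target and its base point.\<close>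

definition homotopy_induced ::
  "nat \<Rightarrow> 'y topology \<Rightarrow> 'y \<Rightarrow> ('x \<Rightarrow> 'y) \<Rightarrow>
   ((nat \<Rightarrow> real) \<Rightarrow> 'x) set \<Rightarrow> ((nat \<Rightarrow> real) \<Rightarrow> 'y) set" where
  "homotopy_induced k Y y f A = (\<Union>g\<in>A. spheroid_class k Y y (f \<circ> g))"

text \<open>
  The change-of-base-point isomorphism \<open>\<pi>\<^sub>k(X, \<gamma> 0) \<rightarrow> \<pi>\<^sub>k(X, \<gamma> 1)\<close>: the image of a class consists of
  the maps freely homotopic to its members, the boundary of the cube moving along \<open>\<gamma>\<close>.
\<close>

definition homotopy_transport ::
  "nat \<Rightarrow> 'x topology \<Rightarrow> (real \<Rightarrow> 'x) \<Rightarrow>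
   ((nat \<Rightarrow> real) \<Rightarrow> 'x) set \<Rightarrow> ((nat \<Rightarrow> real) \<Rightarrow> 'x) set" where
  "homotopy_transport k X \<gamma> A =
     {g. \<exists>f\<in>A. \<exists>H. continuous_map (prod_topology (top_of_set {0..1}) (kcube k)) X H \<and>
           (\<forall>u\<in>topspace (kcube k). H (0, u) = f u \<and> H (1, u) = g u) \<and>
           (\<forall>t\<in>{0..1}. \<forall>u\<in>kcube_bd k. H (t, u) = \<gamma> t)}"


section \<open>Singular homology and cohomology with coefficients\<close>

text \<open>
  The coefficient group is the type \<^typ>\<open>'g\<close> of class \<^class>\<open>ab_group_add\<close>.  A chain is a finitely
  supported function from singular simplices to \<^typ>\<open>'g\<close>.
\<close>

type_synonym ('x, 'g) gchain = "((nat \<Rightarrow> real) \<Rightarrow> 'x) \<Rightarrow>\<^sub>0 'g"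

type_synonym ('x, 'g) gcochain = "((nat \<Rightarrow> real) \<Rightarrow> 'x) \<Rightarrow> 'g"

definition alt_sign :: "nat \<Rightarrow> 'g::ab_group_add \<Rightarrow> 'g" where
  "alt_sign i x = (if even i then x else - x)"

definition gchains :: "nat \<Rightarrow> 'x topology \<Rightarrow> ('x, 'g::ab_group_add) gchain set" where
  "gchains p X = {c. Poly_Mapping.keys c \<subseteq> singular_simplex_set p X}"

definition gboundary :: "nat \<Rightarrow> ('x, 'g::ab_group_add) gchain \<Rightarrow> ('x, 'g) gchain" where
  "gboundary p c =
     (if p = 0 then 0
      else \<Sum>s\<in>Poly_Mapping.keys c. \<Sum>i\<le>p.
             Poly_Mapping.single (singular_face p i s) (alt_sign i (Poly_Mapping.lookup c s)))"

definition gcycle_group :: "nat \<Rightarrow> 'x topology \<Rightarrow> ('x, 'g::ab_group_add) gchain monoid" where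
  "gcycle_group p X =
     \<lparr>carrier = {c \<in> gchains p X. gboundary p c = 0}, mult = (+), one = 0\<rparr>"

definition gboundaries :: "nat \<Rightarrow> 'x topology \<Rightarrow> ('x, 'g::ab_group_add) gchain set" where
  "gboundaries p X = gboundary (Suc p) ` gchains (Suc p) X"

definition homology_coeff ::
  "nat \<Rightarrow> 'x topology \<Rightarrow> ('x, 'g::ab_group_add) gchain set monoid" where
  "homology_coeff p X = gcycle_group p X Mod gboundaries p X"

definition gchain_map ::
  "nat \<Rightarrow> ('x \<Rightarrow> 'y) \<Rightarrow> ('x, 'g::ab_group_add) gchain \<Rightarrow> ('y, 'g) gchain" where
  "gchain_map p f c =
     (\<Sum>s\<in>Poly_Mapping.keys c. Poly_Mapping.single (simplex_map p f s) (Poly_Mapping.lookup c s))"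

text \<open>Here \<open>Y\<close> is the target space; the argument \<open>A\<close> is a coset of boundaries of the source.\<close>

definition homology_induced ::
  "nat \<Rightarrow> 'y topology \<Rightarrow> ('x \<Rightarrow> 'y) \<Rightarrow>
   ('x, 'g::ab_group_add) gchain set \<Rightarrow> ('y, 'g) gchain set" where
  "homology_induced p Y f A = {b + gchain_map p f c | b c. b \<in> gboundaries p Y \<and> c \<in> A}"

text \<open>Cochains are normalized to vanish off the singular simplices of the space.\<close>

definition gcochains :: "nat \<Rightarrow> 'x topology \<Rightarrow> ('x, 'g::ab_group_add) gcochain set" where
  "gcochains p X = {\<phi>. \<forall>s. \<not> singular_simplex p X s \<longrightarrow> \<phi> s = 0}"

definition gcoboundary ::
  "nat \<Rightarrow> 'x topology \<Rightarrow> ('x, 'g::ab_group_add) gcochain \<Rightarrow> ('x, 'g) gcochain" where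
  "gcoboundary p X \<phi> =
     (\<lambda>s. if singular_simplex (Suc p) X s
          then \<Sum>i\<le>Suc p. alt_sign i (\<phi> (singular_face (Suc p) i s)) else 0)"

definition gcocycle_group ::
  "nat \<Rightarrow> 'x topology \<Rightarrow> ('x, 'g::ab_group_add) gcochain monoid" where
  "gcocycle_group p X =
     \<lparr>carrier = {\<phi> \<in> gcochains p X. gcoboundary p X \<phi> = (\<lambda>_. 0)},
      mult = (\<lambda>\<phi> \<psi> s. \<phi> s + \<psi> s), one = (\<lambda>_. 0)\<rparr>"

definition gcoboundaries :: "nat \<Rightarrow> 'x topology \<Rightarrow> ('x, 'g::ab_group_add) gcochain set" where
  "gcoboundaries p X =
     (case p of 0 \<Rightarrow> {\<lambda>_. 0} | Suc n \<Rightarrow> gcoboundary n X ` gcochains n X)"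

definition cohomology_coeff ::
  "nat \<Rightarrow> 'x topology \<Rightarrow> ('x, 'g::ab_group_add) gcochain set monoid" where
  "cohomology_coeff p X = gcocycle_group p X Mod gcoboundaries p X"

definition gcochain_pullback ::
  "nat \<Rightarrow> 'x topology \<Rightarrow> ('x \<Rightarrow> 'y) \<Rightarrow> ('y, 'g::ab_group_add) gcochain \<Rightarrow> ('x, 'g) gcochain" where
  "gcochain_pullback p X f \<phi> = (\<lambda>s. if singular_simplex p X s then \<phi> (simplex_map p f s) else 0)"

text \<open>Here \<open>X\<close> is the source of \<open>f\<close>, hence the target of the induced map.\<close>

definition cohomology_induced ::
  "nat \<Rightarrow> 'x topology \<Rightarrow> ('x \<Rightarrow> 'y) \<Rightarrow>
   ('y, 'g::ab_group_add) gcochain set \<Rightarrow> ('x, 'g) gcochain set" where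
  "cohomology_induced p X f A =
     {(\<lambda>s. \<beta> s + gcochain_pullback p X f \<phi> s) | \<beta> \<phi>. \<beta> \<in> gcoboundaries p X \<and> \<phi> \<in> A}"


section \<open>Sequential limits of groups\<close>

text \<open>Limits over the indices \<open>r \<ge> N\<close>, the bonding maps being \<open>f r : G (Suc r) \<rightarrow> G r\<close>.\<close>

definition proj_lim ::
  "nat \<Rightarrow> (nat \<Rightarrow> 'b monoid) \<Rightarrow> (nat \<Rightarrow> 'b \<Rightarrow> 'b) \<Rightarrow> (nat \<Rightarrow> 'b) monoid" where
  "proj_lim N G f =
     (product_group {N..} G)
       \<lparr>carrier := {x \<in> carrier (product_group {N..} G). \<forall>r\<ge>N. f r (x (Suc r)) = x r}\<rparr>"

text \<open>
  For direct limits the bonding maps are \<open>f r : G r \<rightarrow> G (Suc r)\<close>; \<open>bond f r n\<close> is the composite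
  \<open>G r \<rightarrow> G (r + n)\<close>, and \<open>ind_class N G f r x\<close> is the element of the limit represented by
  \<open>x \<in> G r\<close>, as a set of pairs (level, representative).
\<close>

primrec bond :: "(nat \<Rightarrow> 'b \<Rightarrow> 'b) \<Rightarrow> nat \<Rightarrow> nat \<Rightarrow> 'b \<Rightarrow> 'b" where
  "bond f r 0 x = x"
| "bond f r (Suc n) x = f (r + n) (bond f r n x)"

definition ind_class ::
  "nat \<Rightarrow> (nat \<Rightarrow> 'b monoid) \<Rightarrow> (nat \<Rightarrow> 'b \<Rightarrow> 'b) \<Rightarrow> nat \<Rightarrow> 'b \<Rightarrow> (nat \<times> 'b) set" where
  "ind_class N G f r x =
     {(s, y). s \<ge> N \<and> y \<in> carrier (G s) \<and> (\<exists>m n. r + m = s + n \<and> bond f r m x = bond f s n y)}"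

definition ind_lim ::
  "nat \<Rightarrow> (nat \<Rightarrow> 'b monoid) \<Rightarrow> (nat \<Rightarrow> 'b \<Rightarrow> 'b) \<Rightarrow> (nat \<times> 'b) set monoid" where
  "ind_lim N G f =
     \<lparr>carrier = {ind_class N G f r x | r x. r \<ge> N \<and> x \<in> carrier (G r)},
      mult = (\<lambda>A B. \<Union>{ind_class N G f r (x \<otimes>\<^bsub>G r\<^esub> y) | r x y. (r, x) \<in> A \<and> (r, y) \<in> B}),
      one = ind_class N G f N \<one>\<^bsub>G N\<^esub>\<rparr>"


section \<open>Tile complexes\<close>

definition quotient_topology :: "'x topology \<Rightarrow> ('x \<times> 'x) set \<Rightarrow> 'x set topology" where
  "quotient_topology X E =
     topology (\<lambda>U. U \<subseteq> topspace X // E \<and> openin X {x \<in> topspace X. E `` {x} \<in> U})"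

lemma openin_quotient_topology:
  "openin (quotient_topology X E) U \<longleftrightarrow>
     U \<subseteq> topspace X // E \<and> openin X {x \<in> topspace X. E `` {x} \<in> U}"
proof -
  have "istopology (\<lambda>U. U \<subseteq> topspace X // E \<and> openin X {x \<in> topspace X. E `` {x} \<in> U})"
    unfolding istopology_def
  proof (rule conjI; intro allI impI conjI)
    fix S T assume S: "S \<subseteq> topspace X // E \<and> openin X {x \<in> topspace X. E `` {x} \<in> S}"
      and T: "T \<subseteq> topspace X // E \<and> openin X {x \<in> topspace X. E `` {x} \<in> T}"
    have "{x \<in> topspace X. E `` {x} \<in> S \<inter> T} =
        {x \<in> topspace X. E `` {x} \<in> S} \<inter> {x \<in> topspace X. E `` {x} \<in> T}"
      by auto
    with S T show "openin X {x \<in> topspace X. E `` {x} \<in> S \<inter> T}"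
      by auto
    show "S \<inter> T \<subseteq> topspace X // E" using S by auto
  next
    fix K assume K: "\<forall>S\<in>K. S \<subseteq> topspace X // E \<and> openin X {x \<in> topspace X. E `` {x} \<in> S}"
    have "{x \<in> topspace X. E `` {x} \<in> \<Union>K} = (\<Union>S\<in>K. {x \<in> topspace X. E `` {x} \<in> S})"
      by auto
    with K show "openin X {x \<in> topspace X. E `` {x} \<in> \<Union>K}"
      by auto
    show "\<Union>K \<subseteq> topspace X // E" using K by auto
  qed
  then show ?thesis
    by (simp add: quotient_topology_def topology_inverse')
qed

text \<open>
  A point of the disjoint union of the cubes \<open>\<box>\<^sub>z c\<close> is a pair \<open>((z, c), p)\<close> with
  \<open>p \<in> z + [0,1]\<^sup>D\<close>; a point of \<open>X\<^sub>r\<close> is an equivalence class of such pairs.  As \<open>p\<close> is an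
  absolute position, gluing identifies pairs with the same \<open>p\<close>.
\<close>

type_synonym ('d, 'a) tile_pt = "((int ^ 'd) \<times> ('d, 'a) config) \<times> (real ^ 'd)"

definition upper_box :: "('d::finite) \<Rightarrow> nat \<Rightarrow> (int ^ 'd) set" where
  "upper_box i r = {u \<in> lat_box r. u $ i > - int r}"

definition tile_sum :: "('d::finite, 'a) config set \<Rightarrow> nat \<Rightarrow> ('d, 'a) tile_pt topology" where
  "tile_sum \<AA> r = sum_topology (\<lambda>(z, c). top_of_set (unit_cube z)) (UNIV \<times> patterns \<AA> r)"

text \<open>Translating the index set by \<open>-e\<^sub>i\<close> maps \<open>\<partial>\<^sub>i\<^sup>+ B(r)\<close> onto \<open>\<partial>\<^sub>i\<^sup>- B(r)\<close>.\<close>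

definition tile_glue :: "('d::finite, 'a) config set \<Rightarrow> nat \<Rightarrow> (('d, 'a) tile_pt \<times> ('d, 'a) tile_pt) set" where
  "tile_glue \<AA> r =
     {(((z, c), p), ((z + axis i 1, c'), p)) | z c c' p i.
        c \<in> patterns \<AA> r \<and> c' \<in> patterns \<AA> r \<and>
        p \<in> unit_cube z \<and> p $ i = real_of_int (z $ i) + 1 \<and>
        (\<forall>u\<in>upper_box i r. c u = c' (u - axis i 1))}"

definition tile_eq :: "('d::finite, 'a) config set \<Rightarrow> nat \<Rightarrow> (('d, 'a) tile_pt \<times> ('d, 'a) tile_pt) set" where
  "tile_eq \<AA> r = (tile_glue \<AA> r \<union> (tile_glue \<AA> r)\<inverse>)\<^sup>*"

definition tile_complex :: "('d::finite, 'a) config set \<Rightarrow> nat \<Rightarrow> ('d, 'a) tile_pt set topology" where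
  "tile_complex \<AA> r = quotient_topology (tile_sum \<AA> r) (tile_eq \<AA> r)"

definition tile_proj :: "('d::finite, 'a) tile_pt set \<Rightarrow> real ^ 'd" where
  "tile_proj S = the_elem (snd ` S)"

definition tile_vertices :: "('d::finite, 'a) config set \<Rightarrow> nat \<Rightarrow> ('d, 'a) tile_pt set set" where
  "tile_vertices \<AA> r =
     {tile_eq \<AA> r `` {((z, c), lattice_pt w)} | z c w. c \<in> patterns \<AA> r \<and> w \<in> corners z}"

definition tile_base :: "('d::finite, 'a) config set \<Rightarrow> nat \<Rightarrow> ('d, 'a) config \<Rightarrow> ('d, 'a) tile_pt set" where
  "tile_base \<AA> r c = tile_eq \<AA> r `` {((0, restrict c (lat_box r)), 0)}"

text \<open>
  The representatives offered for \<open>p\<close> are all glued to one another, so this is a single class.  The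
  second alternative covers the points of \<open>\<GG>\<^sub>r(a)\<close> that are not a corner of any full cube.
\<close>

definition tile_section ::
  "('d::finite, 'a) config set \<Rightarrow> ('d, 'a) config \<Rightarrow> nat \<Rightarrow> real ^ 'd \<Rightarrow> ('d, 'a) tile_pt set" where
  "tile_section \<AA> a r p =
     tile_eq \<AA> r `` {((z, pattern_at a z r), p) | z.
        (corners z \<subseteq> good \<AA> a r \<and> p \<in> unit_cube z) \<or> (z \<in> good \<AA> a r \<and> p = lattice_pt z)}"

text \<open>
  The map \<open>X\<^sub>s \<rightarrow> X\<^sub>r\<close>, for any \<open>s \<ge> r\<close>, that restricts the patterns to \<open>B(r)\<close>; it is \<open>\<zeta>\<^sub>r\<close> for
  \<open>s = r + 1\<close>.
\<close>

definition tile_zeta ::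
  "('d::finite, 'a) config set \<Rightarrow> nat \<Rightarrow> ('d, 'a) tile_pt set \<Rightarrow> ('d, 'a) tile_pt set" where
  "tile_zeta \<AA> r S = tile_eq \<AA> r `` ((\<lambda>((z, c), p). ((z, restrict c (lat_box r)), p)) ` S)"

text \<open>
  The map \<open>\<Phi>\<^sub>* : X\<^bsub>r+q\<^esub> \<rightarrow> X\<^sub>r\<close>.  A pattern \<open>c\<close> on \<open>B(r+q)\<close> is itself a configuration (constantly
  \<^const>\<open>undefined\<close> outside), and if \<open>\<Phi>\<close> has radius \<open>q\<close> then \<open>\<Phi>(c)\<close> on \<open>B(r)\<close> depends
  on \<open>c\<close> on \<open>B(r+q)\<close> only.
\<close>

definition tile_ca ::
  "(('d::finite, 'a) config \<Rightarrow> ('d, 'a) config) \<Rightarrow> ('d, 'a) config set \<Rightarrow> nat \<Rightarrow>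
   ('d, 'a) tile_pt set \<Rightarrow> ('d, 'a) tile_pt set" where
  "tile_ca \<Phi> \<AA> r S = tile_eq \<AA> r `` ((\<lambda>((z, c), p). ((z, restrict (\<Phi> c) (lat_box r)), p)) ` S)"


section \<open>Groups of a subshift of finite type\<close>

text \<open>\<open>R\<close> is the radius of \<open>\<AA>\<close>; the limits run over \<open>r \<ge> R\<close>.\<close>

definition pi_subshift ::
  "nat \<Rightarrow> ('d::finite, 'a) config set \<Rightarrow> nat \<Rightarrow> ('d, 'a) config \<Rightarrow>
   (nat \<Rightarrow> ((nat \<Rightarrow> real) \<Rightarrow> ('d, 'a) tile_pt set) set) monoid" where
  "pi_subshift R \<AA> k c =
     proj_lim R (\<lambda>r. homotopy_group k (tile_complex \<AA> r) (tile_base \<AA> r c))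
       (\<lambda>r. homotopy_induced k (tile_complex \<AA> r) (tile_base \<AA> r c) (tile_zeta \<AA> r))"

definition homology_subshift ::
  "nat \<Rightarrow> ('d::finite, 'a) config set \<Rightarrow> nat \<Rightarrow>
   (nat \<Rightarrow> (('d, 'a) tile_pt set, 'g::ab_group_add) gchain set) monoid" where
  "homology_subshift R \<AA> k =
     proj_lim R (\<lambda>r. homology_coeff k (tile_complex \<AA> r))
       (\<lambda>r. homology_induced k (tile_complex \<AA> r) (tile_zeta \<AA> r))"

abbreviation cohomology_tile ::
  "('d::finite, 'a) config set \<Rightarrow> nat \<Rightarrow> nat \<Rightarrow>
   (('d, 'a) tile_pt set, 'g::ab_group_add) gcochain set monoid" where
  "cohomology_tile \<AA> k r \<equiv> cohomology_coeff k (tile_complex \<AA> r)"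

abbreviation cohomology_zeta ::
  "('d::finite, 'a) config set \<Rightarrow> nat \<Rightarrow> nat \<Rightarrow>
   (('d, 'a) tile_pt set, 'g::ab_group_add) gcochain set \<Rightarrow>
   (('d, 'a) tile_pt set, 'g) gcochain set" where
  "cohomology_zeta \<AA> k r \<equiv> cohomology_induced k (tile_complex \<AA> (Suc r)) (tile_zeta \<AA> r)"

definition cohomology_subshift ::
  "nat \<Rightarrow> ('d::finite, 'a) config set \<Rightarrow> nat \<Rightarrow>
   (nat \<times> (('d, 'a) tile_pt set, 'g::ab_group_add) gcochain set) set monoid" where
  "cohomology_subshift R \<AA> k = ind_lim R (cohomology_tile \<AA> k) (cohomology_zeta \<AA> k)"

definition basepoint_free :: "nat \<Rightarrow> ('d::finite, 'a) config set \<Rightarrow> nat \<Rightarrow> bool" where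
  "basepoint_free R \<AA> k \<longleftrightarrow>
     (\<exists>r0\<ge>R. \<forall>r\<ge>r0. inj_on tile_proj (tile_vertices \<AA> r)) \<or>
     (weakly_mixing \<AA> \<and> k = 1 \<and> (\<forall>c\<in>\<AA>. comm_group (pi_subshift R \<AA> 1 c))) \<or>
     (weakly_mixing \<AA> \<and> (\<forall>c\<in>\<AA>. trivial_group (pi_subshift R \<AA> 1 c)))"

text \<open>
  The maps induced by a cellular automaton of radius \<open>q\<close>; on homotopy the map is
  \<open>\<pi>\<^sub>k(\<AA>, c) \<rightarrow> \<pi>\<^sub>k(\<AA>, \<Phi>(c))\<close>.
\<close>

definition pi_ca ::
  "nat \<Rightarrow> (('d::finite, 'a) config \<Rightarrow> ('d, 'a) config) \<Rightarrow> nat \<Rightarrow> ('d, 'a) config set \<Rightarrow> nat \<Rightarrow>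
   ('d, 'a) config \<Rightarrow>
   (nat \<Rightarrow> ((nat \<Rightarrow> real) \<Rightarrow> ('d, 'a) tile_pt set) set) \<Rightarrow>
   (nat \<Rightarrow> ((nat \<Rightarrow> real) \<Rightarrow> ('d, 'a) tile_pt set) set)" where
  "pi_ca q \<Phi> R \<AA> k c x =
     (\<lambda>r\<in>{R..}. homotopy_induced k (tile_complex \<AA> r) (tile_base \<AA> r (\<Phi> c)) (tile_ca \<Phi> \<AA> r)
                  (x (r + q)))"

definition homology_ca ::
  "nat \<Rightarrow> (('d::finite, 'a) config \<Rightarrow> ('d, 'a) config) \<Rightarrow> nat \<Rightarrow> ('d, 'a) config set \<Rightarrow> nat \<Rightarrow>
   (nat \<Rightarrow> (('d, 'a) tile_pt set, 'g::ab_group_add) gchain set) \<Rightarrow>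
   (nat \<Rightarrow> (('d, 'a) tile_pt set, 'g) gchain set)" where
  "homology_ca q \<Phi> R \<AA> k x =
     (\<lambda>r\<in>{R..}. homology_induced k (tile_complex \<AA> r) (tile_ca \<Phi> \<AA> r) (x (r + q)))"

definition cohomology_ca ::
  "nat \<Rightarrow> (('d::finite, 'a) config \<Rightarrow> ('d, 'a) config) \<Rightarrow> nat \<Rightarrow> ('d, 'a) config set \<Rightarrow> nat \<Rightarrow>
   (nat \<times> (('d, 'a) tile_pt set, 'g::ab_group_add) gcochain set) set \<Rightarrow>
   (nat \<times> (('d, 'a) tile_pt set, 'g) gcochain set) set" where
  "cohomology_ca q \<Phi> R \<AA> k A =
     (\<Union>(r, x)\<in>A. ind_class R (cohomology_tile \<AA> k) (cohomology_zeta \<AA> k) (r + q)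
                    (cohomology_induced k (tile_complex \<AA> (r + q)) (tile_ca \<Phi> \<AA> r) x))"


section \<open>Groups of the unbounded part of a configuration\<close>

abbreviation good_space :: "('d::finite, 'a) config set \<Rightarrow> ('d, 'a) config \<Rightarrow> nat \<Rightarrow> (real ^ 'd) topology" where
  "good_space \<AA> a r \<equiv> top_of_set (cube_union (good \<AA> a r))"

definition unique_projective_component ::
  "('d::finite, 'a) config set \<Rightarrow> ('d, 'a) config \<Rightarrow> nat \<Rightarrow> (int ^ 'd) set \<Rightarrow> bool" where
  "unique_projective_component \<AA> a r0 Y \<longleftrightarrow>
     projective_component \<AA> a r0 Y \<and> (\<forall>Y'. projective_component \<AA> a r0 Y' \<longrightarrow> Y' = Y)"

definition proper_base_ray :: "(int ^ ('d::finite)) set \<Rightarrow> (real \<Rightarrow> real ^ 'd) \<Rightarrow> bool" where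
  "proper_base_ray Y \<omega> \<longleftrightarrow>
     continuous_on {0..} \<omega> \<and> \<omega> ` {0..} \<subseteq> cube_union Y \<and>
     filterlim (\<lambda>t. norm (\<omega> t)) at_top at_top"

text \<open>
  A choice of base points \<open>y\<^sub>r = \<omega> (\<tau> r) \<in> Y\<^sub>r\<close>, where \<open>Y\<^sub>r = Y \<inter> \<GG>\<^sub>r(a)\<close> and \<open>r > r0\<close>.  Comparing
  the groups of consecutive levels requires the part of the ray between \<open>y\<^bsub>r+1\<^esub>\<close> and \<open>y\<^sub>r\<close> to lie
  in the cube union of \<open>Y\<^sub>r\<close>.
\<close>

definition base_times ::
  "('d::finite, 'a) config set \<Rightarrow> ('d, 'a) config \<Rightarrow> nat \<Rightarrow> (int ^ 'd) set \<Rightarrow>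
   (real \<Rightarrow> real ^ 'd) \<Rightarrow> (nat \<Rightarrow> real) \<Rightarrow> bool" where
  "base_times \<AA> a r0 Y \<omega> \<tau> \<longleftrightarrow>
     (\<forall>r>r0. 0 \<le> \<tau> r \<and> \<omega> (\<tau> r) \<in> lattice_pt ` (Y \<inter> good \<AA> a r) \<and>
        \<omega> ` closed_segment (\<tau> (Suc r)) (\<tau> r) \<subseteq> cube_union (Y \<inter> good \<AA> a r))"

text \<open>
  \<open>\<pi>\<^sub>k[\<GG>\<^sub>\<infinity>(a), \<omega>]\<close>.  The bonding map is the inclusion, followed by the change of base point from
  \<open>y\<^bsub>r+1\<^esub>\<close> to \<open>y\<^sub>r\<close> along the ray.
\<close>

definition pi_good ::
  "('d::finite, 'a) config set \<Rightarrow> ('d, 'a) config \<Rightarrow> nat \<Rightarrow> nat \<Rightarrow> (int ^ 'd) set \<Rightarrow>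
   (real \<Rightarrow> real ^ 'd) \<Rightarrow> (nat \<Rightarrow> real) \<Rightarrow>
   (nat \<Rightarrow> ((nat \<Rightarrow> real) \<Rightarrow> real ^ 'd) set) monoid" where
  "pi_good \<AA> a k r0 Y \<omega> \<tau> =
     proj_lim (Suc r0)
       (\<lambda>r. homotopy_group k (top_of_set (cube_union (Y \<inter> good \<AA> a r))) (\<omega> (\<tau> r)))
       (\<lambda>r A. homotopy_transport k (top_of_set (cube_union (Y \<inter> good \<AA> a r)))
                (\<lambda>t. \<omega> ((1 - t) * \<tau> (Suc r) + t * \<tau> r))
                (homotopy_induced k (top_of_set (cube_union (Y \<inter> good \<AA> a r)))
                   (\<omega> (\<tau> (Suc r))) (\<lambda>p. p) A))"

definition homology_good ::
  "('d::finite, 'a) config set \<Rightarrow> ('d, 'a) config \<Rightarrow> nat \<Rightarrow>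
   (nat \<Rightarrow> (real ^ 'd, 'g::ab_group_add) gchain set) monoid" where
  "homology_good \<AA> a k =
     proj_lim 0 (\<lambda>r. homology_coeff k (good_space \<AA> a r))
       (\<lambda>r. homology_induced k (good_space \<AA> a r) (\<lambda>p. p))"

abbreviation cohomology_good_level ::
  "('d::finite, 'a) config set \<Rightarrow> ('d, 'a) config \<Rightarrow> nat \<Rightarrow> nat \<Rightarrow>
   (real ^ 'd, 'g::ab_group_add) gcochain set monoid" where
  "cohomology_good_level \<AA> a k r \<equiv> cohomology_coeff k (good_space \<AA> a r)"

abbreviation cohomology_good_bond ::
  "('d::finite, 'a) config set \<Rightarrow> ('d, 'a) config \<Rightarrow> nat \<Rightarrow> nat \<Rightarrow>
   (real ^ 'd, 'g::ab_group_add) gcochain set \<Rightarrow> (real ^ 'd, 'g) gcochain set" where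
  "cohomology_good_bond \<AA> a k r \<equiv> cohomology_induced k (good_space \<AA> a (Suc r)) (\<lambda>p. p)"

definition cohomology_good ::
  "('d::finite, 'a) config set \<Rightarrow> ('d, 'a) config \<Rightarrow> nat \<Rightarrow>
   (nat \<times> (real ^ 'd, 'g::ab_group_add) gcochain set) set monoid" where
  "cohomology_good \<AA> a k = ind_lim 0 (cohomology_good_level \<AA> a k) (cohomology_good_bond \<AA> a k)"

text \<open>
  The data exhibiting a defect of projective codimension \<open>k + 1\<close>, where \<open>k \<ge> 1\<close>.
\<close>

definition projective_defect_data ::
  "('d::finite, 'a) config set \<Rightarrow> ('d, 'a) config \<Rightarrow> nat \<Rightarrow> nat \<Rightarrow> (int ^ 'd) set \<Rightarrow>
   (real \<Rightarrow> real ^ 'd) \<Rightarrow> (nat \<Rightarrow> real) \<Rightarrow> bool" where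
  "projective_defect_data \<AA> a k r0 Y \<omega> \<tau> \<longleftrightarrow>
     unique_projective_component \<AA> a r0 Y \<and> proper_base_ray Y \<omega> \<and> base_times \<AA> a r0 Y \<omega> \<tau> \<and>
     carrier (pi_good \<AA> a k r0 Y \<omega> \<tau>) \<noteq> {\<one>\<^bsub>pi_good \<AA> a k r0 Y \<omega> \<tau>\<^esub>}"

definition projective_defect :: "('d::finite, 'a) config set \<Rightarrow> ('d, 'a) config \<Rightarrow> nat \<Rightarrow> bool" where
  "projective_defect \<AA> a k \<longleftrightarrow> (\<exists>r0 Y \<omega> \<tau>. projective_defect_data \<AA> a k r0 Y \<omega> \<tau>)"


section \<open>Signatures\<close>

text \<open>
  At level \<open>s\<close> the section carries \<open>\<pi>\<^sub>k(Y\<^sub>s, y\<^sub>s)\<close> into \<open>\<pi>\<^sub>k(X\<^sub>s, \<varsigma>\<^sub>a\<^sup>s(y\<^sub>s))\<close>, which is identified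
  with \<open>\<pi>\<^sub>k(X\<^sub>s, x\<^sub>s(c))\<close> by the change of base point along a path \<open>p s\<close> in \<open>X\<^sub>s\<close>.
  The group \<open>\<pi>\<^sub>k(Y\<^sub>s, y\<^sub>s)\<close> is available for \<open>s > r0\<close> only, whereas \<open>\<pi>\<^sub>k(\<AA>, c)\<close> has components for
  all \<open>r \<ge> R\<close>; the component at a level \<open>r \<le> r0\<close> is the image of that at level \<open>r0 + 1\<close>.
\<close>

definition basepoint_paths ::
  "nat \<Rightarrow> ('d::finite, 'a) config set \<Rightarrow> ('d, 'a) config \<Rightarrow> nat \<Rightarrow> (real \<Rightarrow> real ^ 'd) \<Rightarrow> (nat \<Rightarrow> real) \<Rightarrow>
   ('d, 'a) config \<Rightarrow> (nat \<Rightarrow> real \<Rightarrow> ('d, 'a) tile_pt set) \<Rightarrow> bool" where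
  "basepoint_paths R \<AA> a r0 \<omega> \<tau> c p \<longleftrightarrow>
     (\<forall>s. R \<le> s \<and> r0 < s \<longrightarrow>
        pathin (tile_complex \<AA> s) (p s) \<and>
        p s 0 = tile_section \<AA> a s (\<omega> (\<tau> s)) \<and> p s 1 = tile_base \<AA> s c)"

definition pi_signature ::
  "nat \<Rightarrow> ('d::finite, 'a) config set \<Rightarrow> ('d, 'a) config \<Rightarrow> nat \<Rightarrow> nat \<Rightarrow> (real \<Rightarrow> real ^ 'd) \<Rightarrow> (nat \<Rightarrow> real) \<Rightarrow>
   ('d, 'a) config \<Rightarrow> (nat \<Rightarrow> real \<Rightarrow> ('d, 'a) tile_pt set) \<Rightarrow>
   (nat \<Rightarrow> ((nat \<Rightarrow> real) \<Rightarrow> real ^ 'd) set) \<Rightarrow>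
   (nat \<Rightarrow> ((nat \<Rightarrow> real) \<Rightarrow> ('d, 'a) tile_pt set) set)" where
  "pi_signature R \<AA> a k r0 \<omega> \<tau> c p x =
     (\<lambda>r\<in>{R..}. let s = max r (Suc r0) in
        homotopy_induced k (tile_complex \<AA> r) (tile_base \<AA> r c) (tile_zeta \<AA> r)
          (homotopy_transport k (tile_complex \<AA> s) (p s)
             (homotopy_induced k (tile_complex \<AA> s) (tile_section \<AA> a s (\<omega> (\<tau> s)))
                (tile_section \<AA> a s) (x s))))"

definition homology_signature ::
  "nat \<Rightarrow> ('d::finite, 'a) config set \<Rightarrow> ('d, 'a) config \<Rightarrow> nat \<Rightarrow>
   (nat \<Rightarrow> (real ^ 'd, 'g::ab_group_add) gchain set) \<Rightarrow>
   (nat \<Rightarrow> (('d, 'a) tile_pt set, 'g) gchain set)" where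
  "homology_signature R \<AA> a k x =
     (\<lambda>r\<in>{R..}. homology_induced k (tile_complex \<AA> r) (tile_section \<AA> a r) (x r))"

definition cohomology_signature ::
  "('d::finite, 'a) config set \<Rightarrow> ('d, 'a) config \<Rightarrow> nat \<Rightarrow>
   (nat \<times> (('d, 'a) tile_pt set, 'g::ab_group_add) gcochain set) set \<Rightarrow>
   (nat \<times> (real ^ 'd, 'g) gcochain set) set" where
  "cohomology_signature \<AA> a k A =
     (\<Union>(r, x)\<in>A. ind_class 0 (cohomology_good_level \<AA> a k) (cohomology_good_bond \<AA> a k) r
                    (cohomology_induced k (good_space \<AA> a r) (tile_section \<AA> a r) x))"

text \<open>
  The paths \<open>p\<close> are the identification of the groups based at the points \<open>\<varsigma>\<^sub>a\<^sup>s(y\<^sub>s)\<close> with those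
  based at \<open>x\<^sub>s(c)\<close>; the membership in \<^const>\<open>hom\<close> says that under it the sections do induce a
  homomorphism of the limit groups.
\<close>

definition homotopy_defect :: "nat \<Rightarrow> ('d::finite, 'a) config set \<Rightarrow> nat \<Rightarrow> ('d, 'a) config \<Rightarrow> bool" where
  "homotopy_defect R \<AA> k a \<longleftrightarrow>
     a \<in> tilde \<AA> \<and>
     (\<exists>r0 Y \<omega> \<tau>. projective_defect_data \<AA> a k r0 Y \<omega> \<tau> \<and>
        (\<exists>c\<in>\<AA>. \<exists>p. basepoint_paths R \<AA> a r0 \<omega> \<tau> c p \<and>
           pi_signature R \<AA> a k r0 \<omega> \<tau> c p \<in> hom (pi_good \<AA> a k r0 Y \<omega> \<tau>) (pi_subshift R \<AA> k c) \<and>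
           (\<exists>x\<in>carrier (pi_good \<AA> a k r0 Y \<omega> \<tau>).
              pi_signature R \<AA> a k r0 \<omega> \<tau> c p x \<noteq> \<one>\<^bsub>pi_subshift R \<AA> k c\<^esub>)))"

text \<open>The argument of type \<^typ>\<open>'g itself\<close> is the coefficient group.\<close>

definition homology_defect ::
  "'g::ab_group_add itself \<Rightarrow> nat \<Rightarrow> ('d::finite, 'a) config set \<Rightarrow> nat \<Rightarrow> ('d, 'a) config \<Rightarrow> bool" where
  "homology_defect T R \<AA> k a \<longleftrightarrow>
     a \<in> tilde \<AA> \<and> projective_defect \<AA> a k \<and>
     (\<exists>x\<in>carrier (homology_good \<AA> a k :: (nat \<Rightarrow> (real ^ 'd, 'g) gchain set) monoid).
        homology_signature R \<AA> a k x \<noteq> \<one>\<^bsub>homology_subshift R \<AA> k\<^esub>)"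

definition cohomology_defect ::
  "'g::ab_group_add itself \<Rightarrow> nat \<Rightarrow> ('d::finite, 'a) config set \<Rightarrow> nat \<Rightarrow> ('d, 'a) config \<Rightarrow> bool" where
  "cohomology_defect T R \<AA> k a \<longleftrightarrow>
     a \<in> tilde \<AA> \<and> projective_defect \<AA> a k \<and>
     (\<exists>A\<in>carrier (cohomology_subshift R \<AA> k ::
            (nat \<times> (('d, 'a) tile_pt set, 'g) gcochain set) set monoid).
        cohomology_signature \<AA> a k A \<noteq> \<one>\<^bsub>cohomology_good \<AA> a k\<^esub>)"

end

theory Submission
  imports Defs
begin

text \<open>
  Suppose \<open>b = \<Phi>\<^sup>t(a)\<close> belongs to \<open>\<AA>\<close>.  Then all lattice points are good for \<open>b\<close>, and the sections of \<open>b\<close>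
  are defined on the whole contractible space \<open>\<real>\<^sup>D\<close>.  Since \<open>\<Phi>\<^sub>*\<close> maps the section of a configuration to the
  section of its image, the signature of \<open>a\<close> followed by \<open>\<Phi>\<^sub>*\<^sup>t\<close> factors through the section of \<open>b\<close>, hence
  is trivial.  But an injective \<open>\<Phi>\<^sub>*\<close> (a surjective \<open>\<Phi>\<^sup>*\<close> in the case of cohomology) preserves the
  nontriviality of the signature.
\<close>

section \<open>Patterns and good points\<close>

text \<open>The iterates are reached one step at a time, by an invariant that passes from
  \<open>a\<close> to \<open>\<Phi> a\<close> and fails on \<open>\<AA>\<close>. Being a defect of
  codimension k+1 is not a convenient invariant: it asks for a unique projective component, a base
  ray and base points, while good sets grow (level r+q of \<open>a\<close> lies in level r of
  \<open>\<Phi> a\<close>), so that new components and connections may appear. The invariant is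
  therefore the bare nontriviality of the signature over the whole good set; in homotopy, the
  existence of a nontrivial class freely homotopic to a map that factors through the section. The q
  levels lost at each step are absorbed by the limits. Contractibility of \<real>^D enters in two
  ways: homology and cohomology with arbitrary coefficients vanish in positive degrees, by coning
  simplices to the origin; and a sphere in it contracts freely, after which the free nullhomotopy of
  its image has to be made relative to the base point. In degree 0 the homology of a point is the
  coefficient group, so degrees start at 1.\<close>

lemma lat_box_mono: "r \<le> s \<Longrightarrow> lat_box r \<subseteq> lat_box s"
  by (auto simp: lat_box_def intro: order_trans)

lemma lat_box_add: "u \<in> lat_box r \<Longrightarrow> v \<in> lat_box q \<Longrightarrow> u + v \<in> lat_box (r + q)"
  unfolding lat_box_def
proof (intro CollectI allI)
  fix i assume "u \<in> {u. \<forall>i. \<bar>u $ i\<bar> \<le> int r}" "v \<in> {u. \<forall>i. \<bar>u $ i\<bar> \<le> int q}"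
  then have "\<bar>u $ i\<bar> \<le> int r" "\<bar>v $ i\<bar> \<le> int q" by auto
  then show "\<bar>(u + v) $ i\<bar> \<le> int (r + q)" by simp
qed

lemma upper_box_subset: "upper_box i r \<subseteq> lat_box r"
  by (auto simp: upper_box_def)

lemma lat_box_diff_axis:
  assumes "u \<in> upper_box i r"
  shows "u - axis i 1 \<in> lat_box r"
proof -
  have "\<bar>(u - axis i 1) $ j\<bar> \<le> int r" for j
  proof (cases "j = i")
    case True
    have "\<bar>u $ i\<bar> \<le> int r" "u $ i > - int r"
      using assms by (auto simp: upper_box_def lat_box_def)
    then show ?thesis by (simp add: True axis_def)
  next
    case False
    then show ?thesis using assms by (simp add: axis_def upper_box_def lat_box_def)
  qed
  then show ?thesis by (simp add: lat_box_def)
qed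

lemma upper_box_add:
  assumes "u \<in> upper_box i r" "v \<in> lat_box q"
  shows "u + v \<in> upper_box i (r + q)"
proof -
  have "\<bar>v $ i\<bar> \<le> int q" "u $ i > - int r"
    using assms by (auto simp: upper_box_def lat_box_def)
  moreover have "u + v \<in> lat_box (r + q)"
    using assms lat_box_add upper_box_subset by blast
  ultimately show ?thesis by (auto simp: upper_box_def)
qed

lemma upper_box_mono: "r \<le> s \<Longrightarrow> upper_box i r \<subseteq> upper_box i s"
  using lat_box_mono by (fastforce simp: upper_box_def)

lemma pattern_at_apply: "u \<in> lat_box r \<Longrightarrow> pattern_at a z r u = a (z + u)"
  by (simp add: pattern_at_def shift_def add.commute)

lemma restrict_patterns:
  assumes "c \<in> patterns \<AA> s" "r \<le> s"
  shows "restrict c (lat_box r) \<in> patterns \<AA> r"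
proof -
  obtain b where "b \<in> \<AA>" "c = restrict b (lat_box s)"
    using assms by (auto simp: patterns_def)
  moreover have "restrict (restrict b (lat_box s)) (lat_box r) = restrict b (lat_box r)" for b :: "('a, 'b) config"
    by (simp add: Int_absorb1 lat_box_mono assms(2))
  ultimately show ?thesis by (auto simp: patterns_def)
qed

lemma restrict_pattern_at:
  assumes "r \<le> s"
  shows "restrict (pattern_at a z s) (lat_box r) = pattern_at a z r"
  by (simp add: pattern_at_def Int_absorb1 lat_box_mono assms)

text \<open>Restricting an admissible pattern to a smaller box keeps it admissible, so the
  admissible radii form an initial segment and the supremum can be tested at \<open>r\<close>
  itself.\<close>

lemma good_iff: "z \<in> good \<AA> a r \<longleftrightarrow> pattern_at a z r \<in> patterns \<AA> r"
proof
  assume z: "z \<in> good \<AA> a r"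
  show "pattern_at a z r \<in> patterns \<AA> r"
  proof (rule ccontr)
    assume no: "pattern_at a z r \<notin> patterns \<AA> r"
    have lt: "s < r" if "pattern_at a z s \<in> patterns \<AA> s" for s
    proof (rule ccontr)
      assume "\<not> s < r"
      then show False
        using restrict_patterns[OF that, of r] restrict_pattern_at[of r s a z] no by simp
    qed
    \<comment> \<open>Admissible radii are naturals below \<open>r\<close>, hence at most r - 1. For
      r = 0 there are none, and the supremum is -\<infinity>.\<close>
    have "adm_radius \<AA> a z \<le> ereal (real r - 1)"
      unfolding adm_radius_def
    proof (rule SUP_least)
      fix s assume "s \<in> {s. pattern_at a z s \<in> patterns \<AA> s}"
      then have "s < r" using lt by simp
      then show "ereal (real s) \<le> ereal (real r - 1)" by simp
    qed
    moreover have "ereal (real r) \<le> adm_radius \<AA> a z"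
      using z by (simp add: good_def)
    ultimately have "ereal (real r) \<le> ereal (real r - 1)" by (rule order_trans[rotated])
    then show False by simp
  qed
next
  assume "pattern_at a z r \<in> patterns \<AA> r"
  then show "z \<in> good \<AA> a r"
    unfolding good_def adm_radius_def by (auto intro!: SUP_upper)
qed

lemma good_antimono: "r \<le> s \<Longrightarrow> good \<AA> a s \<subseteq> good \<AA> a r"
proof
  fix z assume "r \<le> s" "z \<in> good \<AA> a s"
  then have "ereal (real r) \<le> ereal (real s)" "ereal (real s) \<le> adm_radius \<AA> a z"
    by (auto simp: good_def)
  then show "z \<in> good \<AA> a r" unfolding good_def mem_Collect_eq by (rule order_trans)
qed

lemma good_eq_UNIV:
  assumes "subshift \<AA>" "a \<in> \<AA>"
  shows "good \<AA> a r = UNIV"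
proof -
  have "shift z a \<in> \<AA>" for z
    using assms by (auto simp: subshift_def)
  then show ?thesis
    by (auto simp: good_iff pattern_at_def patterns_def)
qed

text \<open>Replaces the supremum by a condition on each level, in which form the effect of
  \<open>\<Phi>\<close> follows from inclusions of good sets.\<close>

lemma mem_tilde_iff: "a \<in> tilde \<AA> \<longleftrightarrow> (\<forall>r. good \<AA> a r \<noteq> {})"
proof
  assume "a \<in> tilde \<AA>"
  then have sup: "(SUP z. adm_radius \<AA> a z) = \<infinity>" by (simp add: tilde_def)
  show "\<forall>r. good \<AA> a r \<noteq> {}"
  proof
    fix r
    have "ereal (real r) < (SUP z. adm_radius \<AA> a z)" by (simp add: sup)
    then obtain z where "ereal (real r) < adm_radius \<AA> a z" by (auto simp: less_SUP_iff)
    then show "good \<AA> a r \<noteq> {}" by (auto simp: good_def intro: less_imp_le)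
  qed
next
  assume ne: "\<forall>r. good \<AA> a r \<noteq> {}"
  have ge: "ereal (real r) \<le> (SUP z. adm_radius \<AA> a z)" for r
  proof -
    obtain z where "z \<in> good \<AA> a r" using ne by blast
    then show ?thesis by (auto simp: good_def intro: SUP_upper2)
  qed
  have "(SUP z. adm_radius \<AA> a z) = \<infinity>"
  proof (rule ereal_top)
    fix B :: real
    obtain r where "B \<le> real r" using real_arch_simple by blast
    then have "ereal B \<le> ereal (real r)" by simp
    then show "ereal B \<le> (SUP z. adm_radius \<AA> a z)" using ge order_trans by blast
  qed
  then show "a \<in> tilde \<AA>" by (simp add: tilde_def)
qed

section \<open>Local rules acting on patterns and good sets\<close>

text \<open>Two centres \<open>z\<close> and \<open>w\<close> are allowed because gluing compares a
  pattern with its translate by a unit vector.\<close>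

lemma has_radius_cong:
  assumes "has_radius \<Phi> q" "\<And>v. v \<in> lat_box q \<Longrightarrow> a (z + v) = b (w + v)"
  shows "\<Phi> a z = \<Phi> b w"
proof -
  obtain \<phi> where \<phi>: "\<And>a z. \<Phi> a z = \<phi> (pattern_at a z q)"
    using assms(1) unfolding has_radius_def by blast
  have "pattern_at a z q = pattern_at b w q"
    using assms(2) by (auto simp: pattern_at_def shift_def add.commute intro!: restrict_ext)
  then show ?thesis by (simp add: \<phi>)
qed

text \<open>A pattern used as a configuration is \<open>undefined\<close> outside its box. The rule
  at a site of B(r) reads only B(r+q), so this junk never enters.\<close>

lemma ca_restrict:
  assumes "has_radius \<Phi> q"
  shows "restrict (\<Phi> (restrict b (lat_box (r + q)))) (lat_box r) = restrict (\<Phi> b) (lat_box r)"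
  by (rule restrict_ext) (auto intro!: has_radius_cong[OF assms] simp: lat_box_add)

lemma ca_patterns:
  assumes "has_radius \<Phi> q" "\<Phi> ` \<AA> \<subseteq> \<AA>" "c \<in> patterns \<AA> (r + q)"
  shows "restrict (\<Phi> c) (lat_box r) \<in> patterns \<AA> r"
  using assms ca_restrict[OF assms(1)] by (auto simp: patterns_def)

lemma ca_pattern_at:
  assumes "has_radius \<Phi> q"
  shows "restrict (\<Phi> (pattern_at a z (r + q))) (lat_box r) = pattern_at (\<Phi> a) z r"
  unfolding pattern_at_def ca_restrict[OF assms]
  by (rule restrict_ext) (auto intro!: has_radius_cong[OF assms] simp: shift_def ac_simps)

text \<open>If the pattern of radius r+q around a point occurs in some \<open>c\<close> of
  \<open>\<AA>\<close>, its image of radius r occurs in \<open>\<Phi> c\<close>, again in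
  \<open>\<AA>\<close>. This inclusion is what carries cycles and spheres over the good set of
  \<open>a\<close> to that of \<open>\<Phi> a\<close>, at the price of \<open>q\<close>
  levels.\<close>

lemma good_ca:
  assumes "has_radius \<Phi> q" "\<Phi> ` \<AA> \<subseteq> \<AA>"
  shows "good \<AA> a (r + q) \<subseteq> good \<AA> (\<Phi> a) r"
  using ca_patterns[OF assms] ca_pattern_at[OF assms(1)] by (metis good_iff subsetI)

lemma tilde_ca:
  assumes "has_radius \<Phi> q" "\<Phi> ` \<AA> \<subseteq> \<AA>" "a \<in> tilde \<AA>"
  shows "\<Phi> a \<in> tilde \<AA>"
  using good_ca[OF assms(1,2)] assms(3) unfolding mem_tilde_iff by blast

lemma cube_union_mono: "Y \<subseteq> Z \<Longrightarrow> cube_union Y \<subseteq> cube_union Z"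
  unfolding cube_union_def by blast

lemma cube_union_UNIV: "cube_union UNIV = UNIV"
proof -
  have "p \<in> unit_cube (\<chi> i. \<lfloor>p $ i\<rfloor>)" for p :: "real ^ 'a"
    by (auto simp: unit_cube_def)
  then show ?thesis by (auto simp: cube_union_def)
qed

section \<open>Tile complexes and sections\<close>

lemma topspace_quotient_topology:
  "topspace (quotient_topology X E) = topspace X // E"
proof
  show "topspace (quotient_topology X E) \<subseteq> topspace X // E"
    using openin_quotient_topology[of X E] openin_topspace by blast
  have "{x \<in> topspace X. E `` {x} \<in> topspace X // E} = topspace X"
    by (auto simp: quotient_def)
  then have "openin (quotient_topology X E) (topspace X // E)"
    by (simp add: openin_quotient_topology)
  then show "topspace X // E \<subseteq> topspace (quotient_topology X E)"
    by (rule openin_subset)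
qed

lemma continuous_map_quotient_class:
  "continuous_map X (quotient_topology X E) (\<lambda>x. E `` {x})"
  unfolding continuous_map_def topspace_quotient_topology
  by (auto simp: openin_quotient_topology quotientI)

lemma continuous_map_from_quotient:
  assumes "continuous_map X Y (\<lambda>x. f (E `` {x}))"
  shows "continuous_map (quotient_topology X E) Y f"
  unfolding continuous_map_def
proof (intro conjI allI impI)
  show "f \<in> topspace (quotient_topology X E) \<rightarrow> topspace Y"
    using assms by (auto simp: topspace_quotient_topology quotient_def continuous_map_def)
next
  fix U assume U: "openin Y U"
  have "{x \<in> topspace X. E `` {x} \<in> {S \<in> topspace X // E. f S \<in> U}} =
        {x \<in> topspace X. f (E `` {x}) \<in> U}"
    by (auto simp: quotientI)
  then show "openin (quotient_topology X E) {S \<in> topspace (quotient_topology X E). f S \<in> U}"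
    using openin_continuous_map_preimage[OF assms U]
    by (auto simp: openin_quotient_topology topspace_quotient_topology)
qed

section \<open>Cellular maps between tile complexes\<close>

lemma equiv_tile_eq: "equiv UNIV (tile_eq \<AA> r)"
  unfolding tile_eq_def
  by (intro equivI refl_rtrancl trans_rtrancl sym_rtrancl sym_Un_converse subset_UNIV) auto

lemma tile_glue_subset_eq: "x \<in> tile_glue \<AA> r \<Longrightarrow> x \<in> tile_eq \<AA> r"
  unfolding tile_eq_def by blast

lemma topspace_tile_sum:
  "topspace (tile_sum \<AA> r) = {((z, c), p). c \<in> patterns \<AA> r \<and> p \<in> unit_cube z}"
  unfolding tile_sum_def by (auto split: prod.splits)

text \<open>The cube \<open>z\<close> and the absolute position \<open>p\<close> stay fixed. Both
  \<open>tile_zeta\<close> and \<open>tile_ca\<close> arise in this way and are treated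
  together.\<close>

definition cell_map :: "(('d, 'a) config \<Rightarrow> ('d, 'a) config) \<Rightarrow> ('d, 'a) tile_pt \<Rightarrow> ('d, 'a) tile_pt"
  where "cell_map h = (\<lambda>((z, c), p). ((z, h c), p))"

lemma cell_map_apply [simp]: "cell_map h ((z, c), p) = ((z, h c), p)"
  by (simp add: cell_map_def)

text \<open>What a change of patterns has to satisfy in order to descend to the complexes:
  admissible patterns go to admissible ones, and agreement across a glued face is kept.\<close>

definition glue_preserving ::
  "('d::finite, 'a) config set \<Rightarrow> nat \<Rightarrow> nat \<Rightarrow> (('d, 'a) config \<Rightarrow> ('d, 'a) config) \<Rightarrow> bool" where
  "glue_preserving \<AA> s r h \<longleftrightarrow>
     h ` patterns \<AA> s \<subseteq> patterns \<AA> r \<and>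
     (\<forall>c\<in>patterns \<AA> s. \<forall>c'\<in>patterns \<AA> s. \<forall>i.
        (\<forall>u\<in>upper_box i s. c u = c' (u - axis i 1)) \<longrightarrow>
        (\<forall>u\<in>upper_box i r. h c u = h c' (u - axis i 1)))"

lemma cell_map_tile_glue:
  assumes "glue_preserving \<AA> s r h" "(x, y) \<in> tile_glue \<AA> s"
  shows "(cell_map h x, cell_map h y) \<in> tile_glue \<AA> r"
proof -
  obtain z c c' p i where *: "x = ((z, c), p)" "y = ((z + axis i 1, c'), p)"
    "c \<in> patterns \<AA> s" "c' \<in> patterns \<AA> s" "p \<in> unit_cube z" "p $ i = real_of_int (z $ i) + 1"
    "\<forall>u\<in>upper_box i s. c u = c' (u - axis i 1)"
    using assms(2) unfolding tile_glue_def by auto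
  have "h c \<in> patterns \<AA> r" "h c' \<in> patterns \<AA> r" "\<forall>u\<in>upper_box i r. h c u = h c' (u - axis i 1)"
    using assms(1) *(3,4,7) unfolding glue_preserving_def by blast+
  then show ?thesis
    unfolding *(1,2) cell_map_apply tile_glue_def using *(5,6) by blast
qed

lemma cell_map_tile_eq:
  assumes "glue_preserving \<AA> s r h" "(x, y) \<in> tile_eq \<AA> s"
  shows "(cell_map h x, cell_map h y) \<in> tile_eq \<AA> r"
  using assms(2) unfolding tile_eq_def
proof (induction rule: rtrancl_induct)
  case (step y z)
  then have "(cell_map h y, cell_map h z) \<in> tile_glue \<AA> r \<union> (tile_glue \<AA> r)\<inverse>"
    using cell_map_tile_glue[OF assms(1)] by blast
  with step.IH show ?case by (rule rtrancl_into_rtrancl)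
qed simp

definition tile_map ::
  "('d::finite, 'a) config set \<Rightarrow> nat \<Rightarrow> (('d, 'a) config \<Rightarrow> ('d, 'a) config) \<Rightarrow>
   ('d, 'a) tile_pt set \<Rightarrow> ('d, 'a) tile_pt set" where
  "tile_map \<AA> r h S = tile_eq \<AA> r `` (cell_map h ` S)"

lemma tile_zeta_eq_tile_map: "tile_zeta \<AA> r = tile_map \<AA> r (\<lambda>c. restrict c (lat_box r))"
  by (auto simp: fun_eq_iff tile_zeta_def tile_map_def cell_map_def)

lemma tile_ca_eq_tile_map: "tile_ca \<Phi> \<AA> r = tile_map \<AA> r (\<lambda>c. restrict (\<Phi> c) (lat_box r))"
  by (auto simp: fun_eq_iff tile_ca_def tile_map_def cell_map_def)

text \<open>\<open>tile_map\<close> saturates the image of a whole class, so its definition involves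
  no choice of representative. As related points have related images, a single representative
  already gives the full result.\<close>

lemma tile_map_class:
  assumes "glue_preserving \<AA> s r h"
  shows "tile_map \<AA> r h (tile_eq \<AA> s `` {x}) = tile_eq \<AA> r `` {cell_map h x}"
proof
  show "tile_map \<AA> r h (tile_eq \<AA> s `` {x}) \<subseteq> tile_eq \<AA> r `` {cell_map h x}"
  proof
    fix y assume "y \<in> tile_map \<AA> r h (tile_eq \<AA> s `` {x})"
    then obtain w where w: "(x, w) \<in> tile_eq \<AA> s" "(cell_map h w, y) \<in> tile_eq \<AA> r"
      by (auto simp: tile_map_def simp del: split_paired_Ex)
    show "y \<in> tile_eq \<AA> r `` {cell_map h x}"
      using transD[OF _ cell_map_tile_eq[OF assms w(1)] w(2)] equiv_tile_eq by (auto simp: equiv_def)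
  qed
  have "x \<in> tile_eq \<AA> s `` {x}"
    using equiv_tile_eq by (rule equiv_class_self) simp
  then show "tile_eq \<AA> r `` {cell_map h x} \<subseteq> tile_map \<AA> r h (tile_eq \<AA> s `` {x})"
    unfolding tile_map_def by blast
qed

text \<open>The summand \<open>(z, c)\<close> goes identically onto the summand
  \<open>(z, h c)\<close>, both being copies of the same cube.\<close>

lemma continuous_map_cell_map:
  assumes "glue_preserving \<AA> s r h"
  shows "continuous_map (tile_sum \<AA> s) (tile_sum \<AA> r) (cell_map h)"
  unfolding continuous_map_def
proof (intro conjI allI impI)
  show mem: "cell_map h \<in> topspace (tile_sum \<AA> s) \<rightarrow> topspace (tile_sum \<AA> r)"
    using assms by (auto simp: topspace_tile_sum glue_preserving_def)
  fix U assume U: "openin (tile_sum \<AA> r) U"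
  show "openin (tile_sum \<AA> s) {x \<in> topspace (tile_sum \<AA> s). cell_map h x \<in> U}"
    unfolding tile_sum_def openin_sum_topology
  proof (intro conjI ballI)
    fix j :: "(int ^ 'a) \<times> ('a, 'b) config" assume j: "j \<in> UNIV \<times> patterns \<AA> s"
    obtain z c where zc: "j = (z, c)" "c \<in> patterns \<AA> s" using j by auto
    have "openin (top_of_set (unit_cube z)) {x. ((z, h c), x) \<in> U}"
      using U assms zc unfolding tile_sum_def openin_sum_topology glue_preserving_def by fastforce
    moreover have "{x. (j, x) \<in> {x \<in> topspace (tile_sum \<AA> s). cell_map h x \<in> U}} =
          {x. ((z, h c), x) \<in> U} \<inter> unit_cube z"
      by (auto simp: topspace_tile_sum zc)
    ultimately show "openin (case j of (z, c) \<Rightarrow> top_of_set (unit_cube z))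
         {x. (j, x) \<in> {x \<in> topspace (sum_topology (\<lambda>(z, c). top_of_set (unit_cube z)) (UNIV \<times> patterns \<AA> s)).
           cell_map h x \<in> U}}"
      unfolding tile_sum_def[symmetric] by (simp add: zc openin_subtopology Int_ac) blast
  qed auto
qed

lemma continuous_map_tile_map:
  assumes "glue_preserving \<AA> s r h"
  shows "continuous_map (tile_complex \<AA> s) (tile_complex \<AA> r) (tile_map \<AA> r h)"
  unfolding tile_complex_def
proof (rule continuous_map_from_quotient, unfold tile_map_class[OF assms])
  show "continuous_map (tile_sum \<AA> s) (quotient_topology (tile_sum \<AA> r) (tile_eq \<AA> r))
     (\<lambda>x. tile_eq \<AA> r `` {cell_map h x})"
    using continuous_map_compose[OF continuous_map_cell_map[OF assms] continuous_map_quotient_class]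
    by (simp add: o_def)
qed

lemma glue_preserving_restrict:
  assumes "r \<le> s"
  shows "glue_preserving \<AA> s r (\<lambda>c. restrict c (lat_box r))"
  unfolding glue_preserving_def
proof (intro conjI ballI allI impI)
  show "(\<lambda>c. restrict c (lat_box r)) ` patterns \<AA> s \<subseteq> patterns \<AA> r"
    using restrict_patterns[OF _ assms] by blast
  fix c c' :: "('a, 'b) config" and i u
  assume "\<forall>u\<in>upper_box i s. c u = c' (u - axis i 1)" and u: "u \<in> upper_box i r"
  then have "c u = c' (u - axis i 1)" using upper_box_mono[OF assms] by blast
  then show "restrict c (lat_box r) u = restrict c' (lat_box r) (u - axis i 1)"
    using u upper_box_subset[of i r] lat_box_diff_axis[OF u] by (simp add: subset_iff)
qed

text \<open>For \<open>u\<close> in the upper box of radius r, the whole neighbourhood of radius q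
  around \<open>u\<close> lies in the upper box of radius r+q. Hence the rule reads the same symbols
  of \<open>c\<close> around \<open>u\<close> as of \<open>c'\<close> around the translate of
  \<open>u\<close>.\<close>

lemma glue_preserving_ca:
  assumes "has_radius \<Phi> q" "\<Phi> ` \<AA> \<subseteq> \<AA>"
  shows "glue_preserving \<AA> (r + q) r (\<lambda>c. restrict (\<Phi> c) (lat_box r))"
  unfolding glue_preserving_def
proof (intro conjI ballI allI impI)
  show "(\<lambda>c. restrict (\<Phi> c) (lat_box r)) ` patterns \<AA> (r + q) \<subseteq> patterns \<AA> r"
    using ca_patterns[OF assms] by blast
  fix c c' :: "('a, 'b) config" and i u
  assume eq: "\<forall>u\<in>upper_box i (r + q). c u = c' (u - axis i 1)" and u: "u \<in> upper_box i r"
  have "\<Phi> c u = \<Phi> c' (u - axis i 1)"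
  proof (rule has_radius_cong[OF assms(1)])
    fix v :: "int ^ 'a" assume "v \<in> lat_box q"
    then have "c (u + v) = c' (u + v - axis i 1)"
      using eq upper_box_add[OF u] by blast
    then show "c (u + v) = c' (u - axis i 1 + v)" by (simp add: algebra_simps)
  qed
  then show "restrict (\<Phi> c) (lat_box r) u = restrict (\<Phi> c') (lat_box r) (u - axis i 1)"
    using u upper_box_subset[of i r] lat_box_diff_axis[OF u] by (simp add: subset_iff)
qed

section \<open>Cells of the cube union and continuity of sections\<close>

text \<open>Cuts the cube union into closed pieces indexed by the points of \<open>G\<close>: the
  cube with lower corner \<open>z\<close> if all its corners are in \<open>G\<close>, else the bare
  vertex. Cubes and stray vertices thus form one locally finite closed cover.\<close>

definition cell :: "(int ^ ('d::finite)) set \<Rightarrow> int ^ 'd \<Rightarrow> (real ^ 'd) set" where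
  "cell G z = (if corners z \<subseteq> G then unit_cube z else {lattice_pt z})"

lemma mem_corners_self [simp]: "z \<in> corners z"
  by (simp add: corners_def)

lemma lattice_pt_mem_unit_cube [simp]: "lattice_pt z \<in> unit_cube z"
  by (simp add: unit_cube_def lattice_pt_def)

lemma cell_subset_unit_cube: "cell G z \<subseteq> unit_cube z"
  by (auto simp: cell_def)

lemma cell_mono: "G \<subseteq> H \<Longrightarrow> cell G z \<subseteq> cell H z"
  by (auto simp: cell_def)

lemma cube_union_eq_cells: "cube_union G = (\<Union>z\<in>G. cell G z)"
proof
  show "cube_union G \<subseteq> (\<Union>z\<in>G. cell G z)"
  proof
    fix p assume "p \<in> cube_union G"
    then consider z where "z \<in> G" "p = lattice_pt z" | z where "corners z \<subseteq> G" "p \<in> unit_cube z"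
      by (auto simp: cube_union_def)
    then show "p \<in> (\<Union>z\<in>G. cell G z)"
    proof cases
      case 1
      then have "p \<in> cell G z" by (simp add: cell_def)
      with 1 show ?thesis by blast
    next
      case 2
      then have "z \<in> G" "p \<in> cell G z" using mem_corners_self by (auto simp: cell_def)
      then show ?thesis by blast
    qed
  qed
  show "(\<Union>z\<in>G. cell G z) \<subseteq> cube_union G"
    by (auto simp: cube_union_def cell_def split: if_splits)
qed

lemma tile_section_alt:
  "tile_section \<AA> a r p =
     tile_eq \<AA> r `` ((\<lambda>z. ((z, pattern_at a z r), p)) ` {z \<in> good \<AA> a r. p \<in> cell (good \<AA> a r) z})"
proof -
  have "{z \<in> good \<AA> a r. p \<in> cell (good \<AA> a r) z} =
      {z. (corners z \<subseteq> good \<AA> a r \<and> p \<in> unit_cube z) \<or> (z \<in> good \<AA> a r \<and> p = lattice_pt z)}"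
    by (auto simp: cell_def split: if_splits dest: subsetD[OF _ mem_corners_self])
  then show ?thesis
    unfolding tile_section_def by (simp only: setcompr_eq_image)
qed

text \<open>Lower corner of a preferred cube through \<open>p\<close>, with which all cubes offered
  by the section are compared. That cube need not have all its corners in the good set.\<close>

definition floor_pt :: "real ^ ('d::finite) \<Rightarrow> int ^ 'd" where
  "floor_pt p = (\<chi> i. \<lfloor>p $ i\<rfloor>)"

lemma tile_glue_step:
  assumes "z \<in> good \<AA> a r" "z + axis i 1 \<in> good \<AA> a r"
    and "p \<in> unit_cube z" "p $ i = real_of_int (z $ i) + 1"
  shows "(((z, pattern_at a z r), p), ((z + axis i 1, pattern_at a (z + axis i 1) r), p)) \<in> tile_glue \<AA> r"
proof -
  have "pattern_at a z r u = pattern_at a (z + axis i 1) r (u - axis i 1)" if "u \<in> upper_box i r" for u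
    using that upper_box_subset[of i r] lat_box_diff_axis[OF that]
    by (simp add: pattern_at_apply subset_iff algebra_simps)
  moreover have "pattern_at a z r \<in> patterns \<AA> r" "pattern_at a (z + axis i 1) r \<in> patterns \<AA> r"
    using assms by (auto simp: good_iff)
  ultimately show ?thesis
    unfolding tile_glue_def using assms(3,4) by blast
qed

text \<open>
  Two cubes of the cube union through \<open>p\<close> need not be joined by cubes of the cube union, but each of
  them is joined to the cube with lower corner \<open>\<lfloor>p\<rfloor>\<close> by a chain of cubes whose lower corners are corners
  of the given one, so that the patterns there are still admissible.
\<close>

lemma tile_eq_floor_pt:
  assumes z: "z \<in> good \<AA> a r" and p: "p \<in> cell (good \<AA> a r) z"
  shows "(((z, pattern_at a z r), p), ((floor_pt p, pattern_at a (floor_pt p) r), p)) \<in> tile_eq \<AA> r"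
proof (cases "corners z \<subseteq> good \<AA> a r")
  case False
  then have "p = lattice_pt z" using p by (simp add: cell_def)
  then have "floor_pt p = z" by (simp add: floor_pt_def lattice_pt_def vec_eq_iff)
  then show ?thesis by (simp add: tile_eq_def)
next
  case True
  then have pz: "real_of_int (z $ i) \<le> p $ i" "p $ i \<le> real_of_int (z $ i) + 1" for i
    using p by (auto simp: cell_def unit_cube_def)
  define w where "w S = (\<chi> j. if j \<in> S then z $ j + 1 else z $ j)" for S
  have w_good: "w S \<in> good \<AA> a r" for S
  proof -
    have "w S \<in> corners z" by (simp add: w_def corners_def)
    then show ?thesis using True by blast
  qed
  have chain: "(((z, pattern_at a z r), p), ((w S, pattern_at a (w S) r), p)) \<in> tile_eq \<AA> r"
    if "finite S" "S \<subseteq> {i. p $ i = real_of_int (z $ i) + 1}" for S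
    using that
  proof (induction S)
    case empty
    have "w {} = z" by (simp add: w_def vec_eq_iff)
    then show ?case by (simp add: tile_eq_def)
  next
    case (insert i S)
    have eq: "w (insert i S) = w S + axis i 1"
      using insert.hyps by (auto simp: w_def vec_eq_iff axis_def)
    have "p \<in> unit_cube (w S)"
      using insert.prems pz unfolding unit_cube_def w_def by fastforce
    moreover have "p $ i = real_of_int (w S $ i) + 1"
      using insert.prems insert.hyps by (simp add: w_def)
    ultimately have "(((w S, pattern_at a (w S) r), p), ((w (insert i S), pattern_at a (w (insert i S)) r), p))
        \<in> tile_eq \<AA> r"
      using tile_glue_subset_eq[OF tile_glue_step] w_good[of S] w_good[of "insert i S"]
      unfolding eq by blast
    moreover have "(((z, pattern_at a z r), p), ((w S, pattern_at a (w S) r), p)) \<in> tile_eq \<AA> r"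
      using insert.IH insert.prems by blast
    ultimately show ?case
      using equiv_tile_eq[of \<AA> r] unfolding equiv_def by (blast dest: transD)
  qed
  define S where "S = {i. p $ i = real_of_int (z $ i) + 1}"
  \<comment> \<open>In the directions outside \<open>S\<close> the point \<open>p\<close> is
    strictly below the upper face, so the floor is the lower coordinate.\<close>
  have "w S = floor_pt p"
    unfolding vec_eq_iff
  proof
    fix i
    show "w S $ i = floor_pt p $ i"
      using pz[of i] unfolding w_def S_def floor_pt_def by (simp; linarith)
  qed
  then show ?thesis using chain[of S] by (simp add: S_def)
qed

text \<open>Well-definedness of the section: every cell through \<open>p\<close> is glued over
  \<open>p\<close> to the preferred cube, so all of them give one class.\<close>

lemma tile_section_eq_class:
  assumes "z \<in> good \<AA> a r" "p \<in> cell (good \<AA> a r) z"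
  shows "tile_section \<AA> a r p = tile_eq \<AA> r `` {((z, pattern_at a z r), p)}"
proof -
  have "tile_eq \<AA> r `` {((z, pattern_at a z r), p)} =
        tile_eq \<AA> r `` {((floor_pt p, pattern_at a (floor_pt p) r), p)}"
    if "z \<in> good \<AA> a r" "p \<in> cell (good \<AA> a r) z" for z
    using equiv_class_eq[OF equiv_tile_eq tile_eq_floor_pt[OF that]] .
  then show ?thesis
    using assms unfolding tile_section_alt by blast
qed

lemma closed_cell: "closed (cell G z)"
proof -
  have "closed (unit_cube z)"
    unfolding unit_cube_def
    by (intro closed_Collect_all closed_Collect_conj closed_Collect_le continuous_intros)
  then show ?thesis by (simp add: cell_def)
qed

lemma finite_cells_near:
  fixes x :: "real ^ 'd::finite"
  shows "finite {z. cell G z \<inter> ball x 1 \<noteq> {}}"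
proof (rule finite_subset)
  \<comment> \<open>In each coordinate \<open>p\<close> is within 1 of \<open>x\<close> and
    \<open>z\<close> is at most 1 below \<open>p\<close>, which puts \<open>z\<close> between x - 2
    and x + 1; the interval leaves some slack.\<close>
  let ?A = "\<lambda>i. {\<lfloor>x $ i\<rfloor> - 2 .. \<lceil>x $ i\<rceil> + 2}"
  show "finite (vec_lambda ` (Pi\<^sub>E UNIV ?A))"
    by (intro finite_imageI finite_PiE) auto
  show "{z. cell G z \<inter> ball x 1 \<noteq> {}} \<subseteq> vec_lambda ` (Pi\<^sub>E UNIV ?A)"
  proof
    fix z assume "z \<in> {z. cell G z \<inter> ball x 1 \<noteq> {}}"
    then obtain p where p: "p \<in> unit_cube z" "dist x p < 1"
      using cell_subset_unit_cube by fastforce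
    have "z $ i \<in> ?A i" for i
    proof -
      have "\<bar>(x - p) $ i\<bar> < 1"
        using p(2) component_le_norm_cart[of "x - p" i] by (simp add: dist_norm)
      moreover have "real_of_int (z $ i) \<le> p $ i" "p $ i \<le> real_of_int (z $ i) + 1"
        using p(1) by (auto simp: unit_cube_def)
      ultimately have "real_of_int (z $ i) \<le> x $ i + 2" "x $ i - 2 \<le> real_of_int (z $ i)"
        by auto
      then show ?thesis by simp linarith
    qed
    then have "z = vec_lambda (vec_nth z)" "vec_nth z \<in> Pi\<^sub>E UNIV ?A" by auto
    then show "z \<in> vec_lambda ` (Pi\<^sub>E UNIV ?A)" by blast
  qed
qed

text \<open>On a cell the section is the inclusion of one cube into the disjoint union, followed by
  the quotient map. The cells are closed and locally finite, and the local formulas agree on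
  overlaps by well-definedness, so they paste.\<close>

lemma continuous_map_tile_section:
  "continuous_map (good_space \<AA> a r) (tile_complex \<AA> r) (tile_section \<AA> a r)"
proof -
  let ?G = "good \<AA> a r"
  let ?f = "\<lambda>z p. tile_eq \<AA> r `` {((z, pattern_at a z r), p)}"
  show ?thesis
  proof (rule pasting_lemma_locally_finite[where I = ?G and T = "cell ?G" and f = ?f])
    fix x assume x: "x \<in> topspace (good_space \<AA> a r)"
    have "{z \<in> ?G. cell ?G z \<inter> (cube_union ?G \<inter> ball x 1) \<noteq> {}} \<subseteq> {z. cell ?G z \<inter> ball x 1 \<noteq> {}}"
      by blast
    then have "finite {z \<in> ?G. cell ?G z \<inter> (cube_union ?G \<inter> ball x 1) \<noteq> {}}"
      using finite_cells_near finite_subset by blast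
    moreover have "openin (good_space \<AA> a r) (cube_union ?G \<inter> ball x 1)"
      by (simp add: openin_open_Int)
    ultimately show "\<exists>V. openin (good_space \<AA> a r) V \<and> x \<in> V \<and> finite {z \<in> ?G. cell ?G z \<inter> V \<noteq> {}}"
      using x by (intro exI[of _ "cube_union ?G \<inter> ball x 1"]) auto
  next
    fix z assume z: "z \<in> ?G"
    then have sub: "cell ?G z \<subseteq> cube_union ?G" by (auto simp: cube_union_eq_cells)
    then show "closedin (good_space \<AA> a r) (cell ?G z)"
      by (simp add: closed_cell closed_subset)
    have "continuous_map (top_of_set (unit_cube z)) (tile_sum \<AA> r) (\<lambda>p. ((z, pattern_at a z r), p))"
      unfolding tile_sum_def
      using continuous_map_component_injection
        [of "(z, pattern_at a z r)" "UNIV \<times> patterns \<AA> r" "\<lambda>(z, c). top_of_set (unit_cube z)"] z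
      by (simp add: good_iff)
    then have "continuous_map (top_of_set (unit_cube z)) (tile_complex \<AA> r) (?f z)"
      unfolding tile_complex_def
      using continuous_map_compose[OF _ continuous_map_quotient_class] unfolding o_def by blast
    then show "continuous_map (subtopology (good_space \<AA> a r) (cell ?G z)) (tile_complex \<AA> r) (?f z)"
      using continuous_map_from_subtopology_mono[OF _ cell_subset_unit_cube] sub
      by (simp add: subtopology_subtopology Int_absorb1)
  next
    fix z z' x assume "z \<in> ?G" "z' \<in> ?G" "x \<in> topspace (good_space \<AA> a r) \<inter> cell ?G z \<inter> cell ?G z'"
    then show "?f z x = ?f z' x"
      using tile_section_eq_class[of z \<AA> a r x] tile_section_eq_class[of z' \<AA> a r x] by simp
  next
    fix x assume "x \<in> topspace (good_space \<AA> a r)"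
    then obtain z where "z \<in> ?G" "x \<in> cell ?G z" by (auto simp: cube_union_eq_cells)
    then show "\<exists>z. z \<in> ?G \<and> x \<in> cell ?G z \<and> tile_section \<AA> a r x = ?f z x"
      using tile_section_eq_class by blast
  qed
qed

section \<open>Naturality of sections\<close>

text \<open>Both sides can be computed in a cell with the same index, since a cell of the smaller
  good set lies in the corresponding cell of the larger one. Used with \<open>b = a\<close> for the
  restriction of patterns and with \<open>b = \<Phi> a\<close> for the automaton.\<close>

lemma tile_map_section:
  assumes h: "glue_preserving \<AA> s r h"
    and "\<And>z. z \<in> good \<AA> a s \<Longrightarrow> h (pattern_at a z s) = pattern_at b z r"
    and sub: "good \<AA> a s \<subseteq> good \<AA> b r" and p: "p \<in> cube_union (good \<AA> a s)"
  shows "tile_map \<AA> r h (tile_section \<AA> a s p) = tile_section \<AA> b r p"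
proof -
  obtain z where z: "z \<in> good \<AA> a s" "p \<in> cell (good \<AA> a s) z"
    using p by (auto simp: cube_union_eq_cells)
  then have "z \<in> good \<AA> b r" "p \<in> cell (good \<AA> b r) z"
    using sub cell_mono[OF sub] by blast+
  then show ?thesis
    using assms(2)[OF z(1)]
    unfolding tile_section_eq_class[OF z] tile_map_class[OF h] by (simp add: tile_section_eq_class)
qed

lemma tile_zeta_section:
  assumes "r \<le> s" "p \<in> cube_union (good \<AA> a s)"
  shows "tile_zeta \<AA> r (tile_section \<AA> a s p) = tile_section \<AA> a r p"
  unfolding tile_zeta_eq_tile_map
  by (rule tile_map_section[OF glue_preserving_restrict])
    (use assms in \<open>simp_all add: restrict_pattern_at good_antimono\<close>)

lemma tile_ca_section:
  assumes "has_radius \<Phi> q" "\<Phi> ` \<AA> \<subseteq> \<AA>" "p \<in> cube_union (good \<AA> a (r + q))"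
  shows "tile_ca \<Phi> \<AA> r (tile_section \<AA> a (r + q) p) = tile_section \<AA> (\<Phi> a) r p"
  unfolding tile_ca_eq_tile_map
  by (rule tile_map_section[OF glue_preserving_ca[OF assms(1,2)] _ good_ca[OF assms(1,2)] assms(3)])
    (simp add: ca_pattern_at[OF assms(1)])

lemma continuous_map_tile_zeta:
  "r \<le> s \<Longrightarrow> continuous_map (tile_complex \<AA> s) (tile_complex \<AA> r) (tile_zeta \<AA> r)"
  unfolding tile_zeta_eq_tile_map by (intro continuous_map_tile_map glue_preserving_restrict)

lemma continuous_map_tile_ca:
  assumes "has_radius \<Phi> q" "\<Phi> ` \<AA> \<subseteq> \<AA>"
  shows "continuous_map (tile_complex \<AA> (r + q)) (tile_complex \<AA> r) (tile_ca \<Phi> \<AA> r)"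
  unfolding tile_ca_eq_tile_map by (intro continuous_map_tile_map glue_preserving_ca assms)

lemma tile_zeta_class:
  assumes "r \<le> s"
  shows "tile_zeta \<AA> r (tile_eq \<AA> s `` {((z, c), p)}) = tile_eq \<AA> r `` {((z, restrict c (lat_box r)), p)}"
  unfolding tile_zeta_eq_tile_map tile_map_class[OF glue_preserving_restrict[OF assms]] by simp

lemma tile_ca_class:
  assumes "has_radius \<Phi> q" "\<Phi> ` \<AA> \<subseteq> \<AA>"
  shows "tile_ca \<Phi> \<AA> r (tile_eq \<AA> (r + q) `` {((z, c), p)}) =
    tile_eq \<AA> r `` {((z, restrict (\<Phi> c) (lat_box r)), p)}"
  unfolding tile_ca_eq_tile_map tile_map_class[OF glue_preserving_ca[OF assms]] by simp

lemma tile_zeta_base: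
  assumes "r \<le> s"
  shows "tile_zeta \<AA> r (tile_base \<AA> s c) = tile_base \<AA> r c"
  using assms by (simp add: tile_base_def tile_zeta_class Int_absorb1 lat_box_mono)

lemma tile_ca_base:
  assumes "has_radius \<Phi> q" "\<Phi> ` \<AA> \<subseteq> \<AA>"
  shows "tile_ca \<Phi> \<AA> r (tile_base \<AA> (r + q) c) = tile_base \<AA> r (\<Phi> c)"
  by (simp add: tile_base_def tile_ca_class[OF assms] ca_restrict[OF assms(1)])

text \<open>Taking \<open>S\<close> in the complex makes it the class of a point, where both
  composites amount to the image pattern on B(r), which is determined by B(r+q).\<close>

lemma tile_zeta_tile_ca:
  assumes "has_radius \<Phi> q" "\<Phi> ` \<AA> \<subseteq> \<AA>" "S \<in> topspace (tile_complex \<AA> (Suc r + q))"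
  shows "tile_zeta \<AA> r (tile_ca \<Phi> \<AA> (Suc r) S) = tile_ca \<Phi> \<AA> r (tile_zeta \<AA> (r + q) S)"
proof -
  obtain z c p where S: "S = tile_eq \<AA> (Suc r + q) `` {((z, c), p)}"
    using assms(3) by (auto simp: tile_complex_def topspace_quotient_topology quotient_def)
  have le: "r + q \<le> Suc r + q" "r \<le> Suc r" by auto
  show ?thesis
    unfolding S tile_zeta_class[OF le(1)] tile_ca_class[OF assms(1,2)] tile_zeta_class[OF le(2)]
    by (simp add: ca_restrict[OF assms(1)] Int_absorb1 lat_box_mono)
qed

lemma tile_base_mem_topspace:
  assumes "c \<in> \<AA>"
  shows "tile_base \<AA> r c \<in> topspace (tile_complex \<AA> r)"
proof -
  have "((0, restrict c (lat_box r)), 0) \<in> topspace (tile_sum \<AA> r)"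
    using assms by (auto simp: topspace_tile_sum patterns_def unit_cube_def)
  then show ?thesis
    by (simp add: tile_complex_def topspace_quotient_topology tile_base_def quotientI)
qed

section \<open>Homology with coefficients\<close>

lemma singular_face_simplex_map_face:
  assumes "0 < p" "i \<le> p"
  shows "singular_face p i (simplex_map p f s) = simplex_map (p - Suc 0) f (singular_face p i s)"
  using assms by (fastforce simp: singular_face_def simplex_map_def simplical_face_in_standard_simplex)

lemma additive_alt_sign: "Modules.additive (alt_sign i)"
  by (simp add: Modules.additive_def alt_sign_def)

lemma alt_sign_0 [simp]: "alt_sign i 0 = 0"
  by (simp add: alt_sign_def)

text \<open>Additive extension of a map given on chains supported on one simplex. Boundaries, chain
  maps and the cone operator are all of this kind, so identities between them can be checked on
  \<open>Poly_Mapping.single s g\<close>.\<close>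

definition gchain_ext :: "('s \<Rightarrow> 'g::ab_group_add \<Rightarrow> 'h::ab_group_add) \<Rightarrow> ('s \<Rightarrow>\<^sub>0 'g) \<Rightarrow> 'h" where
  "gchain_ext h c = (\<Sum>s\<in>Poly_Mapping.keys c. h s (Poly_Mapping.lookup c s))"

lemma gchain_ext_superset:
  assumes "\<And>s. Modules.additive (h s)" "finite K" "Poly_Mapping.keys c \<subseteq> K"
  shows "gchain_ext h c = (\<Sum>s\<in>K. h s (Poly_Mapping.lookup c s))"
  unfolding gchain_ext_def
  by (rule sum.mono_neutral_left)
    (use assms Modules.additive.zero[OF assms(1)] in \<open>auto simp: in_keys_iff\<close>)

lemma additive_gchain_ext:
  assumes "\<And>s. Modules.additive (h s)"
  shows "Modules.additive (gchain_ext h)"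
proof
  fix a b :: "'a \<Rightarrow>\<^sub>0 'b"
  \<comment> \<open>Coefficients may cancel in \<open>a + b\<close>, so all three sums are taken
    over one finite set; the extra terms vanish by additivity.\<close>
  let ?K = "Poly_Mapping.keys a \<union> Poly_Mapping.keys b"
  have K: "finite ?K" "Poly_Mapping.keys (a + b) \<subseteq> ?K" by (auto simp: keys_add)
  show "gchain_ext h (a + b) = gchain_ext h a + gchain_ext h b"
    using gchain_ext_superset[OF assms K(1), of a] gchain_ext_superset[OF assms K(1), of b]
      gchain_ext_superset[OF assms K]
    by (simp add: lookup_add Modules.additive.add[OF assms] sum.distrib)
qed

lemma gchain_ext_single:
  assumes "Modules.additive (h s)"
  shows "gchain_ext h (Poly_Mapping.single s g) = h s g"
  using Modules.additive.zero[OF assms] by (simp add: gchain_ext_def)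

lemma gchain_eq_sum_single:
  "c = (\<Sum>s\<in>Poly_Mapping.keys c. Poly_Mapping.single s (Poly_Mapping.lookup c s))"
proof (rule poly_mapping_eqI)
  fix k
  show "Poly_Mapping.lookup c k = Poly_Mapping.lookup
      (\<Sum>s\<in>Poly_Mapping.keys c. Poly_Mapping.single s (Poly_Mapping.lookup c s)) k"
    by (simp add: lookup_sum lookup_single when_def in_keys_iff)
qed

text \<open>A chain is the sum of its one-simplex parts. Agreement is asked only on the keys of
  \<open>c\<close>, because some of the identities to be checked hold only for singular simplices of
  the space in question.\<close>

lemma additive_eq_on_gchain:
  assumes "Modules.additive F" "Modules.additive G"
    and eq: "\<And>s g. s \<in> Poly_Mapping.keys c \<Longrightarrow> F (Poly_Mapping.single s g) = G (Poly_Mapping.single s g)"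
  shows "F c = G c"
proof -
  have "F c = (\<Sum>s\<in>Poly_Mapping.keys c. F (Poly_Mapping.single s (Poly_Mapping.lookup c s)))"
    using arg_cong[OF gchain_eq_sum_single[of c], of F] Modules.additive.sum[OF assms(1)] by simp
  also have "\<dots> = (\<Sum>s\<in>Poly_Mapping.keys c. G (Poly_Mapping.single s (Poly_Mapping.lookup c s)))"
    by (rule sum.cong) (auto simp: eq)
  also have "\<dots> = G (\<Sum>s\<in>Poly_Mapping.keys c. Poly_Mapping.single s (Poly_Mapping.lookup c s))"
    by (simp add: Modules.additive.sum[OF assms(2)])
  also have "\<dots> = G c"
    by (simp flip: gchain_eq_sum_single)
  finally show ?thesis .
qed

lemma additive_compose: "Modules.additive F \<Longrightarrow> Modules.additive G \<Longrightarrow> Modules.additive (\<lambda>c. F (G c))"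
  by (simp add: Modules.additive_def)

lemma additive_single: "Modules.additive (\<lambda>g. Poly_Mapping.single s (g::'g::ab_group_add))"
  by (simp add: Modules.additive_def single_add)

lemma additive_setsum: "(\<And>i. Modules.additive (F i)) \<Longrightarrow> Modules.additive (\<lambda>c. \<Sum>i\<in>I. F i c)"
  by (simp add: Modules.additive_def sum.distrib)

lemma additive_zero: "Modules.additive (\<lambda>_. 0)"
  by (simp add: Modules.additive_def)

lemma gboundary_eq_ext:
  "gboundary p = (if p = 0 then (\<lambda>_. 0) else
     gchain_ext (\<lambda>s g. \<Sum>i\<le>p. Poly_Mapping.single (singular_face p i s) (alt_sign i g)))"
  by (auto simp: fun_eq_iff gboundary_def gchain_ext_def)

lemma additive_face_sum:
  "Modules.additive (\<lambda>g::'g::ab_group_add. \<Sum>i\<le>p. Poly_Mapping.single (singular_face p i s) (alt_sign i g))"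
  by (intro additive_setsum additive_compose[OF additive_single] additive_alt_sign)

lemma additive_gboundary: "Modules.additive (gboundary p)"
  by (simp add: gboundary_eq_ext additive_zero additive_gchain_ext additive_face_sum)

lemma gboundary_single:
  "gboundary p (Poly_Mapping.single s g) =
     (if p = 0 then 0 else \<Sum>i\<le>p. Poly_Mapping.single (singular_face p i s) (alt_sign i g))"
  by (simp add: gboundary_eq_ext gchain_ext_single additive_face_sum)

lemma gchain_map_eq_ext: "gchain_map p f = gchain_ext (\<lambda>s. Poly_Mapping.single (simplex_map p f s))"
  by (simp add: fun_eq_iff gchain_map_def gchain_ext_def)

lemma additive_gchain_map: "Modules.additive (gchain_map p f)"
  by (simp add: gchain_map_eq_ext additive_gchain_ext additive_single)

lemma gchain_map_single:
  "gchain_map p f (Poly_Mapping.single s g) = Poly_Mapping.single (simplex_map p f s) g"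
  by (simp add: gchain_map_eq_ext gchain_ext_single[OF additive_single])

lemma gchains_zero: "0 \<in> gchains p X"
  by (simp add: gchains_def)

lemma gchains_add: "a \<in> gchains p X \<Longrightarrow> b \<in> gchains p X \<Longrightarrow> a + b \<in> gchains p X"
  unfolding gchains_def using keys_add[of a b] by blast

lemma gchains_uminus: "a \<in> gchains p X \<Longrightarrow> - a \<in> gchains p X"
  by (simp add: gchains_def)

lemma gchains_sum: "(\<And>i. i \<in> I \<Longrightarrow> F i \<in> gchains p X) \<Longrightarrow> sum F I \<in> gchains p X"
  by (induction I rule: infinite_finite_induct) (auto simp: gchains_zero gchains_add)

lemma gchains_single: "singular_simplex p X s \<Longrightarrow> Poly_Mapping.single s g \<in> gchains p X"
  by (simp add: gchains_def)

lemma gchains_key: "c \<in> gchains p X \<Longrightarrow> s \<in> Poly_Mapping.keys c \<Longrightarrow> singular_simplex p X s"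
  by (auto simp: gchains_def)

lemma gchain_map_gchains:
  "continuous_map X Y f \<Longrightarrow> c \<in> gchains p X \<Longrightarrow> gchain_map p f c \<in> gchains p Y"
  unfolding gchain_map_def
  by (intro gchains_sum gchains_single singular_simplex_simplex_map) (auto dest: gchains_key)

text \<open>For one simplex this is the fact that taking faces commutes with composing by
  \<open>f\<close>. In degree 0 both boundaries vanish, so the truncated p - 1 does no harm.\<close>

lemma gboundary_gchain_map:
  "gboundary p (gchain_map p f c) = gchain_map (p - Suc 0) f (gboundary p c)"
proof (rule additive_eq_on_gchain[of "\<lambda>c. gboundary p (gchain_map p f c)" "\<lambda>c. gchain_map (p - Suc 0) f (gboundary p c)"])
  fix s g
  show "gboundary p (gchain_map p f (Poly_Mapping.single s g)) =
      gchain_map (p - Suc 0) f (gboundary p (Poly_Mapping.single s g))"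
    by (cases "p = 0")
      (simp_all add: gchain_map_single gboundary_single Modules.additive.sum[OF additive_gchain_map]
        Modules.additive.zero[OF additive_gchain_map] singular_face_simplex_map_face)
qed (rule additive_compose[OF additive_gboundary additive_gchain_map]
      additive_compose[OF additive_gchain_map additive_gboundary])+

lemma gchain_map_compose: "gchain_map p g (gchain_map p f c) = gchain_map p (g \<circ> f) c"
proof (rule additive_eq_on_gchain[of "\<lambda>c. gchain_map p g (gchain_map p f c)" "gchain_map p (g \<circ> f)"])
  show "Modules.additive (\<lambda>c. gchain_map p g (gchain_map p f c))"
    by (rule additive_compose[OF additive_gchain_map additive_gchain_map])
qed (simp_all add: additive_gchain_map gchain_map_single simplex_map_compose)

lemma gchain_map_cong:
  assumes "c \<in> gchains p X" "\<And>x. x \<in> topspace X \<Longrightarrow> f x = g x"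
  shows "gchain_map p f c = gchain_map p g c"
proof (rule additive_eq_on_gchain[of "gchain_map p f" "gchain_map p g"])
  fix s h
  assume "s \<in> Poly_Mapping.keys c"
  then show "gchain_map p f (Poly_Mapping.single s h) = gchain_map p g (Poly_Mapping.single s h)"
    using simplex_map_eq[OF gchains_key[OF assms(1)] assms(2)] by (simp add: gchain_map_single)
qed (rule additive_gchain_map)+

lemma gboundaries_zero: "0 \<in> gboundaries p X"
  unfolding gboundaries_def
  using gchains_zero Modules.additive.zero[OF additive_gboundary] by (metis image_eqI)

lemma gboundaries_add: "a \<in> gboundaries p X \<Longrightarrow> b \<in> gboundaries p X \<Longrightarrow> a + b \<in> gboundaries p X"
  unfolding gboundaries_def
  by (auto simp: Modules.additive.add[OF additive_gboundary, symmetric] intro!: imageI gchains_add)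

lemma gboundaries_uminus: "a \<in> gboundaries p X \<Longrightarrow> - a \<in> gboundaries p X"
  unfolding gboundaries_def
  by (auto simp: Modules.additive.minus[OF additive_gboundary, symmetric] intro!: imageI gchains_uminus)

lemma gboundaries_map:
  assumes "continuous_map X Y f" "b \<in> gboundaries p X"
  shows "gchain_map p f b \<in> gboundaries p Y"
proof -
  obtain c where c: "c \<in> gchains (Suc p) X" "b = gboundary (Suc p) c"
    using assms(2) by (auto simp: gboundaries_def)
  then have "gchain_map p f b = gboundary (Suc p) (gchain_map (Suc p) f c)"
    using gboundary_gchain_map[of "Suc p" f c] by simp
  then show ?thesis
    using gchain_map_gchains[OF assms(1) c(1)] by (auto simp: gboundaries_def)
qed

section \<open>Homology classes and induced maps\<close>

text \<open>The coset of the boundaries, written out for an arbitrary chain so that induced maps can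
  be computed on representatives without cycle conditions.\<close>

definition homology_class :: "nat \<Rightarrow> 'x topology \<Rightarrow> ('x, 'g::ab_group_add) gchain \<Rightarrow> ('x, 'g) gchain set" where
  "homology_class p X c = {b + c | b. b \<in> gboundaries p X}"

lemma carrier_homology_coeff:
  "carrier (homology_coeff p X) = homology_class p X ` {c \<in> gchains p X. gboundary p c = 0}"
  by (auto simp: homology_coeff_def carrier_FactGroup gcycle_group_def r_coset_def homology_class_def)

lemma one_homology_coeff: "\<one>\<^bsub>homology_coeff p X\<^esub> = homology_class p X 0"
  by (auto simp: homology_coeff_def homology_class_def)

lemma homology_class_boundary:
  assumes "c \<in> gboundaries p X"
  shows "homology_class p X c = homology_class p X 0"
proof
  show "homology_class p X c \<subseteq> homology_class p X 0"
    using gboundaries_add[OF _ assms] by (auto simp: homology_class_def)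
  have "\<exists>b'. b = b' + c \<and> b' \<in> gboundaries p X" if "b \<in> gboundaries p X" for b
    using gboundaries_add[OF that gboundaries_uminus[OF assms]] by (intro exI[of _ "b + - c"]) simp
  then show "homology_class p X 0 \<subseteq> homology_class p X c"
    by (auto simp: homology_class_def)
qed

lemma homology_induced_class:
  assumes "continuous_map X Y f"
  shows "homology_induced p Y f (homology_class p X c) = homology_class p Y (gchain_map p f c)"
proof
  show "homology_induced p Y f (homology_class p X c) \<subseteq> homology_class p Y (gchain_map p f c)"
  proof
    fix y assume "y \<in> homology_induced p Y f (homology_class p X c)"
    then obtain b b' where b: "b \<in> gboundaries p Y" "b' \<in> gboundaries p X" "y = b + gchain_map p f (b' + c)"
      by (auto simp: homology_induced_def homology_class_def)
    then have "y = (b + gchain_map p f b') + gchain_map p f c"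
      by (simp add: Modules.additive.add[OF additive_gchain_map] add.assoc)
    moreover have "b + gchain_map p f b' \<in> gboundaries p Y"
      using b gboundaries_add gboundaries_map[OF assms] by blast
    ultimately show "y \<in> homology_class p Y (gchain_map p f c)"
      unfolding homology_class_def by blast
  qed
  have "c \<in> homology_class p X c"
    unfolding homology_class_def using gboundaries_zero by force
  then show "homology_class p Y (gchain_map p f c) \<subseteq> homology_induced p Y f (homology_class p X c)"
    unfolding homology_induced_def homology_class_def[of p Y] by blast
qed

lemma homology_induced_carrier:
  assumes "continuous_map X Y f" "A \<in> carrier (homology_coeff p X)"
  shows "homology_induced p Y f A \<in> carrier (homology_coeff p Y)"
proof -
  obtain c where c: "A = homology_class p X c" "c \<in> gchains p X" "gboundary p c = 0"
    using assms(2) by (auto simp: carrier_homology_coeff)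
  then show ?thesis
    by (auto simp: carrier_homology_coeff homology_induced_class[OF assms(1)] gboundary_gchain_map
        Modules.additive.zero[OF additive_gchain_map] intro!: imageI gchain_map_gchains[OF assms(1)])
qed

lemma homology_induced_one:
  assumes "continuous_map X Y f"
  shows "homology_induced p Y f \<one>\<^bsub>homology_coeff p X\<^esub> = \<one>\<^bsub>homology_coeff p Y\<^esub>"
  by (simp add: one_homology_coeff homology_induced_class[OF assms] Modules.additive.zero[OF additive_gchain_map])

lemma homology_induced_compose:
  assumes "continuous_map X Y f" "continuous_map Y Z g" "A \<in> carrier (homology_coeff p X)"
  shows "homology_induced p Z g (homology_induced p Y f A) = homology_induced p Z (g \<circ> f) A"
proof -
  obtain c where c: "A = homology_class p X c"
    using assms(3) by (auto simp: carrier_homology_coeff)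
  show ?thesis
    by (simp add: c homology_induced_class[OF assms(1)] homology_induced_class[OF assms(2)]
        homology_induced_class[OF continuous_map_compose[OF assms(1,2)]] gchain_map_compose)
qed

lemma homology_induced_cong:
  assumes "continuous_map X Y f" "continuous_map X Y g" "\<And>x. x \<in> topspace X \<Longrightarrow> f x = g x"
    and "A \<in> carrier (homology_coeff p X)"
  shows "homology_induced p Y f A = homology_induced p Y g A"
proof -
  obtain c where c: "A = homology_class p X c" "c \<in> gchains p X"
    using assms(4) by (auto simp: carrier_homology_coeff)
  show ?thesis
    by (simp add: c homology_induced_class[OF assms(1)] homology_induced_class[OF assms(2)]
        gchain_map_cong[OF c(2) assms(3)])
qed

section \<open>Cones and the vanishing of homology in Euclidean space\<close>

text \<open>
  At the apex \<open>x 0 = 1\<close> the argument of \<open>s\<close> is junk, but the factor \<open>1 - x 0\<close> vanishes there.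
\<close>

definition cone_simplex ::
  "nat \<Rightarrow> ((nat \<Rightarrow> real) \<Rightarrow> 'x::real_normed_vector) \<Rightarrow> (nat \<Rightarrow> real) \<Rightarrow> 'x" where
  "cone_simplex p s = (\<lambda>x\<in>standard_simplex (Suc p). (1 - x 0) *\<^sub>R s (\<lambda>i. x (Suc i) / (1 - x 0)))"

text \<open>These are the barycentric coordinates of the projection of \<open>x\<close> from the
  apex onto the opposite face.\<close>

lemma standard_simplex_base:
  assumes x: "x \<in> standard_simplex (Suc p)" and "x 0 < 1"
  shows "(\<lambda>i. x (Suc i) / (1 - x 0)) \<in> standard_simplex p"
proof -
  have nn: "0 \<le> x i" and z: "i > Suc p \<Longrightarrow> x i = 0" for i
    using x by (auto simp: standard_simplex_def)
  have "x 0 + (\<Sum>i\<le>p. x (Suc i)) = 1"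
    using x sum.atMost_Suc_shift[of x p] by (simp add: standard_simplex_def)
  then have sum: "(\<Sum>i\<le>p. x (Suc i)) = 1 - x 0" by simp
  have le: "x (Suc i) \<le> 1 - x 0" for i
  proof (cases "i \<le> p")
    case True
    then have "x (Suc i) \<le> (\<Sum>i\<le>p. x (Suc i))"
      by (intro member_le_sum[where f = "\<lambda>i. x (Suc i)"]) (auto simp: nn)
    then show ?thesis by (simp add: sum)
  next
    case False
    then show ?thesis using z[of "Suc i"] assms(2) by simp
  qed
  have "0 \<le> x (Suc i) / (1 - x 0)" "x (Suc i) / (1 - x 0) \<le> 1" for i
    using assms(2) nn[of "Suc i"] le[of i] by simp_all
  moreover have "x (Suc i) / (1 - x 0) = 0" if "i > p" for i
    using z[of "Suc i"] that by simp
  moreover have "(\<Sum>i\<le>p. x (Suc i) / (1 - x 0)) = 1"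
    using assms(2) by (simp add: sum flip: sum_divide_distrib)
  ultimately show ?thesis by (simp add: standard_simplex_def)
qed

text \<open>Only the apex needs an argument. There the rescaled coordinates need not converge, but
  \<open>s\<close> is bounded on the compact simplex, so the factor \<open>1 - x 0\<close> forces
  the limit 0. Away from it the formula is a composite of continuous maps.\<close>

lemma singular_simplex_cone:
  assumes s: "singular_simplex p euclidean s"
  shows "singular_simplex (Suc p) euclidean (cone_simplex p s)"
proof -
  let ?S = "standard_simplex (Suc p)"
  let ?g = "\<lambda>x. (1 - x 0) *\<^sub>R s (\<lambda>i. x (Suc i) / (1 - x 0))"
  have cs: "continuous_on (standard_simplex p) s"
    using s by (simp add: singular_simplex_def euclidean_product_topology)
  have "compact (standard_simplex p)"
    using compactin_standard_simplex[of p] by (simp add: euclidean_product_topology)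
  then have "bounded (s ` standard_simplex p)"
    using compact_continuous_image[OF cs] compact_imp_bounded by blast
  then obtain M where M: "\<And>y. y \<in> standard_simplex p \<Longrightarrow> norm (s y) \<le> M"
    by (auto simp: bounded_iff)
  have cont: "continuous (at x within ?S) ?g" if x: "x \<in> ?S" for x
  proof (cases "x 0 = 1")
    case False
    then have "x 0 < 1" using x by (auto simp: standard_simplex_def order_less_le)
    let ?U = "?S \<inter> {x. x 0 < 1}"
    have "continuous_on ?U (\<lambda>x i. x (Suc i) / (1 - x 0))"
      by (intro continuous_intros continuous_on_subset[OF continuous_on_product_coordinates]) auto
    then have "continuous_on ?U (\<lambda>x. s (\<lambda>i. x (Suc i) / (1 - x 0)))"
      by (rule continuous_on_compose2[OF cs]) (auto simp: standard_simplex_base)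
    then have "continuous_on ?U ?g"
      by (intro continuous_intros continuous_on_subset[OF continuous_on_product_coordinates]) auto
    then have "continuous (at x within ?U) ?g"
      using x \<open>x 0 < 1\<close> by (simp add: continuous_on_eq_continuous_within)
    moreover have "open {x :: nat \<Rightarrow> real. x 0 < 1}"
      by (intro open_Collect_less continuous_intros continuous_on_product_coordinates)
    then have "at x within ?S = at x within ?U"
      by (intro at_within_nhd[of _ "{x. x 0 < 1}"]) (use \<open>x 0 < 1\<close> in auto)
    ultimately show ?thesis by simp
  next
    case True
    have bd: "norm (?g y) \<le> (1 - y 0) * \<bar>M\<bar>" if y: "y \<in> ?S" for y
    proof (cases "y 0 = 1")
      case False
      then have "y 0 < 1" using y by (auto simp: standard_simplex_def order_less_le)
      then show ?thesis
        using M[OF standard_simplex_base[OF y]] by (auto intro!: mult_left_mono)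
    qed simp
    have "((\<lambda>y. (1 - y 0) * \<bar>M\<bar>) \<longlongrightarrow> (1 - x 0) * \<bar>M\<bar>) (at x within ?S)"
      using continuous_on_subset[OF continuous_on_product_coordinates[of 0] subset_UNIV, of ?S] x
      by (intro tendsto_intros) (simp add: continuous_on_def)
    then have "((\<lambda>y. (1 - y 0) * \<bar>M\<bar>) \<longlongrightarrow> 0) (at x within ?S)"
      by (simp add: True)
    moreover have "\<forall>\<^sub>F y in at x within ?S. norm (?g y) \<le> (1 - y 0) * \<bar>M\<bar>"
      using bd by (simp add: eventually_at_filter)
    ultimately have "(?g \<longlongrightarrow> 0) (at x within ?S)"
      by (rule Lim_null_comparison[rotated])
    then show ?thesis by (simp add: continuous_within True)
  qed
  have "continuous_on ?S (cone_simplex p s)"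
    using cont by (simp add: continuous_on_eq_continuous_within cone_simplex_def cong: continuous_on_cong)
  then show ?thesis
    by (simp add: singular_simplex_def euclidean_product_topology cone_simplex_def)
qed

text \<open>Coordinate 0 belongs to the apex, so the face where it vanishes is the base of the cone.
  Outside the standard simplex both sides are \<open>undefined\<close>, which for \<open>s\<close>
  is part of being a singular simplex.\<close>

lemma face_0_cone:
  assumes "singular_simplex p X s"
  shows "singular_face (Suc p) 0 (cone_simplex p s) = s"
proof
  fix x
  show "singular_face (Suc p) 0 (cone_simplex p s) x = s x"
  proof (cases "x \<in> standard_simplex p")
    case False
    then show ?thesis
      using assms by (simp add: singular_face_def singular_simplex_def extensional_def)
  next
    case True
    then have "simplical_face 0 x \<in> standard_simplex (Suc p)"
      using simplical_face_in_standard_simplex[of "Suc p" 0 x] by simp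
    then show ?thesis
      using True by (simp add: singular_face_def cone_simplex_def simplical_face_def)
  qed
qed

text \<open>The other faces contain the apex and are cones over the faces of \<open>s\<close>. For p
  = 0 there is no face of \<open>s\<close> to form a cone over.\<close>

lemma face_Suc_cone:
  assumes "0 < p" "i \<le> p"
  shows "singular_face (Suc p) (Suc i) (cone_simplex p s) = cone_simplex (p - Suc 0) (singular_face p i s)"
proof
  fix x :: "nat \<Rightarrow> real"
  show "singular_face (Suc p) (Suc i) (cone_simplex p s) x = cone_simplex (p - Suc 0) (singular_face p i s) x"
  proof (cases "x \<in> standard_simplex p")
    case False
    then have "x \<notin> standard_simplex (Suc p - Suc 0)" "x \<notin> standard_simplex (Suc (p - Suc 0))"
      using assms(1) by simp_all
    then show ?thesis
      by (simp only: singular_face_def cone_simplex_def restrict_apply if_False)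
  next
    case x: True
    have x': "x \<in> standard_simplex (Suc (p - Suc 0))"
      using x assms(1) by simp
    let ?y = "\<lambda>j. x (Suc j) / (1 - x 0)"
    let ?w = "simplical_face (Suc i) x"
    have w: "?w \<in> standard_simplex (Suc p)"
      using simplical_face_in_standard_simplex[of "Suc p" "Suc i" x] assms x by simp
    have w0: "?w 0 = x 0"
      by (simp add: simplical_face_def)
    have wS: "(\<lambda>j. ?w (Suc j) / (1 - x 0)) = simplical_face i ?y"
    proof
      fix j
      show "?w (Suc j) / (1 - x 0) = simplical_face i ?y j"
        by (cases j) (auto simp: simplical_face_def)
    qed
    have "singular_face (Suc p) (Suc i) (cone_simplex p s) x = cone_simplex p s ?w"
      using x by (simp add: singular_face_def)
    also have "\<dots> = (1 - ?w 0) *\<^sub>R s (\<lambda>j. ?w (Suc j) / (1 - ?w 0))"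
      unfolding cone_simplex_def using w by (rule restrict_apply')
    finally have lhs: "singular_face (Suc p) (Suc i) (cone_simplex p s) x =
        (1 - x 0) *\<^sub>R s (simplical_face i ?y)"
      unfolding w0 wS .
    have rhs: "cone_simplex (p - Suc 0) (singular_face p i s) x = (1 - x 0) *\<^sub>R singular_face p i s ?y"
      unfolding cone_simplex_def using x' by (rule restrict_apply')
    show ?thesis
    \<comment> \<open>At the apex the inner arguments are junk, but both sides carry the factor
      0.\<close>
    proof (cases "x 0 = 1")
      case True
      then show ?thesis unfolding lhs rhs by simp
    next
      case False
      moreover have "x 0 \<le> 1" using x unfolding standard_simplex_def by blast
      ultimately have "x 0 < 1" by simp
      then have "?y \<in> standard_simplex (p - Suc 0)"
        by (rule standard_simplex_base[OF x'])
      then have "singular_face p i s ?y = s (simplical_face i ?y)"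
        by (simp only: singular_face_def restrict_apply' o_def)
      then show ?thesis by (simp only: lhs rhs)
    qed
  qed
qed

lemma alt_sign_Suc: "alt_sign (Suc i) g = - alt_sign i g"
  by (simp add: alt_sign_def)

text \<open>Coning to the origin is a contracting chain homotopy in positive degrees: in the
  boundary of \<open>K p c\<close>, face 0 gives back \<open>c\<close>, and the others give the cone
  over the boundary of \<open>c\<close> with opposite sign, as face i of \<open>s\<close> has become
  face i + 1. So a cycle bounds its cone.\<close>

lemma homology_coeff_euclidean_trivial:
  fixes A :: "('x::real_normed_vector, 'g::ab_group_add) gchain set"
  assumes "0 < p" "A \<in> carrier (homology_coeff p euclidean)"
  shows "A = \<one>\<^bsub>homology_coeff p euclidean\<^esub>"
proof -
  obtain c :: "('x, 'g) gchain" where c: "A = homology_class p euclidean c" "c \<in> gchains p euclidean" "gboundary p c = 0"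
    using assms(2) by (auto simp: carrier_homology_coeff)
  define K :: "nat \<Rightarrow> ('x, 'g) gchain \<Rightarrow> ('x, 'g) gchain"
    where "K p = gchain_ext (\<lambda>s. Poly_Mapping.single (cone_simplex p s))" for p
  have addK: "Modules.additive (K p)" for p
    unfolding K_def by (intro additive_gchain_ext additive_single)
  have K_single: "K p (Poly_Mapping.single s g) = Poly_Mapping.single (cone_simplex p s) g" for p s g
    unfolding K_def by (rule gchain_ext_single[OF additive_single])
  have "gboundary (Suc p) (K p c) = c - K (p - Suc 0) (gboundary p c)"
  proof (rule additive_eq_on_gchain[of "\<lambda>c. gboundary (Suc p) (K p c)" "\<lambda>c. c - K (p - Suc 0) (gboundary p c)"])
    fix s g assume "s \<in> Poly_Mapping.keys c"
    then have s: "singular_simplex p euclidean s" using c(2) gchains_key by blast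
    show "gboundary (Suc p) (K p (Poly_Mapping.single s g)) =
        Poly_Mapping.single s g - K (p - Suc 0) (gboundary p (Poly_Mapping.single s g))"
      using assms(1)
      by (simp add: K_single gboundary_single sum.atMost_Suc_shift face_0_cone[OF s] face_Suc_cone
          Modules.additive.sum[OF addK] alt_sign_Suc single_uminus sum_negf del: sum.atMost_Suc)
        (simp add: alt_sign_def)
  next
    show "Modules.additive (\<lambda>c. gboundary (Suc p) (K p c))"
      by (rule additive_compose[OF additive_gboundary addK])
    have "Modules.additive (\<lambda>c. K (p - Suc 0) (gboundary p c))"
      by (rule additive_compose[OF addK additive_gboundary])
    then show "Modules.additive (\<lambda>c. c - K (p - Suc 0) (gboundary p c))"
      by (simp add: Modules.additive_def)
  qed
  then have "c = gboundary (Suc p) (K p c)"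
    by (simp add: c(3) Modules.additive.zero[OF addK])
  moreover have "K p c \<in> gchains (Suc p) euclidean"
    unfolding K_def gchain_ext_def
    by (intro gchains_sum gchains_single singular_simplex_cone) (use c(2) gchains_key in blast)
  ultimately have "c \<in> gboundaries p euclidean"
    unfolding gboundaries_def by blast
  then show ?thesis
    by (simp add: c(1) homology_class_boundary one_homology_coeff)
qed

section \<open>Cohomology with coefficients\<close>

definition cohomology_class :: "nat \<Rightarrow> 'x topology \<Rightarrow> ('x, 'g::ab_group_add) gcochain \<Rightarrow> ('x, 'g) gcochain set" where
  "cohomology_class p X \<phi> = {(\<lambda>s. \<beta> s + \<phi> s) | \<beta>. \<beta> \<in> gcoboundaries p X}"

lemma carrier_cohomology_coeff:
  "carrier (cohomology_coeff p X) =
     cohomology_class p X ` {\<phi> \<in> gcochains p X. gcoboundary p X \<phi> = (\<lambda>_. 0)}"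
  by (auto simp: cohomology_coeff_def carrier_FactGroup gcocycle_group_def r_coset_def cohomology_class_def)

lemma one_cohomology_coeff: "\<one>\<^bsub>cohomology_coeff p X\<^esub> = cohomology_class p X (\<lambda>_. 0)"
  by (simp add: cohomology_coeff_def cohomology_class_def)

lemma alt_sign_add: "alt_sign i (a + b) = alt_sign i a + alt_sign i b"
  by (simp add: alt_sign_def)

lemma alt_sign_uminus: "alt_sign i (- a) = - alt_sign i a"
  by (simp add: alt_sign_def)

lemma gcoboundary_add:
  "gcoboundary p X (\<lambda>s. \<phi> s + \<psi> s) = (\<lambda>s. gcoboundary p X \<phi> s + gcoboundary p X \<psi> s)"
  by (rule ext) (simp add: gcoboundary_def alt_sign_add sum.distrib del: sum.atMost_Suc)

lemma gcoboundary_uminus: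
  "gcoboundary p X (\<lambda>s. - \<phi> s) = (\<lambda>s. - gcoboundary p X \<phi> s)"
  by (rule ext) (simp add: gcoboundary_def alt_sign_uminus sum_negf del: sum.atMost_Suc)

lemma gcoboundaries_zero:
  fixes X :: "'x topology"
  shows "(\<lambda>_. 0 :: 'g::ab_group_add) \<in> gcoboundaries p X"
proof (cases p)
  case (Suc n)
  have "gcoboundary n X (\<lambda>_. 0 :: 'g) = (\<lambda>_. 0)" "(\<lambda>_. 0 :: 'g) \<in> gcochains n X"
    by (auto simp: gcoboundary_def gcochains_def)
  then have "(\<lambda>_. 0 :: 'g) \<in> gcoboundary n X ` gcochains n X"
    by (intro image_eqI[of _ _ "\<lambda>_. 0"]) simp_all
  then show ?thesis by (simp add: gcoboundaries_def Suc)
qed (simp add: gcoboundaries_def)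

lemma gcoboundaries_add:
  assumes "\<alpha> \<in> gcoboundaries p X" "\<beta> \<in> gcoboundaries p X"
  shows "(\<lambda>s. \<alpha> s + \<beta> s) \<in> gcoboundaries p X"
proof (cases p)
  case (Suc n)
  then obtain \<phi> \<psi> where "\<phi> \<in> gcochains n X" "\<psi> \<in> gcochains n X"
    "\<alpha> = gcoboundary n X \<phi>" "\<beta> = gcoboundary n X \<psi>"
    using assms by (auto simp: gcoboundaries_def)
  moreover have "(\<lambda>s. \<phi> s + \<psi> s) \<in> gcochains n X"
    using calculation by (simp add: gcochains_def)
  ultimately have "(\<lambda>s. \<alpha> s + \<beta> s) \<in> gcoboundary n X ` gcochains n X"
    using gcoboundary_add[of n X \<phi> \<psi>] by (intro image_eqI[of _ _ "\<lambda>s. \<phi> s + \<psi> s"]) simp_all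
  then show ?thesis by (simp add: gcoboundaries_def Suc)
qed (use assms in \<open>simp add: gcoboundaries_def\<close>)

lemma gcoboundaries_uminus:
  assumes "\<alpha> \<in> gcoboundaries p X"
  shows "(\<lambda>s. - \<alpha> s) \<in> gcoboundaries p X"
proof (cases p)
  case (Suc n)
  then obtain \<phi> where "\<phi> \<in> gcochains n X" "\<alpha> = gcoboundary n X \<phi>"
    using assms by (auto simp: gcoboundaries_def)
  then have "(\<lambda>s. - \<alpha> s) \<in> gcoboundary n X ` gcochains n X"
    using gcoboundary_uminus[of n X \<phi>]
    by (intro image_eqI[of _ _ "\<lambda>s. - \<phi> s"]) (simp_all add: gcochains_def)
  then show ?thesis by (simp add: gcoboundaries_def Suc)
qed (use assms in \<open>simp add: gcoboundaries_def\<close>)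

lemma cohomology_class_coboundary:
  assumes "\<phi> \<in> gcoboundaries p X"
  shows "cohomology_class p X \<phi> = cohomology_class p X (\<lambda>_. 0)"
proof
  show "cohomology_class p X \<phi> \<subseteq> cohomology_class p X (\<lambda>_. 0)"
    using gcoboundaries_add[OF _ assms] by (auto simp: cohomology_class_def)
  have "\<exists>\<beta>'. \<beta> = (\<lambda>s. \<beta>' s + \<phi> s) \<and> \<beta>' \<in> gcoboundaries p X" if "\<beta> \<in> gcoboundaries p X" for \<beta>
    using gcoboundaries_add[OF that gcoboundaries_uminus[OF assms]]
    by (intro exI[of _ "\<lambda>s. \<beta> s + - \<phi> s"]) simp
  then show "cohomology_class p X (\<lambda>_. 0) \<subseteq> cohomology_class p X \<phi>"
    by (auto simp: cohomology_class_def)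
qed

lemma gcochain_pullback_add:
  "gcochain_pullback p X f (\<lambda>s. \<phi> s + \<psi> s) =
     (\<lambda>s. gcochain_pullback p X f \<phi> s + gcochain_pullback p X f \<psi> s)"
  by (auto simp: gcochain_pullback_def)

lemma gcochain_pullback_zero: "gcochain_pullback p X f (\<lambda>_. 0) = (\<lambda>_. 0)"
  by (simp add: gcochain_pullback_def)

lemma gcochain_pullback_gcochains: "gcochain_pullback p X f \<phi> \<in> gcochains p X"
  by (simp add: gcochain_pullback_def gcochains_def)

lemma gcoboundary_pullback:
  assumes "continuous_map X Y f"
  shows "gcoboundary p X (gcochain_pullback p X f \<phi>) = gcochain_pullback (Suc p) X f (gcoboundary p Y \<phi>)"
proof
  fix s
  show "gcoboundary p X (gcochain_pullback p X f \<phi>) s = gcochain_pullback (Suc p) X f (gcoboundary p Y \<phi>) s"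
  proof (cases "singular_simplex (Suc p) X s")
    case True
    have "singular_simplex p X (singular_face (Suc p) i s)" if "i \<le> Suc p" for i
      using singular_simplex_singular_face[OF True _ that] by simp
    moreover have "singular_face (Suc p) i (simplex_map (Suc p) f s) = simplex_map p f (singular_face (Suc p) i s)"
      if "i \<le> Suc p" for i
      using singular_face_simplex_map_face[of "Suc p" i f s] that by simp
    ultimately show ?thesis
      using True singular_simplex_simplex_map[OF True assms]
      by (simp add: gcoboundary_def gcochain_pullback_def del: sum.atMost_Suc)
  qed (simp add: gcoboundary_def gcochain_pullback_def)
qed

lemma gcoboundaries_pullback:
  assumes "continuous_map X Y f" "\<beta> \<in> gcoboundaries p Y"
  shows "gcochain_pullback p X f \<beta> \<in> gcoboundaries p X"
proof (cases p)
  case (Suc n)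
  then obtain \<phi> where "\<beta> = gcoboundary n Y \<phi>"
    using assms(2) by (auto simp: gcoboundaries_def)
  then have "gcochain_pullback p X f \<beta> = gcoboundary n X (gcochain_pullback n X f \<phi>)"
    using gcoboundary_pullback[OF assms(1)] Suc by metis
  then have "gcochain_pullback p X f \<beta> \<in> gcoboundary n X ` gcochains n X"
    using gcochain_pullback_gcochains by blast
  then show ?thesis by (simp add: gcoboundaries_def Suc)
next
  case 0
  then show ?thesis using assms(2) by (auto simp: gcoboundaries_def gcochain_pullback_def)
qed

lemma cohomology_induced_class:
  assumes "continuous_map X Y f"
  shows "cohomology_induced p X f (cohomology_class p Y \<phi>) = cohomology_class p X (gcochain_pullback p X f \<phi>)"
proof
  show "cohomology_induced p X f (cohomology_class p Y \<phi>) \<subseteq> cohomology_class p X (gcochain_pullback p X f \<phi>)"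
  proof
    fix y assume "y \<in> cohomology_induced p X f (cohomology_class p Y \<phi>)"
    then obtain \<beta> \<beta>' where b: "\<beta> \<in> gcoboundaries p X" "\<beta>' \<in> gcoboundaries p Y"
      "y = (\<lambda>s. \<beta> s + gcochain_pullback p X f (\<lambda>s. \<beta>' s + \<phi> s) s)"
      by (auto simp: cohomology_induced_def cohomology_class_def)
    then have "y = (\<lambda>s. (\<beta> s + gcochain_pullback p X f \<beta>' s) + gcochain_pullback p X f \<phi> s)"
      by (simp add: gcochain_pullback_add add.assoc)
    moreover have "(\<lambda>s. \<beta> s + gcochain_pullback p X f \<beta>' s) \<in> gcoboundaries p X"
      using b gcoboundaries_add gcoboundaries_pullback[OF assms] by blast
    ultimately show "y \<in> cohomology_class p X (gcochain_pullback p X f \<phi>)"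
      unfolding cohomology_class_def by (intro CollectI exI conjI)
  qed
  have "\<phi> \<in> cohomology_class p Y \<phi>"
    unfolding cohomology_class_def using gcoboundaries_zero by force
  then show "cohomology_class p X (gcochain_pullback p X f \<phi>) \<subseteq> cohomology_induced p X f (cohomology_class p Y \<phi>)"
    unfolding cohomology_induced_def cohomology_class_def[of p X] by blast
qed

lemma cohomology_induced_carrier:
  assumes "continuous_map X Y f" "A \<in> carrier (cohomology_coeff p Y)"
  shows "cohomology_induced p X f A \<in> carrier (cohomology_coeff p X)"
proof -
  obtain \<phi> where c: "A = cohomology_class p Y \<phi>" "gcoboundary p Y \<phi> = (\<lambda>_. 0)"
    using assms(2) by (auto simp: carrier_cohomology_coeff)
  then show ?thesis
    by (auto simp: carrier_cohomology_coeff cohomology_induced_class[OF assms(1)]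
        gcoboundary_pullback[OF assms(1)] gcochain_pullback_zero gcochain_pullback_gcochains intro!: imageI)
qed

lemma cohomology_induced_one:
  assumes "continuous_map X Y f"
  shows "cohomology_induced p X f \<one>\<^bsub>cohomology_coeff p Y\<^esub> = \<one>\<^bsub>cohomology_coeff p X\<^esub>"
  by (simp add: one_cohomology_coeff cohomology_induced_class[OF assms] gcochain_pullback_zero)

lemma cohomology_induced_compose:
  assumes "continuous_map X Y f" "continuous_map Y Z g" "A \<in> carrier (cohomology_coeff p Z)"
  shows "cohomology_induced p X f (cohomology_induced p Y g A) = cohomology_induced p X (g \<circ> f) A"
proof -
  obtain \<phi> where c: "A = cohomology_class p Z \<phi>"
    using assms(3) by (auto simp: carrier_cohomology_coeff)
  have "gcochain_pullback p X f (gcochain_pullback p Y g \<phi>) = gcochain_pullback p X (g \<circ> f) \<phi>"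
    by (rule ext) (simp add: gcochain_pullback_def simplex_map_compose singular_simplex_simplex_map[OF _ assms(1)])
  then show ?thesis
    by (simp add: c cohomology_induced_class[OF assms(1)] cohomology_induced_class[OF assms(2)]
        cohomology_induced_class[OF continuous_map_compose[OF assms(1,2)]])
qed

lemma cohomology_induced_cong:
  fixes A :: "('y, 'g::ab_group_add) gcochain set"
  assumes "\<And>x. x \<in> topspace X \<Longrightarrow> f x = g x"
  shows "cohomology_induced p X f A = cohomology_induced p X g A"
proof -
  have "gcochain_pullback p X f = (gcochain_pullback p X g :: ('y, 'g) gcochain \<Rightarrow> _)"
    by (intro ext) (simp add: gcochain_pullback_def simplex_map_eq[OF _ assms])
  then show ?thesis by (simp add: cohomology_induced_def)
qed

text \<open>The dual of the cone homotopy: evaluating the cocycle on the cone over \<open>s\<close>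
  gives 0 on one side, and on the other \<open>\<phi> s\<close> minus the coboundary of the cochain
  that reads \<open>\<phi>\<close> on cones.\<close>

lemma cohomology_coeff_euclidean_trivial:
  fixes A :: "('x::real_normed_vector, 'g::ab_group_add) gcochain set"
  assumes "0 < p" "A \<in> carrier (cohomology_coeff p euclidean)"
  shows "A = \<one>\<^bsub>cohomology_coeff p euclidean\<^esub>"
proof -
  obtain \<phi> :: "('x, 'g) gcochain" where c: "A = cohomology_class p euclidean \<phi>"
    "\<phi> \<in> gcochains p euclidean" "gcoboundary p euclidean \<phi> = (\<lambda>_. 0)"
    using assms(2) by (auto simp: carrier_cohomology_coeff)
  obtain n where p: "p = Suc n" using assms(1) by (cases p) auto
  \<comment> \<open>The value 0 off the singular simplices is the normalization required of
    cochains.\<close>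
  define \<psi> where "\<psi> t = (if singular_simplex n euclidean t then \<phi> (cone_simplex n t) else 0)" for t
  have "\<phi> = gcoboundary n euclidean \<psi>"
  proof
    fix s
    show "\<phi> s = gcoboundary n euclidean \<psi> s"
    proof (cases "singular_simplex p euclidean s")
      case False
      then show ?thesis using c(2) by (simp add: gcochains_def gcoboundary_def p)
    next
      case True
      have f: "singular_simplex n euclidean (singular_face p i s)" if "i \<le> p" for i
        using singular_simplex_singular_face[OF True _ that] p by simp
      have "0 = gcoboundary p euclidean \<phi> (cone_simplex p s)"
        by (simp add: c(3))
      also have "\<dots> = (\<Sum>i\<le>Suc p. alt_sign i (\<phi> (singular_face (Suc p) i (cone_simplex p s))))"
        using singular_simplex_cone[OF True] by (simp add: gcoboundary_def del: sum.atMost_Suc)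
      also have "\<dots> = \<phi> s + (\<Sum>i\<le>p. alt_sign (Suc i) (\<phi> (cone_simplex n (singular_face p i s))))"
        unfolding sum.atMost_Suc_shift
      proof (rule arg_cong2[of _ _ _ _ "(+)"])
        show "alt_sign 0 (\<phi> (singular_face (Suc p) 0 (cone_simplex p s))) = \<phi> s"
          by (simp add: face_0_cone[OF True] alt_sign_def)
        show "(\<Sum>i\<le>p. alt_sign (Suc i) (\<phi> (singular_face (Suc p) (Suc i) (cone_simplex p s)))) =
            (\<Sum>i\<le>p. alt_sign (Suc i) (\<phi> (cone_simplex n (singular_face p i s))))"
          by (rule sum.cong) (auto simp: face_Suc_cone p)
      qed
      also have "\<dots> = \<phi> s - (\<Sum>i\<le>p. alt_sign i (\<psi> (singular_face p i s)))"
        using f by (simp add: alt_sign_Suc sum_negf \<psi>_def)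
      also have "\<dots> = \<phi> s - gcoboundary n euclidean \<psi> s"
        using True by (simp add: gcoboundary_def p del: sum.atMost_Suc)
      finally show ?thesis by simp
    qed
  qed
  moreover have "\<psi> \<in> gcochains n euclidean"
    by (simp add: gcochains_def \<psi>_def)
  ultimately have "\<phi> \<in> gcoboundaries p euclidean"
    by (simp add: gcoboundaries_def p)
  then show ?thesis
    by (simp add: c(1) cohomology_class_coboundary one_cohomology_coeff)
qed

section \<open>Direct limits\<close>

lemma bond_add: "bond f r (m + n) x = bond f (r + m) n (bond f r m x)"
  by (induction n) (simp_all add: add.assoc)

lemma bond_carrier:
  assumes "\<And>r x. N \<le> r \<Longrightarrow> x \<in> carrier (G r) \<Longrightarrow> f r x \<in> carrier (G (Suc r))"
    and "N \<le> r" "x \<in> carrier (G r)"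
  shows "bond f r n x \<in> carrier (G (r + n))"
  by (induction n) (use assms in simp_all)

lemma ind_class_self:
  assumes "N \<le> r" "x \<in> carrier (G r)"
  shows "(r, x) \<in> ind_class N G f r x"
proof -
  have "r + 0 = r + 0 \<and> bond f r 0 x = bond f r 0 x" by simp
  then show ?thesis unfolding ind_class_def using assms by blast
qed

text \<open>Transitivity of the relation of becoming equal at a later level. The classes are sets,
  so equality will follow by symmetry.\<close>

lemma ind_class_subset:
  assumes "r + m = s + n" "bond f r m x = bond f s n y"
  shows "ind_class N G f r x \<subseteq> ind_class N G f s y"
proof clarify
  fix t z assume "(t, z) \<in> ind_class N G f r x"
  then obtain m' n' where t: "N \<le> t" "z \<in> carrier (G t)" and
    mn: "r + m' = t + n'" "bond f r m' x = bond f t n' z"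
    by (auto simp: ind_class_def)
  \<comment> \<open>All three representatives are pushed to the common level r + m + m', where both
    known equalities are available.\<close>
  have "bond f s (n + m') y = bond f r (m + m') x"
    by (simp add: bond_add assms)
  also have "\<dots> = bond f r (m' + m) x" by (simp add: add.commute)
  also have "\<dots> = bond f t (n' + m) z" by (simp add: bond_add mn)
  finally have "s + (n + m') = t + (n' + m) \<and> bond f s (n + m') y = bond f t (n' + m) z"
    using assms(1) mn(1) by simp
  then show "(t, z) \<in> ind_class N G f s y"
    unfolding ind_class_def using t by blast
qed

lemma ind_class_eqI:
  assumes "r + m = s + n" "bond f r m x = bond f s n y"
  shows "ind_class N G f r x = ind_class N G f s y"
  using ind_class_subset[OF assms] ind_class_subset[OF assms(1)[symmetric] assms(2)[symmetric]]
  by blast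

text \<open>The maps \<open>u r\<close> may raise the level by \<open>e\<close>: this is
  \<open>q\<close> for the automaton and for the inclusion of the good set of \<open>a\<close> into
  that of \<open>\<Phi> a\<close>, and 0 for the sections.\<close>

lemma bond_natural:
  assumes "\<And>r x. N \<le> r \<Longrightarrow> x \<in> carrier (G r) \<Longrightarrow> f r x \<in> carrier (G (Suc r))"
    and "\<And>r x. N \<le> r \<Longrightarrow> x \<in> carrier (G r) \<Longrightarrow> u (Suc r) (f r x) = f' (r + e) (u r x)"
    and "N \<le> r" "x \<in> carrier (G r)"
  shows "bond f' (r + e) n (u r x) = u (r + n) (bond f r n x)"
proof (induction n)
  case (Suc n)
  then show ?case
    using assms(2)[OF _ bond_carrier[OF assms(1,3,4)], of n] assms(3) by (simp add: ac_simps)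
qed simp

text \<open>Maps between direct limits are encoded as unions over all representatives. Naturality
  makes the classes in the union equal, and it is not empty as a class contains its own
  representative.\<close>

lemma UN_ind_class_map:
  assumes f: "\<And>r x. N \<le> r \<Longrightarrow> x \<in> carrier (G r) \<Longrightarrow> f r x \<in> carrier (G (Suc r))"
    and u: "\<And>r x. N \<le> r \<Longrightarrow> x \<in> carrier (G r) \<Longrightarrow> u (Suc r) (f r x) = f' (r + e) (u r x)"
    and r: "N \<le> r" "x \<in> carrier (G r)"
  shows "(\<Union>(s, y)\<in>ind_class N G f r x. ind_class N' G' f' (s + e) (u s y)) = ind_class N' G' f' (r + e) (u r x)"
proof -
  have nat: "bond f' (t + e) j (u t z) = u (t + j) (bond f t j z)"
    if "N \<le> t" "z \<in> carrier (G t)" for t z j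
    by (rule bond_natural[where N = N and G = G]) (use f u that in auto)
  have "ind_class N' G' f' (s + e) (u s y) = ind_class N' G' f' (r + e) (u r x)"
    if mem: "(s, y) \<in> ind_class N G f r x" for s y
  proof -
    obtain m n where s: "N \<le> s" "y \<in> carrier (G s)" and mn: "r + m = s + n" "bond f r m x = bond f s n y"
      using mem by (auto simp: ind_class_def)
    show ?thesis
    proof (rule ind_class_eqI)
      show "s + e + n = r + e + m" using mn(1) by simp
      show "bond f' (s + e) n (u s y) = bond f' (r + e) m (u r x)"
        unfolding nat[OF s] nat[OF r] using mn by simp
    qed
  qed
  then show ?thesis
    using ind_class_self[of N r x G f] r by blast
qed

section \<open>Homotopy groups\<close>

text \<open>A homotopy through such maps is a free homotopy of spheres: at each time the boundary
  goes to one point, which may move with time.\<close>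

abbreviation constant_on_bd :: "nat \<Rightarrow> ((nat \<Rightarrow> real) \<Rightarrow> 'x) \<Rightarrow> bool" where
  "constant_on_bd k h \<equiv> \<exists>y. \<forall>u\<in>kcube_bd k. h u = y"

lemma kcube_bd_subset: "kcube_bd k \<subseteq> topspace (kcube k)"
  by (auto simp: kcube_bd_def)

lemma topspace_kcube: "topspace (kcube k) = Pi\<^sub>E {..<k} (\<lambda>_. {0..1})"
  by (simp add: kcube_def)

lemma continuous_map_kcube_coord:
  assumes "i < k"
  shows "continuous_map (prod_topology Z (kcube k)) euclideanreal (\<lambda>p. snd p i)"
proof -
  have "continuous_map (kcube k) (top_of_set {0..1}) (\<lambda>u. u i)"
    unfolding kcube_def using assms by (intro continuous_map_product_projection) simp
  then have "continuous_map (kcube k) euclideanreal (\<lambda>u. u i)"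
    by (rule continuous_map_into_fulltopology)
  then show ?thesis
    using continuous_map_compose[OF continuous_map_snd] unfolding o_def by blast
qed

lemma continuous_map_unit_fst:
  "continuous_map (prod_topology (top_of_set {0..1}) Z) euclideanreal fst"
  using continuous_map_fst continuous_map_into_fulltopology by blast

section \<open>Making a free nullhomotopy relative to the boundary\<close>

text \<open>For \<open>p = (s, u)\<close>, the point \<open>u\<close> is scaled from the centre of
  the cube by 1 + s and clamped back into the cube. A concentric cube of side 1/(1 + s) is blown up
  to the full one, and the collar around it goes to the boundary.\<close>

definition collar_map :: "nat \<Rightarrow> real \<times> (nat \<Rightarrow> real) \<Rightarrow> nat \<Rightarrow> real" where
  "collar_map k p = (\<lambda>i\<in>{..<k}. max 0 (min 1 (1/2 + (1 + fst p) * (snd p i - 1/2))))"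

text \<open>Twice the total overshoot removed by the clamping. It vanishes on the inner cube; the
  factor 2 makes it at least \<open>s\<close> on the boundary, where one coordinate overshoots by
  s/2.\<close>

definition collar_height :: "nat \<Rightarrow> real \<times> (nat \<Rightarrow> real) \<Rightarrow> real" where
  "collar_height k p = (\<Sum>i<k. 2 * max 0 ((1 + fst p) * \<bar>snd p i - 1/2\<bar> - 1/2))"

text \<open>The time at which the free homotopy is read: 1 - s on the inner cube, rising through the
  collar to 1 on the boundary.\<close>

definition collar_time :: "nat \<Rightarrow> real \<times> (nat \<Rightarrow> real) \<Rightarrow> real" where
  "collar_time k p = max 0 (min 1 (1 - fst p + collar_height k p))"

lemma continuous_map_collar_map:
  "continuous_map (prod_topology (top_of_set {0..1}) (kcube k)) (kcube k) (collar_map k)"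
proof -
  have "continuous_map (prod_topology (top_of_set {0..1}) (kcube k)) (top_of_set {0..1})
      (\<lambda>p. collar_map k p i)" if "i < k" for i
    unfolding continuous_map_in_subtopology
    using that
    by (auto simp: collar_map_def intro!: continuous_intros continuous_map_real_max continuous_map_real_min
        continuous_map_unit_fst continuous_map_kcube_coord)
  then show ?thesis
    unfolding kcube_def[of k] continuous_map_componentwise unfolding kcube_def[symmetric]
    by (auto simp: collar_map_def)
qed

lemma continuous_map_collar_time:
  "continuous_map (prod_topology (top_of_set {0..1}) (kcube k)) (top_of_set {0..1}) (collar_time k)"
proof -
  have "continuous_map (prod_topology (top_of_set {0..1}) (kcube k)) euclideanreal
      (\<lambda>p. max 0 (min 1 (1 - fst p + (\<Sum>i<k. 2 * max 0 ((1 + fst p) * \<bar>snd p i - 1/2\<bar> - 1/2)))))"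
    by (auto intro!: continuous_intros continuous_map_real_max continuous_map_real_min
        continuous_map_unit_fst continuous_map_kcube_coord continuous_map_real_abs)
  then show ?thesis
    unfolding continuous_map_in_subtopology collar_time_def[abs_def] collar_height_def by auto
qed

lemma collar_height_nonneg: "0 \<le> collar_height k p"
  unfolding collar_height_def by (intro sum_nonneg) simp

lemma collar_height_ge:
  assumes "i < k"
  shows "2 * max 0 ((1 + fst p) * \<bar>snd p i - 1/2\<bar> - 1/2) \<le> collar_height k p"
  unfolding collar_height_def using assms
  by (intro member_le_sum[where f = "\<lambda>i. 2 * max 0 ((1 + fst p) * \<bar>snd p i - 1/2\<bar> - 1/2)"]) auto

lemma collar_0:
  assumes "u \<in> topspace (kcube k)"
  shows "collar_map k (0, u) = u" "collar_time k (0, u) = 1"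
proof -
  have u: "0 \<le> u i" "u i \<le> 1" if "i < k" for i
    using assms that by (auto simp: topspace_kcube PiE_iff)
  show "collar_map k (0, u) = u"
    using assms u by (auto simp: fun_eq_iff collar_map_def topspace_kcube PiE_iff extensional_def)
  show "collar_time k (0, u) = 1"
    using collar_height_nonneg[of k "(0, u)"] by (simp add: collar_time_def)
qed

lemma collar_bd:
  assumes "u \<in> kcube_bd k" "s \<in> {0..1}"
  shows "collar_map k (s, u) \<in> kcube_bd k" "collar_time k (s, u) = 1"
proof -
  obtain i where i: "i < k" "u i = 0 \<or> u i = 1"
    using assms(1) by (auto simp: kcube_bd_def)
  have "u \<in> topspace (kcube k)" using assms(1) kcube_bd_subset by blast
  then have "collar_map k (s, u) \<in> topspace (kcube k)"
    using continuous_map_funspace[OF continuous_map_collar_map[of k]] assms(2) by auto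
  moreover have "collar_map k (s, u) i = 0 \<or> collar_map k (s, u) i = 1"
  proof -
    have "1/2 - (1 + s) / 2 \<le> 0" "1 \<le> 1/2 + (1 + s) / 2"
      using assms(2) by (auto simp: field_simps)
    then show ?thesis using i by (auto simp: collar_map_def)
  qed
  ultimately show "collar_map k (s, u) \<in> kcube_bd k"
    using i(1) by (auto simp: kcube_bd_def)
  \<comment> \<open>The coordinate on the boundary overshoots by s/2, so the height is at least
    \<open>s\<close> and the time is clamped to 1.\<close>
  have "\<bar>u i - 1/2\<bar> = 1/2" using i(2) by auto
  then have "s \<le> collar_height k (s, u)"
    using collar_height_ge[OF i(1), of "(s, u)"] assms(2) by (auto simp: max_def field_simps split: if_splits)
  then show "collar_time k (s, u) = 1" by (simp add: collar_time_def)
qed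

text \<open>Positive height means that some coordinate has been clamped, hence equals 0 or
  1.\<close>

lemma collar_1:
  assumes "u \<in> topspace (kcube k)" "0 < collar_height k (1, u)"
  shows "collar_map k (1, u) \<in> kcube_bd k"
proof -
  have "\<exists>i<k. 0 < 2 * max 0 ((1 + fst (1::real, u)) * \<bar>snd (1::real, u) i - 1/2\<bar> - 1/2)"
  proof (rule ccontr)
    assume "\<not> ?thesis"
    then have "2 * max 0 ((1 + fst (1::real, u)) * \<bar>snd (1::real, u) i - 1/2\<bar> - 1/2) \<le> 0" if "i < k" for i
      using that by (meson not_less)
    then have "collar_height k (1, u) \<le> 0"
      unfolding collar_height_def by (intro sum_nonpos) blast
    with assms(2) show False by simp
  qed
  then obtain i where i: "i < k" "1/2 < 2 * \<bar>u i - 1/2\<bar>"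
    by (auto simp: max_def split: if_splits)
  have "collar_map k (1, u) \<in> topspace (kcube k)"
    using continuous_map_funspace[OF continuous_map_collar_map[of k]] assms(1) by auto
  moreover have "collar_map k (1, u) i = 0 \<or> collar_map k (1, u) i = 1"
    using i by (auto simp: collar_map_def max_def min_def abs_if split: if_splits)
  ultimately show ?thesis
    using i(1) by (auto simp: kcube_bd_def)
qed

lemma homotopic_rel_bdI:
  fixes K :: "real \<times> (nat \<Rightarrow> real) \<Rightarrow> 'x"
  assumes "continuous_map (prod_topology (top_of_set {0..1}) (kcube k)) X K"
    and "\<And>u. u \<in> topspace (kcube k) \<Longrightarrow> K (0, u) = f u"
    and "\<And>u. u \<in> topspace (kcube k) \<Longrightarrow> K (1, u) = g u"
    and "\<And>t u. t \<in> {0..1} \<Longrightarrow> u \<in> kcube_bd k \<Longrightarrow> K (t, u) = x"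
  shows "homotopic_with (\<lambda>h. \<forall>u\<in>kcube_bd k. h u = x) (kcube k) X f g"
proof -
  have "(\<forall>u\<in>kcube_bd k. h u = x) \<longleftrightarrow> (\<forall>u\<in>kcube_bd k. h' u = x)"
    if "\<And>u. u \<in> topspace (kcube k) \<Longrightarrow> h u = h' u" for h h' :: "(nat \<Rightarrow> real) \<Rightarrow> 'x"
    using that kcube_bd_subset by (metis subsetD)
  from homotopic_with[of "kcube k" "\<lambda>h. \<forall>u\<in>kcube_bd k. h u = x", OF this]
  show ?thesis using assms by blast
qed

text \<open>
  A free nullhomotopy becomes one relative to the boundary: shrink the cube and fill the collar that
  this leaves with the path traced by the boundary, then contract that path to its end point.
\<close>

lemma nullhomotopic_rel_bd:
  assumes "1 \<le> k" and hom: "homotopic_with (constant_on_bd k) (kcube k) X h (\<lambda>_. x0)"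
    and hx: "\<And>u. u \<in> kcube_bd k \<Longrightarrow> h u = x"
  shows "homotopic_with (\<lambda>h. \<forall>u\<in>kcube_bd k. h u = x) (kcube k) X h (\<lambda>_. x)"
proof -
  let ?I = "top_of_set {0..1::real}"
  obtain H where cH: "continuous_map (prod_topology ?I (kcube k)) X H"
    \<comment> \<open>The homotopy is reversed to run from the constant map at time 0 to
      \<open>h\<close> at time 1, in line with \<open>collar_time\<close>.\<close>
    and H0: "\<And>u. H (0, u) = x0" and H1: "\<And>u. H (1, u) = h u"
    and Hbd: "\<And>t. t \<in> {0..1} \<Longrightarrow> constant_on_bd k (\<lambda>u. H (t, u))"
    using homotopic_with_symD[OF hom] unfolding homotopic_with_def by blast
  \<comment> \<open>Some boundary point is needed to name the path traced by the boundary; the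
    corner 0 serves, and it lies on the boundary since \<open>1 \<le> k\<close>.\<close>
  define b where "b = (\<lambda>i\<in>{..<k}. 0::real)"
  have b: "b \<in> kcube_bd k"
    using \<open>1 \<le> k\<close> by (auto simp: b_def kcube_bd_def topspace_kcube intro!: exI[of _ 0])
  have Hb: "H (t, u) = H (t, b)" if "t \<in> {0..1}" "u \<in> kcube_bd k" for t u
    using Hbd[OF that(1)] that(2) b by metis
  have c\<gamma>: "continuous_map ?I X (\<lambda>t. H (t, b))"
  proof -
    have "b \<in> topspace (kcube k)" using b kcube_bd_subset by blast
    then have "continuous_map ?I (prod_topology ?I (kcube k)) (\<lambda>t. (t, b))"
      by (auto intro!: continuous_map_pairedI)
    then show ?thesis using continuous_map_compose[OF _ cH] unfolding o_def by blast
  qed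
  have T01: "collar_time k p \<in> {0..1}" for p by (auto simp: collar_time_def)
  have "homotopic_with (\<lambda>h. \<forall>u\<in>kcube_bd k. h u = x) (kcube k) X h (\<lambda>u. H (collar_time k (1, u), b))"
  proof (rule homotopic_rel_bdI[of _ _ "\<lambda>p. H (collar_time k p, collar_map k p)"])
    have "continuous_map (prod_topology ?I (kcube k)) (prod_topology ?I (kcube k))
        (\<lambda>p. (collar_time k p, collar_map k p))"
      by (intro continuous_map_pairedI continuous_map_collar_time continuous_map_collar_map)
    then show "continuous_map (prod_topology ?I (kcube k)) X (\<lambda>p. H (collar_time k p, collar_map k p))"
      using continuous_map_compose[OF _ cH] unfolding o_def by blast
  next
    fix u assume "u \<in> topspace (kcube k)"
    then show "H (collar_time k (0, u), collar_map k (0, u)) = h u"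
      by (simp add: collar_0 H1)
  next
    fix u assume u: "u \<in> topspace (kcube k)"
    show "H (collar_time k (1, u), collar_map k (1, u)) = H (collar_time k (1, u), b)"
    \<comment> \<open>At height 0 the time is 0, when \<open>H\<close> is constant. At positive
      height the point has been pushed to the boundary, where \<open>H\<close> depends on the time
      only.\<close>
    proof (cases "collar_height k (1, u) = 0")
      case True
      then have "collar_time k (1, u) = 0" by (simp add: collar_time_def)
      then show ?thesis by (simp add: H0)
    next
      case False
      then have "0 < collar_height k (1, u)" using collar_height_nonneg[of k "(1, u)"] by simp
      then show ?thesis using Hb[OF T01 collar_1[OF u]] by blast
    qed
  next
    fix s :: real and u assume "s \<in> {0..1}" "u \<in> kcube_bd k"
    then show "H (collar_time k (s, u), collar_map k (s, u)) = x"
      using collar_bd[of u k s] by (simp add: H1 hx)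
  qed
  moreover have "homotopic_with (\<lambda>h. \<forall>u\<in>kcube_bd k. h u = x) (kcube k) X
      (\<lambda>u. H (collar_time k (1, u), b)) (\<lambda>_. x)"
  \<comment> \<open>The map now factors through the path of the boundary. Letting the time run on
    until it stops at 1 slides it along that path to the base point.\<close>
  proof (rule homotopic_rel_bdI[of _ _ "\<lambda>p. H (min 1 (collar_time k (1, snd p) + fst p), b)"])
    have "continuous_map (prod_topology ?I (kcube k)) (prod_topology ?I (kcube k)) (\<lambda>p. (1, snd p))"
      by (intro continuous_map_pairedI continuous_map_snd) simp
    then have "continuous_map (prod_topology ?I (kcube k)) ?I (\<lambda>p. collar_time k (1, snd p))"
      using continuous_map_compose[OF _ continuous_map_collar_time] unfolding o_def by blast
    then have "continuous_map (prod_topology ?I (kcube k)) euclideanreal (\<lambda>p. collar_time k (1, snd p))"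
      by (rule continuous_map_into_fulltopology)
    then have "continuous_map (prod_topology ?I (kcube k)) euclideanreal (\<lambda>p. min 1 (collar_time k (1, snd p) + fst p))"
      by (intro continuous_map_real_min continuous_intros continuous_map_unit_fst) auto
    then have "continuous_map (prod_topology ?I (kcube k)) ?I (\<lambda>p. min 1 (collar_time k (1, snd p) + fst p))"
      unfolding continuous_map_in_subtopology using T01 by auto
    then show "continuous_map (prod_topology ?I (kcube k)) X (\<lambda>p. H (min 1 (collar_time k (1, snd p) + fst p), b))"
      using continuous_map_compose[OF _ c\<gamma>] unfolding o_def by blast
  next
    fix u
    show "H (min 1 (collar_time k (1, snd (0, u)) + fst (0, u)), b) = H (collar_time k (1, u), b)"
      using T01[of "(1, u)"] by (simp add: min_absorb2)
    show "H (min 1 (collar_time k (1, snd (1, u)) + fst (1, u)), b) = x"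
      using T01[of "(1, u)"] by (simp add: min_absorb1 H1 hx b)
  next
    fix s :: real and u assume "s \<in> {0..1}" "u \<in> kcube_bd k"
    then show "H (min 1 (collar_time k (1, snd (s, u)) + fst (s, u)), b) = x"
      using collar_bd[of u k 1] by (simp add: H1 hx b min_def)
  qed
  ultimately show ?thesis by (rule homotopic_with_trans)
qed

section \<open>Classes of spheroids and induced maps\<close>

lemma spheroid_class_self: "spheroid k X x f \<Longrightarrow> f \<in> spheroid_class k X x f"
  by (simp add: spheroid_class_def spheroid_def)

lemma spheroid_class_eq:
  assumes "g \<in> spheroid_class k X x f"
  shows "spheroid_class k X x g = spheroid_class k X x f"
proof -
  have "homotopic_with (\<lambda>h. \<forall>u\<in>kcube_bd k. h u = x) (kcube k) X f g"
    using assms by (simp add: spheroid_class_def)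
  then show ?thesis
    unfolding spheroid_class_def using homotopic_with_trans homotopic_with_symD by blast
qed

lemma spheroid_class_spheroid:
  assumes "g \<in> spheroid_class k X x f"
  shows "spheroid k X x f" "spheroid k X x g"
proof -
  have "homotopic_with (\<lambda>h. \<forall>u\<in>kcube_bd k. h u = x) (kcube k) X f g"
    using assms by (simp add: spheroid_class_def)
  from homotopic_with_imp_continuous_maps[OF this] homotopic_with_imp_property[OF this]
  show "spheroid k X x f" "spheroid k X x g" by (auto simp: spheroid_def)
qed

lemma spheroid_compose:
  assumes "continuous_map X Y \<phi>" "\<phi> x = y" "spheroid k X x f"
  shows "spheroid k Y y (\<phi> \<circ> f)"
  using assms continuous_map_compose[OF _ assms(1)] by (auto simp: spheroid_def)

lemma spheroid_class_compose:
  assumes "continuous_map X Y \<phi>" "\<phi> x = y" "g \<in> spheroid_class k X x f"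
  shows "\<phi> \<circ> g \<in> spheroid_class k Y y (\<phi> \<circ> f)"
  using assms unfolding spheroid_class_def
  by (auto intro!: homotopic_with_compose_continuous_map_left)

lemma carrier_homotopy_group:
  "carrier (homotopy_group k X x) = spheroid_class k X x ` Collect (spheroid k X x)"
  by (simp add: homotopy_group_def)

lemma one_homotopy_group: "\<one>\<^bsub>homotopy_group k X x\<^esub> = spheroid_class k X x (\<lambda>_. x)"
  by (simp add: homotopy_group_def)

lemma homotopy_induced_class:
  assumes "continuous_map X Y \<phi>" "\<phi> x = y" "spheroid k X x f"
  shows "homotopy_induced k Y y \<phi> (spheroid_class k X x f) = spheroid_class k Y y (\<phi> \<circ> f)"
proof -
  have "spheroid_class k Y y (\<phi> \<circ> g) = spheroid_class k Y y (\<phi> \<circ> f)" if "g \<in> spheroid_class k X x f" for g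
    using spheroid_class_eq[OF spheroid_class_compose[OF assms(1,2) that]] .
  then show ?thesis
    unfolding homotopy_induced_def using spheroid_class_self[OF assms(3)] by blast
qed

lemma homotopy_induced_carrier:
  assumes "continuous_map X Y \<phi>" "\<phi> x = y" "A \<in> carrier (homotopy_group k X x)"
  shows "homotopy_induced k Y y \<phi> A \<in> carrier (homotopy_group k Y y)"
  using assms(3) spheroid_compose[OF assms(1,2)]
  by (auto simp: carrier_homotopy_group homotopy_induced_class[OF assms(1,2)])

lemma homotopy_induced_one:
  assumes "continuous_map X Y \<phi>" "\<phi> x = y" "x \<in> topspace X"
  shows "homotopy_induced k Y y \<phi> \<one>\<^bsub>homotopy_group k X x\<^esub> = \<one>\<^bsub>homotopy_group k Y y\<^esub>"
proof -
  have "spheroid k X x (\<lambda>_. x)" using assms(3) by (simp add: spheroid_def)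
  from homotopy_induced_class[OF assms(1,2) this]
  show ?thesis by (simp add: one_homotopy_group assms(2) o_def)
qed

lemma spheroid_class_cong:
  assumes "spheroid k X x f" "\<And>u. u \<in> topspace (kcube k) \<Longrightarrow> f u = g u"
  shows "spheroid_class k X x f = spheroid_class k X x g"
proof -
  have "g \<in> spheroid_class k X x f"
    unfolding spheroid_class_def using assms kcube_bd_subset
    by (auto simp: spheroid_def subset_iff intro!: homotopic_with_equal)
  from spheroid_class_eq[OF this] show ?thesis by simp
qed

text \<open>Commutativity is required on points of \<open>X\<close> only, which suffices because a
  class depends on the values of its representative on the cube alone.\<close>

lemma homotopy_induced_square:
  assumes "continuous_map X Y \<phi>" "\<phi> x = y" "continuous_map Y Z \<psi>" "\<psi> y = z"
    and "continuous_map X Y' \<phi>'" "\<phi>' x = y'" "continuous_map Y' Z \<psi>'" "\<psi>' y' = z"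
    and sq: "\<And>p. p \<in> topspace X \<Longrightarrow> \<psi> (\<phi> p) = \<psi>' (\<phi>' p)"
    and "A \<in> carrier (homotopy_group k X x)"
  shows "homotopy_induced k Z z \<psi> (homotopy_induced k Y y \<phi> A) =
    homotopy_induced k Z z \<psi>' (homotopy_induced k Y' y' \<phi>' A)"
proof -
  obtain f where f: "spheroid k X x f" "A = spheroid_class k X x f"
    using assms(10) by (auto simp: carrier_homotopy_group)
  have "f u \<in> topspace X" if "u \<in> topspace (kcube k)" for u
    using f(1) that continuous_map_funspace unfolding spheroid_def by blast
  then have "spheroid_class k Z z (\<psi> \<circ> (\<phi> \<circ> f)) = spheroid_class k Z z (\<psi>' \<circ> (\<phi>' \<circ> f))"
    using spheroid_compose[OF assms(3,4) spheroid_compose[OF assms(1,2) f(1)]]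
    by (intro spheroid_class_cong) (simp_all add: sq)
  then show ?thesis
    by (simp add: f(2) homotopy_induced_class[OF assms(1,2) f(1)] homotopy_induced_class[OF assms(5,6) f(1)]
        homotopy_induced_class[OF assms(3,4) spheroid_compose[OF assms(1,2) f(1)]]
        homotopy_induced_class[OF assms(7,8) spheroid_compose[OF assms(5,6) f(1)]])
qed

section \<open>Free homotopies\<close>

text \<open>What remains of a change of base point once its path is forgotten: the homotopy defining
  the transport sends the boundary to one point at each time.\<close>

lemma homotopy_transport_homotopic:
  assumes "g \<in> homotopy_transport k X \<gamma> A"
  obtains f where "f \<in> A" "homotopic_with (constant_on_bd k) (kcube k) X f g"
proof -
  obtain f H where f: "f \<in> A" and H: "continuous_map (prod_topology (top_of_set {0..1}) (kcube k)) X H"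
    "\<forall>u\<in>topspace (kcube k). H (0, u) = f u \<and> H (1, u) = g u"
    "\<forall>t\<in>{0..1}. \<forall>u\<in>kcube_bd k. H (t, u) = \<gamma> t"
    using assms by (auto simp: homotopy_transport_def)
  have "constant_on_bd k h \<longleftrightarrow> constant_on_bd k h'"
    if "\<And>u. u \<in> topspace (kcube k) \<Longrightarrow> h u = h' u" for h h' :: "(nat \<Rightarrow> real) \<Rightarrow> 'a"
    using that kcube_bd_subset[of k] by (metis subsetD)
  from homotopic_with[of "kcube k" "constant_on_bd k", OF this]
  have "homotopic_with (constant_on_bd k) (kcube k) X f g"
    using H by (auto intro!: exI[of _ H])
  with f show ?thesis by (rule that)
qed

lemma homotopic_with_constant_on_bd:
  "homotopic_with (\<lambda>h. \<forall>u\<in>kcube_bd k. h u = x) (kcube k) X f g \<Longrightarrow>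
   homotopic_with (constant_on_bd k) (kcube k) X f g"
  by (erule homotopic_with_mono) blast

lemma homotopic_with_constant_on_bd_compose:
  assumes "homotopic_with (constant_on_bd k) (kcube k) X f g" "continuous_map X Y \<phi>"
  shows "homotopic_with (constant_on_bd k) (kcube k) Y (\<phi> \<circ> f) (\<phi> \<circ> g)"
proof -
  have "constant_on_bd k (\<phi> \<circ> j)" if "constant_on_bd k j" for j :: "(nat \<Rightarrow> real) \<Rightarrow> 'a"
    using that by (metis comp_apply)
  then show ?thesis
    by (rule homotopic_with_compose_continuous_map_left[OF assms])
qed

text \<open>Shrinking linearly to the origin moves all boundary points together, as they have the
  same image.\<close>

lemma homotopic_constant_euclidean:
  fixes f :: "(nat \<Rightarrow> real) \<Rightarrow> 'x::real_normed_vector"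
  assumes "continuous_map (kcube k) euclidean f" "constant_on_bd k f"
  shows "homotopic_with (constant_on_bd k) (kcube k) euclidean f (\<lambda>_. 0)"
  unfolding homotopic_with_def
proof (intro exI[of _ "\<lambda>(t, u). (1 - t) *\<^sub>R f u"] conjI allI ballI)
  let ?X = "prod_topology (top_of_set {0..1::real}) (kcube k)"
  have "continuous_map ?X euclidean (\<lambda>p. f (snd p))"
    using continuous_map_compose[OF continuous_map_snd assms(1)] by (simp add: o_def)
  moreover have "continuous_map ?X euclideanreal (\<lambda>p. 1 - fst p)"
    by (intro continuous_intros continuous_map_unit_fst)
  ultimately have "continuous_map ?X (prod_topology euclidean euclidean) (\<lambda>p. (1 - fst p, f (snd p)))"
    by (intro continuous_map_pairedI)
  moreover have "continuous_map (prod_topology euclidean euclidean) euclidean (\<lambda>(a::real, v::'x). a *\<^sub>R v)"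
    unfolding case_prod_unfold by (simp add: continuous_intros)
  ultimately have "continuous_map ?X euclidean ((\<lambda>(a, v). a *\<^sub>R v) \<circ> (\<lambda>p. (1 - fst p, f (snd p))))"
    by (rule continuous_map_compose)
  then show "continuous_map ?X euclidean (\<lambda>(t, u). (1 - t) *\<^sub>R f u)"
    by (simp add: o_def case_prod_unfold)
qed (use assms(2) in auto)

section \<open>Signatures\<close>

lemma proj_lim_simps:
  "carrier (proj_lim N G f) = {x \<in> (\<Pi>\<^sub>E r\<in>{N..}. carrier (G r)). \<forall>r\<ge>N. f r (x (Suc r)) = x r}"
  "\<one>\<^bsub>proj_lim N G f\<^esub> = (\<lambda>r\<in>{N..}. \<one>\<^bsub>G r\<^esub>)"
  by (simp_all add: proj_lim_def)

lemma mem_proj_limI: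
  assumes "\<And>r. N \<le> r \<Longrightarrow> x r \<in> carrier (G r)" "\<And>r. N \<le> r \<Longrightarrow> f r (x (Suc r)) = x r"
  shows "(\<lambda>r\<in>{N..}. x r) \<in> carrier (proj_lim N G f)"
  using assms by (simp add: proj_lim_simps)

lemma proj_limD:
  assumes "x \<in> carrier (proj_lim N G f)" "N \<le> r"
  shows "x r \<in> carrier (G r)" "f r (x (Suc r)) = x r"
  using assms by (auto simp: proj_lim_simps PiE_iff)

lemma continuous_map_good_space_inclusion:
  assumes "good \<AA> a s \<subseteq> good \<AA> b r"
  shows "continuous_map (good_space \<AA> a s) (good_space \<AA> b r) (\<lambda>p. p)"
  using cube_union_mono[OF assms] by (simp add: continuous_map_in_subtopology image_subset_iff subset_iff)

lemma good_space_eq_euclidean: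
  assumes "subshift \<AA>" "a \<in> \<AA>"
  shows "good_space \<AA> a r = euclidean"
  by (simp add: good_eq_UNIV[OF assms] cube_union_UNIV)

section \<open>Homology signatures\<close>

text \<open>Compatibility with the bonding maps is the naturality of sections under restriction of
  patterns.\<close>

lemma homology_signature_carrier:
  assumes "x \<in> carrier (homology_good \<AA> a k)"
  shows "homology_signature R \<AA> a k x \<in> carrier (homology_subshift R \<AA> k)"
  unfolding homology_signature_def homology_subshift_def
proof (rule mem_proj_limI)
  fix r assume "R \<le> r"
  have x: "x r \<in> carrier (homology_coeff k (good_space \<AA> a r))"
      "homology_induced k (good_space \<AA> a r) (\<lambda>p. p) (x (Suc r)) = x r" for r
    using proj_limD[OF assms[unfolded homology_good_def], of r] by simp_all
  note sec = continuous_map_tile_section and zeta = continuous_map_tile_zeta[of r "Suc r" \<AA>]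
    and incl = continuous_map_good_space_inclusion[OF good_antimono[of r "Suc r" \<AA> a]]
  show "homology_induced k (tile_complex \<AA> r) (tile_section \<AA> a r) (x r) \<in> carrier (homology_coeff k (tile_complex \<AA> r))"
    by (rule homology_induced_carrier[OF sec x(1)])
  have "homology_induced k (tile_complex \<AA> r) (tile_zeta \<AA> r)
      (homology_induced k (tile_complex \<AA> (Suc r)) (tile_section \<AA> a (Suc r)) (x (Suc r))) =
    homology_induced k (tile_complex \<AA> r) (tile_zeta \<AA> r \<circ> tile_section \<AA> a (Suc r)) (x (Suc r))"
    using homology_induced_compose[OF sec zeta x(1)] by simp
  also have "\<dots> = homology_induced k (tile_complex \<AA> r) (tile_section \<AA> a r \<circ> (\<lambda>p. p)) (x (Suc r))"
  proof (rule homology_induced_cong[OF _ _ _ x(1)])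
    show "continuous_map (good_space \<AA> a (Suc r)) (tile_complex \<AA> r) (tile_zeta \<AA> r \<circ> tile_section \<AA> a (Suc r))"
      using continuous_map_compose[OF sec zeta] by simp
    show "continuous_map (good_space \<AA> a (Suc r)) (tile_complex \<AA> r) (tile_section \<AA> a r \<circ> (\<lambda>p. p))"
      using continuous_map_compose[OF incl sec] by simp
  qed (simp add: tile_zeta_section)
  also have "\<dots> = homology_induced k (tile_complex \<AA> r) (tile_section \<AA> a r) (x r)"
    using homology_induced_compose[OF incl sec x(1)] x(2) by simp
  finally show "homology_induced k (tile_complex \<AA> r) (tile_zeta \<AA> r)
      (homology_induced k (tile_complex \<AA> (Suc r)) (tile_section \<AA> a (Suc r)) (x (Suc r))) =
    homology_induced k (tile_complex \<AA> r) (tile_section \<AA> a r) (x r)" .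
qed

text \<open>Meant for \<open>b = \<Phi> a\<close>: pushes a limit class of \<open>a\<close> forward
  along the inclusions of level r + q of \<open>a\<close> into level r of \<open>b\<close>.\<close>

definition homology_restrict ::
  "nat \<Rightarrow> ('d::finite, 'a) config set \<Rightarrow> ('d, 'a) config \<Rightarrow> nat \<Rightarrow>
   (nat \<Rightarrow> (real ^ 'd, 'g::ab_group_add) gchain set) \<Rightarrow> (nat \<Rightarrow> (real ^ 'd, 'g) gchain set)" where
  "homology_restrict q \<AA> b k x =
     (\<lambda>r\<in>{0..}. homology_induced k (good_space \<AA> b r) (\<lambda>p. p) (x (r + q)))"

text \<open>Injectivity is assumed on the carrier only, so the identity with which a signature is
  compared has to lie there. It is checked level by level.\<close>

lemma homology_one_carrier:
  fixes \<AA> :: "('d::finite, 'a) config set"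
  shows "(\<one>\<^bsub>homology_subshift R \<AA> k\<^esub> :: nat \<Rightarrow> (('d, 'a) tile_pt set, 'g::ab_group_add) gchain set)
     \<in> carrier (homology_subshift R \<AA> k)"
  unfolding homology_subshift_def proj_lim_simps(2)
proof (rule mem_proj_limI)
  fix r
  show "(\<one>\<^bsub>homology_coeff k (tile_complex \<AA> r)\<^esub> :: (('d, 'a) tile_pt set, 'g) gchain set)
      \<in> carrier (homology_coeff k (tile_complex \<AA> r))"
    unfolding carrier_homology_coeff one_homology_coeff
    by (rule imageI) (simp add: gchains_zero Modules.additive.zero[OF additive_gboundary])
  show "homology_induced k (tile_complex \<AA> r) (tile_zeta \<AA> r) \<one>\<^bsub>homology_coeff k (tile_complex \<AA> (Suc r))\<^esub> =
     (\<one>\<^bsub>homology_coeff k (tile_complex \<AA> r)\<^esub> :: (('d, 'a) tile_pt set, 'g) gchain set)"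
    by (rule homology_induced_one[OF continuous_map_tile_zeta]) simp
qed

text \<open>Every point is good for a configuration of \<open>\<AA>\<close>, so at each level the
  signature factors through the homology of the whole Euclidean space, which vanishes for
  \<open>1 \<le> k\<close>.\<close>

lemma homology_signature_trivial:
  fixes \<AA> :: "('d::finite, 'a) config set" and x :: "nat \<Rightarrow> (real ^ 'd, 'g::ab_group_add) gchain set"
  assumes "subshift \<AA>" "a \<in> \<AA>" "1 \<le> k" "x \<in> carrier (homology_good \<AA> a k)"
  shows "homology_signature R \<AA> a k x = \<one>\<^bsub>homology_subshift R \<AA> k\<^esub>"
  unfolding homology_signature_def homology_subshift_def proj_lim_simps
proof (rule restrict_ext)
  fix r
  have "x r \<in> carrier (homology_coeff k (good_space \<AA> a r))"
    using proj_limD(1)[OF assms(4)[unfolded homology_good_def], of r] by simp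
  then have "x r = \<one>\<^bsub>homology_coeff k (good_space \<AA> a r)\<^esub>"
    unfolding good_space_eq_euclidean[OF assms(1,2)]
    using assms(3) by (intro homology_coeff_euclidean_trivial) simp_all
  then show "homology_induced k (tile_complex \<AA> r) (tile_section \<AA> a r) (x r) = \<one>\<^bsub>homology_coeff k (tile_complex \<AA> r)\<^esub>"
    using homology_induced_one[OF continuous_map_tile_section] by simp
qed

section \<open>Cohomology signatures\<close>

lemma cohomology_zeta_carrier:
  assumes "x \<in> carrier (cohomology_tile \<AA> k r)"
  shows "cohomology_zeta \<AA> k r x \<in> carrier (cohomology_tile \<AA> k (Suc r))"
  by (rule cohomology_induced_carrier[OF continuous_map_tile_zeta assms]) simp

lemma cohomology_bond_carrier:
  assumes "x \<in> carrier (cohomology_good_level \<AA> a k r)"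
  shows "cohomology_good_bond \<AA> a k r x \<in> carrier (cohomology_good_level \<AA> a k (Suc r))"
  by (rule cohomology_induced_carrier[OF continuous_map_good_space_inclusion[OF good_antimono] assms]) simp

lemma cohomology_one_carrier: "\<one>\<^bsub>cohomology_coeff k X\<^esub> \<in> carrier (cohomology_coeff k X)"
  unfolding carrier_cohomology_coeff one_cohomology_coeff
  by (rule imageI) (auto simp: gcochains_def gcoboundary_def)

lemma bond_cohomology_one:
  "bond (cohomology_good_bond \<AA> a k) r n \<one>\<^bsub>cohomology_good_level \<AA> a k r\<^esub> =
     \<one>\<^bsub>cohomology_good_level \<AA> a k (r + n)\<^esub>"
proof (induction n)
  case (Suc n)
  have "continuous_map (good_space \<AA> a (Suc (r + n))) (good_space \<AA> a (r + n)) (\<lambda>p. p)"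
    by (intro continuous_map_good_space_inclusion good_antimono) simp
  from cohomology_induced_one[OF this] show ?case by (simp add: Suc)
qed simp

text \<open>Evaluates the signature on one representative, the sections being compatible with the
  bonding maps of both direct systems.\<close>

lemma cohomology_signature_class:
  fixes \<AA> :: "('d::finite, 'a) config set" and x :: "(('d, 'a) tile_pt set, 'g::ab_group_add) gcochain set"
  assumes "R \<le> r" "x \<in> carrier (cohomology_tile \<AA> k r)"
  shows "cohomology_signature \<AA> a k (ind_class R (cohomology_tile \<AA> k) (cohomology_zeta \<AA> k) r x) =
    ind_class 0 (cohomology_good_level \<AA> a k) (cohomology_good_bond \<AA> a k) r
      (cohomology_induced k (good_space \<AA> a r) (tile_section \<AA> a r) x)"
proof -
  have "cohomology_induced k (good_space \<AA> a (Suc r)) (tile_section \<AA> a (Suc r)) (cohomology_zeta \<AA> k r x) =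
      cohomology_good_bond \<AA> a k (r + 0) (cohomology_induced k (good_space \<AA> a r) (tile_section \<AA> a r) x)"
    if x: "x \<in> carrier (cohomology_tile \<AA> k r)" for r and x :: "(('d, 'a) tile_pt set, 'g) gcochain set"
  proof -
    note sec = continuous_map_tile_section and zeta = continuous_map_tile_zeta[of r "Suc r" \<AA>]
      and incl = continuous_map_good_space_inclusion[OF good_antimono[of r "Suc r" \<AA> a]]
    have "cohomology_induced k (good_space \<AA> a (Suc r)) (tile_section \<AA> a (Suc r)) (cohomology_zeta \<AA> k r x) =
        cohomology_induced k (good_space \<AA> a (Suc r)) (tile_zeta \<AA> r \<circ> tile_section \<AA> a (Suc r)) x"
      using cohomology_induced_compose[OF sec zeta x] by simp
    also have "\<dots> = cohomology_induced k (good_space \<AA> a (Suc r)) (tile_section \<AA> a r \<circ> (\<lambda>p. p)) x"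
      by (rule cohomology_induced_cong) (simp add: tile_zeta_section)
    also have "\<dots> = cohomology_good_bond \<AA> a k r (cohomology_induced k (good_space \<AA> a r) (tile_section \<AA> a r) x)"
      using cohomology_induced_compose[OF incl sec x] by simp
    finally show ?thesis by simp
  qed
  from UN_ind_class_map[where u = "\<lambda>r. cohomology_induced k (good_space \<AA> a r) (tile_section \<AA> a r)",
      where N' = 0 and G' = "cohomology_good_level \<AA> a k", OF cohomology_zeta_carrier this assms]
  show ?thesis by (simp only: cohomology_signature_def add_0_right)
qed

lemma cohomology_signature_trivial:
  fixes \<AA> :: "('d::finite, 'a) config set" and A :: "(nat \<times> (('d, 'a) tile_pt set, 'g::ab_group_add) gcochain set) set"
  assumes "subshift \<AA>" "a \<in> \<AA>" "1 \<le> k" "A \<in> carrier (cohomology_subshift R \<AA> k)"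
  shows "cohomology_signature \<AA> a k A = \<one>\<^bsub>cohomology_good \<AA> a k\<^esub>"
proof -
  obtain r x where r: "R \<le> r" "x \<in> carrier (cohomology_tile \<AA> k r)"
    and A: "A = ind_class R (cohomology_tile \<AA> k) (cohomology_zeta \<AA> k) r x"
    using assms(4) by (auto simp: cohomology_subshift_def ind_lim_def)
  let ?G = "cohomology_good_level \<AA> a k" and ?f = "cohomology_good_bond \<AA> a k"
  have "cohomology_induced k (good_space \<AA> a r) (tile_section \<AA> a r) x \<in> carrier (?G r)"
    by (rule cohomology_induced_carrier[OF continuous_map_tile_section r(2)])
  then have one: "cohomology_induced k (good_space \<AA> a r) (tile_section \<AA> a r) x = \<one>\<^bsub>?G r\<^esub>"
    unfolding good_space_eq_euclidean[OF assms(1,2)]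
    using assms(3) by (intro cohomology_coeff_euclidean_trivial) simp_all
  have "ind_class 0 ?G ?f r \<one>\<^bsub>?G r\<^esub> = ind_class 0 ?G ?f 0 (\<one>\<^bsub>?G 0\<^esub> :: (real ^ 'd, 'g) gcochain set)"
    by (intro ind_class_eqI[of _ 0 _ r]) (simp_all add: bond_cohomology_one)
  then show ?thesis
    by (simp add: A cohomology_signature_class[OF r] one cohomology_good_def ind_lim_def)
qed

section \<open>Homotopy signatures\<close>

text \<open>
  The homotopies are free, so that neither the base ray nor the paths identifying base points have to
  be followed under \<open>\<Phi>\<close>.
\<close>

definition carried_by_section ::
  "nat \<Rightarrow> ('d::finite, 'a) config set \<Rightarrow> nat \<Rightarrow> ('d, 'a) config \<Rightarrow> ('d, 'a) config \<Rightarrow>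
   (nat \<Rightarrow> ((nat \<Rightarrow> real) \<Rightarrow> ('d, 'a) tile_pt set) set) \<Rightarrow> bool" where
  "carried_by_section R \<AA> k a c \<alpha> \<longleftrightarrow>
     (\<forall>r\<ge>R. \<exists>f h. \<alpha> r = spheroid_class k (tile_complex \<AA> r) (tile_base \<AA> r c) h \<and>
        spheroid k (tile_complex \<AA> r) (tile_base \<AA> r c) h \<and>
        continuous_map (kcube k) (good_space \<AA> a r) f \<and> constant_on_bd k f \<and>
        homotopic_with (constant_on_bd k) (kcube k) (tile_complex \<AA> r) (tile_section \<AA> a r \<circ> f) h)"

lemma constant_on_bd_compose: "constant_on_bd k f \<Longrightarrow> constant_on_bd k (\<phi> \<circ> f)"
  by (metis comp_apply)

text \<open>The map \<open>\<phi>\<close> turns one section into the other over the good set, so the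
  same \<open>f\<close> serves after the push. This covers lowering the level (\<open>b = a\<close>)
  as well as applying the automaton (\<open>b = \<Phi> a\<close>).\<close>

lemma homotopic_section_push:
  assumes f: "continuous_map (kcube k) (good_space \<AA> a s) f" "constant_on_bd k f"
    and \<phi>: "continuous_map (tile_complex \<AA> s) (tile_complex \<AA> r) \<phi>"
    and sec: "\<And>p. p \<in> cube_union (good \<AA> a s) \<Longrightarrow> \<phi> (tile_section \<AA> a s p) = tile_section \<AA> b r p"
    and sub: "good \<AA> a s \<subseteq> good \<AA> b r"
    and hom: "homotopic_with (constant_on_bd k) (kcube k) (tile_complex \<AA> s) (tile_section \<AA> a s \<circ> f) h"
  shows "homotopic_with (constant_on_bd k) (kcube k) (tile_complex \<AA> r) (tile_section \<AA> b r \<circ> f) (\<phi> \<circ> h)"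
proof (rule homotopic_with_trans)
  show "homotopic_with (constant_on_bd k) (kcube k) (tile_complex \<AA> r) (\<phi> \<circ> (tile_section \<AA> a s \<circ> f)) (\<phi> \<circ> h)"
    by (rule homotopic_with_constant_on_bd_compose[OF hom \<phi>])
  show "homotopic_with (constant_on_bd k) (kcube k) (tile_complex \<AA> r)
      (tile_section \<AA> b r \<circ> f) (\<phi> \<circ> (tile_section \<AA> a s \<circ> f))"
  proof (rule homotopic_with_equal)
    have "continuous_map (kcube k) (good_space \<AA> b r) ((\<lambda>p. p) \<circ> f)"
      by (rule continuous_map_compose[OF f(1) continuous_map_good_space_inclusion[OF sub]])
    then show "continuous_map (kcube k) (tile_complex \<AA> r) (tile_section \<AA> b r \<circ> f)"
      using continuous_map_compose[OF _ continuous_map_tile_section] by (simp add: o_def)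
    fix u assume "u \<in> topspace (kcube k)"
    then have "f u \<in> cube_union (good \<AA> a s)"
      using continuous_map_funspace[OF f(1)] by auto
    then show "(tile_section \<AA> b r \<circ> f) u = (\<phi> \<circ> (tile_section \<AA> a s \<circ> f)) u"
      by (simp add: sec)
  qed (intro constant_on_bd_compose f(2))+
qed

text \<open>Each layer of the signature (section, transport along \<open>p s\<close>, restriction to
  level \<open>r\<close>) changes a map at most by a free homotopy once the section is lowered to
  level \<open>r\<close>. Membership in the limit group supplies a spheroid representing each
  component.\<close>

lemma pi_signature_carried_by_section:
  assumes x: "x \<in> carrier (pi_good \<AA> a k r0 Y \<omega> \<tau>)"
    and sig: "pi_signature R \<AA> a k r0 \<omega> \<tau> c p x \<in> carrier (pi_subshift R \<AA> k c)"
  shows "carried_by_section R \<AA> k a c (pi_signature R \<AA> a k r0 \<omega> \<tau> c p x)"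
  unfolding carried_by_section_def
proof (intro allI impI)
  fix r assume r: "R \<le> r"
  define s where "s = max r (Suc r0)"
  have s: "r \<le> s" "Suc r0 \<le> s" by (auto simp: s_def)
  let ?X = "tile_complex \<AA>" and ?\<alpha> = "pi_signature R \<AA> a k r0 \<omega> \<tau> c p x r"
  have "?\<alpha> \<in> carrier (homotopy_group k (?X r) (tile_base \<AA> r c))"
    using proj_limD(1)[OF sig[unfolded pi_subshift_def] r] .
  then obtain h where h: "spheroid k (?X r) (tile_base \<AA> r c) h"
    and \<alpha>: "?\<alpha> = spheroid_class k (?X r) (tile_base \<AA> r c) h"
    by (auto simp: carrier_homotopy_group)
  \<comment> \<open>The component is a class by the hypothesis and a nested union by definition. Its
    representative \<open>h\<close>, viewed as an element of the union, yields the chain of maps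
    from \<open>f\<close> to \<open>h\<close>.\<close>
  have "h \<in> ?\<alpha>" unfolding \<alpha> by (rule spheroid_class_self[OF h])
  then have "h \<in> homotopy_induced k (?X r) (tile_base \<AA> r c) (tile_zeta \<AA> r)
      (homotopy_transport k (?X s) (p s)
        (homotopy_induced k (?X s) (tile_section \<AA> a s (\<omega> (\<tau> s))) (tile_section \<AA> a s) (x s)))"
    using r by (simp add: pi_signature_def Let_def s_def)
  then obtain g where g: "g \<in> homotopy_transport k (?X s) (p s)
        (homotopy_induced k (?X s) (tile_section \<AA> a s (\<omega> (\<tau> s))) (tile_section \<AA> a s) (x s))"
    and h_g: "h \<in> spheroid_class k (?X r) (tile_base \<AA> r c) (tile_zeta \<AA> r \<circ> g)"
    unfolding homotopy_induced_def by blast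
  obtain g' where g': "g' \<in> homotopy_induced k (?X s) (tile_section \<AA> a s (\<omega> (\<tau> s))) (tile_section \<AA> a s) (x s)"
    and g'_g: "homotopic_with (constant_on_bd k) (kcube k) (?X s) g' g"
    using g by (rule homotopy_transport_homotopic)
  obtain f where f: "f \<in> x s"
    and g'_f: "g' \<in> spheroid_class k (?X s) (tile_section \<AA> a s (\<omega> (\<tau> s))) (tile_section \<AA> a s \<circ> f)"
    using g' unfolding homotopy_induced_def by blast
  have "x s \<in> carrier (homotopy_group k (top_of_set (cube_union (Y \<inter> good \<AA> a s))) (\<omega> (\<tau> s)))"
    using proj_limD(1)[OF x[unfolded pi_good_def] s(2)] .
  then have "spheroid k (top_of_set (cube_union (Y \<inter> good \<AA> a s))) (\<omega> (\<tau> s)) f"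
    using f spheroid_class_spheroid(2) by (force simp: carrier_homotopy_group)
  then have cf: "continuous_map (kcube k) (top_of_set (cube_union (Y \<inter> good \<AA> a s))) f" and bd: "constant_on_bd k f"
    unfolding spheroid_def by blast+
  have "cube_union (Y \<inter> good \<AA> a s) \<subseteq> cube_union (good \<AA> a s)"
    by (rule cube_union_mono) simp
  then have cf_s: "continuous_map (kcube k) (good_space \<AA> a s) f"
    using cf by (auto simp: continuous_map_in_subtopology)
  have "cube_union (good \<AA> a s) \<subseteq> cube_union (good \<AA> a r)"
    by (rule cube_union_mono[OF good_antimono[OF s(1)]])
  then have cf_r: "continuous_map (kcube k) (good_space \<AA> a r) f"
    using cf_s by (auto simp: continuous_map_in_subtopology)
  have "homotopic_with (constant_on_bd k) (kcube k) (?X s) (tile_section \<AA> a s \<circ> f) g'"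
    using g'_f unfolding spheroid_class_def mem_Collect_eq by (rule homotopic_with_constant_on_bd)
  then have fg: "homotopic_with (constant_on_bd k) (kcube k) (?X s) (tile_section \<AA> a s \<circ> f) g"
    using g'_g by (rule homotopic_with_trans)
  have "homotopic_with (constant_on_bd k) (kcube k) (?X r) (tile_section \<AA> a r \<circ> f) (tile_zeta \<AA> r \<circ> g)"
    by (rule homotopic_section_push[OF cf_s bd continuous_map_tile_zeta[OF s(1)] tile_zeta_section[OF s(1)]
          good_antimono[OF s(1)] fg])
  moreover have "homotopic_with (constant_on_bd k) (kcube k) (?X r) (tile_zeta \<AA> r \<circ> g) h"
    using h_g unfolding spheroid_class_def mem_Collect_eq by (rule homotopic_with_constant_on_bd)
  ultimately have "homotopic_with (constant_on_bd k) (kcube k) (?X r) (tile_section \<AA> a r \<circ> f) h"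
    by (rule homotopic_with_trans)
  with h \<alpha> cf_r bd show "\<exists>f h. ?\<alpha> = spheroid_class k (?X r) (tile_base \<AA> r c) h \<and>
      spheroid k (?X r) (tile_base \<AA> r c) h \<and>
      continuous_map (kcube k) (good_space \<AA> a r) f \<and> constant_on_bd k f \<and>
      homotopic_with (constant_on_bd k) (kcube k) (?X r) (tile_section \<AA> a r \<circ> f) h"
    by blast
qed

text \<open>The section is defined on all of Euclidean space, where \<open>f\<close> contracts. This
  gives a free nullhomotopy of \<open>h\<close>, which is then made relative to the
  boundary.\<close>

lemma carried_by_section_trivial:
  assumes "subshift \<AA>" "a \<in> \<AA>" "1 \<le> k" "\<alpha> \<in> carrier (pi_subshift R \<AA> k c)"
    and carried: "carried_by_section R \<AA> k a c \<alpha>"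
  shows "\<alpha> = \<one>\<^bsub>pi_subshift R \<AA> k c\<^esub>"
proof -
  have "\<alpha> r = \<one>\<^bsub>homotopy_group k (tile_complex \<AA> r) (tile_base \<AA> r c)\<^esub>" if "R \<le> r" for r
  proof -
    let ?X = "tile_complex \<AA> r" and ?x = "tile_base \<AA> r c"
    obtain f h where \<alpha>: "\<alpha> r = spheroid_class k ?X ?x h" and h: "spheroid k ?X ?x h"
      and f: "continuous_map (kcube k) (good_space \<AA> a r) f" "constant_on_bd k f"
      and fh: "homotopic_with (constant_on_bd k) (kcube k) ?X (tile_section \<AA> a r \<circ> f) h"
      using carried \<open>R \<le> r\<close> unfolding carried_by_section_def by blast
    have sec: "continuous_map euclidean ?X (tile_section \<AA> a r)"
      using continuous_map_tile_section[of \<AA> a r] by (simp add: good_space_eq_euclidean[OF assms(1,2)])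
    have "homotopic_with (constant_on_bd k) (kcube k) euclidean f (\<lambda>_. 0)"
      using f by (intro homotopic_constant_euclidean) (simp_all add: good_space_eq_euclidean[OF assms(1,2)])
    from homotopic_with_constant_on_bd_compose[OF this sec]
    have "homotopic_with (constant_on_bd k) (kcube k) ?X h (\<lambda>_. tile_section \<AA> a r 0)"
      using homotopic_with_trans[OF homotopic_with_symD[OF fh]] by (simp add: o_def)
    then have "homotopic_with (\<lambda>h. \<forall>u\<in>kcube_bd k. h u = ?x) (kcube k) ?X h (\<lambda>_. ?x)"
      using h by (intro nullhomotopic_rel_bd[OF assms(3)]) (auto simp: spheroid_def)
    then have "(\<lambda>_. ?x) \<in> spheroid_class k ?X ?x h"
      by (simp add: spheroid_class_def)
    then show ?thesis
      by (simp add: \<alpha> one_homotopy_group spheroid_class_eq)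
  qed
  \<comment> \<open>Elements of the limit are \<open>undefined\<close> below level \<open>R\<close>,
    so agreement from \<open>R\<close> on is equality.\<close>
  moreover have "\<alpha> \<in> extensional {R..}"
    using assms(4) by (auto simp: pi_subshift_def proj_lim_simps PiE_iff)
  ultimately show ?thesis
    unfolding pi_subshift_def proj_lim_simps by (auto intro!: extensionalityI[of _ "{R..}"])
qed

text \<open>As \<open>c\<close> is in \<open>\<AA>\<close>, its base points lie in the complexes, so
  constant maps to them are spheroids.\<close>

lemma pi_one_carrier:
  assumes "c \<in> \<AA>"
  shows "\<one>\<^bsub>pi_subshift R \<AA> k c\<^esub> \<in> carrier (pi_subshift R \<AA> k c)"
  unfolding pi_subshift_def proj_lim_simps(2)
proof (rule mem_proj_limI)
  fix r
  show "\<one>\<^bsub>homotopy_group k (tile_complex \<AA> r) (tile_base \<AA> r c)\<^esub> \<in>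
      carrier (homotopy_group k (tile_complex \<AA> r) (tile_base \<AA> r c))"
    unfolding carrier_homotopy_group one_homotopy_group
    using tile_base_mem_topspace[OF assms] by (intro imageI) (simp add: spheroid_def)
  show "homotopy_induced k (tile_complex \<AA> r) (tile_base \<AA> r c) (tile_zeta \<AA> r)
      \<one>\<^bsub>homotopy_group k (tile_complex \<AA> (Suc r)) (tile_base \<AA> (Suc r) c)\<^esub> =
    \<one>\<^bsub>homotopy_group k (tile_complex \<AA> r) (tile_base \<AA> r c)\<^esub>"
    by (rule homotopy_induced_one[OF continuous_map_tile_zeta tile_zeta_base tile_base_mem_topspace[OF assms]]) auto
qed

context
  fixes \<AA> :: "('d::finite, 'a) config set" and \<Phi> :: "('d, 'a) config \<Rightarrow> ('d, 'a) config" and q :: nat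
  assumes radius: "has_radius \<Phi> q" and inv: "\<Phi> ` \<AA> \<subseteq> \<AA>"
begin

section \<open>One step of the automaton\<close>

lemma homology_restrict_carrier:
  fixes x :: "nat \<Rightarrow> (real ^ 'd, 'g::ab_group_add) gchain set"
  assumes "x \<in> carrier (homology_good \<AA> a k)"
  shows "homology_restrict q \<AA> (\<Phi> a) k x \<in> carrier (homology_good \<AA> (\<Phi> a) k)"
  unfolding homology_restrict_def homology_good_def
proof (rule mem_proj_limI)
  fix r
  have x: "x r \<in> carrier (homology_coeff k (good_space \<AA> a r))"
      "homology_induced k (good_space \<AA> a r) (\<lambda>p. p) (x (Suc r)) = x r" for r
    using proj_limD[OF assms[unfolded homology_good_def], of r] by simp_all
  note incl = continuous_map_good_space_inclusion[OF good_ca[OF radius inv, of a]]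
    and incl_Suc = continuous_map_good_space_inclusion[OF good_antimono[of r "Suc r" \<AA> "\<Phi> a"]]
    and incl_Suc' = continuous_map_good_space_inclusion[OF good_antimono[of "r + q" "Suc (r + q)" \<AA> a]]
  show "homology_induced k (good_space \<AA> (\<Phi> a) r) (\<lambda>p. p) (x (r + q)) \<in>
      carrier (homology_coeff k (good_space \<AA> (\<Phi> a) r))"
    by (rule homology_induced_carrier[OF incl x(1)])
  have "homology_induced k (good_space \<AA> (\<Phi> a) r) (\<lambda>p. p)
      (homology_induced k (good_space \<AA> (\<Phi> a) (Suc r)) (\<lambda>p. p) (x (Suc r + q))) =
    homology_induced k (good_space \<AA> (\<Phi> a) r) ((\<lambda>p. p) \<circ> (\<lambda>p. p)) (x (Suc r + q))"
    using homology_induced_compose[OF incl[of "Suc r"] incl_Suc x(1)] by simp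
  also have "\<dots> = homology_induced k (good_space \<AA> (\<Phi> a) r) (\<lambda>p. p) (x (r + q))"
    using homology_induced_compose[OF incl_Suc' incl[of r] x(1)] x(2)[of "r + q"] by simp
  finally show "homology_induced k (good_space \<AA> (\<Phi> a) r) (\<lambda>p. p)
      (homology_induced k (good_space \<AA> (\<Phi> a) (Suc r)) (\<lambda>p. p) (x (Suc r + q))) =
    homology_induced k (good_space \<AA> (\<Phi> a) r) (\<lambda>p. p) (x (r + q))" .
qed

text \<open>Levelwise, \<open>\<Phi>\<close> after the section of \<open>a\<close> is the section of
  \<open>\<Phi> a\<close> after an inclusion of good sets.\<close>

lemma homology_ca_signature:
  fixes x :: "nat \<Rightarrow> (real ^ 'd, 'g::ab_group_add) gchain set"
  assumes "x \<in> carrier (homology_good \<AA> a k)"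
  shows "homology_ca q \<Phi> R \<AA> k (homology_signature R \<AA> a k x) =
    homology_signature R \<AA> (\<Phi> a) k (homology_restrict q \<AA> (\<Phi> a) k x)"
  unfolding homology_ca_def homology_signature_def homology_restrict_def
proof (rule restrict_ext)
  fix r assume r: "r \<in> {R..}"
  have x: "x r \<in> carrier (homology_coeff k (good_space \<AA> a r))" for r
    using proj_limD[OF assms[unfolded homology_good_def], of r] by simp_all
  note sec = continuous_map_tile_section and ca = continuous_map_tile_ca[OF radius inv]
    and incl = continuous_map_good_space_inclusion[OF good_ca[OF radius inv, of a]]
  have "homology_induced k (tile_complex \<AA> r) (tile_ca \<Phi> \<AA> r)
      (homology_induced k (tile_complex \<AA> (r + q)) (tile_section \<AA> a (r + q)) (x (r + q))) =
    homology_induced k (tile_complex \<AA> r) (tile_ca \<Phi> \<AA> r \<circ> tile_section \<AA> a (r + q)) (x (r + q))"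
    by (rule homology_induced_compose[OF sec ca x])
  also have "\<dots> = homology_induced k (tile_complex \<AA> r) (tile_section \<AA> (\<Phi> a) r \<circ> (\<lambda>p. p)) (x (r + q))"
    by (rule homology_induced_cong[OF continuous_map_compose[OF sec ca] continuous_map_compose[OF incl sec] _ x])
      (simp add: tile_ca_section[OF radius inv])
  also have "\<dots> = homology_induced k (tile_complex \<AA> r) (tile_section \<AA> (\<Phi> a) r)
      (homology_induced k (good_space \<AA> (\<Phi> a) r) (\<lambda>p. p) (x (r + q)))"
    by (rule homology_induced_compose[OF incl sec x, symmetric])
  finally show "homology_induced k (tile_complex \<AA> r) (tile_ca \<Phi> \<AA> r)
      ((\<lambda>r\<in>{R..}. homology_induced k (tile_complex \<AA> r) (tile_section \<AA> a r) (x r)) (r + q)) =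
    homology_induced k (tile_complex \<AA> r) (tile_section \<AA> (\<Phi> a) r)
      ((\<lambda>r\<in>{0..}. homology_induced k (good_space \<AA> (\<Phi> a) r) (\<lambda>p. p) (x (r + q))) r)"
    using r by simp
qed

lemma homology_ca_one:
  "homology_ca q \<Phi> R \<AA> k \<one>\<^bsub>homology_subshift R \<AA> k\<^esub> =
    (\<one>\<^bsub>homology_subshift R \<AA> k\<^esub> :: nat \<Rightarrow> (('d, 'a) tile_pt set, 'g::ab_group_add) gchain set)"
  unfolding homology_ca_def homology_subshift_def proj_lim_simps
  by (rule restrict_ext) (simp add: homology_induced_one[OF continuous_map_tile_ca[OF radius inv]])

lemma homology_signature_step:
  assumes inj: "inj_on (homology_ca q \<Phi> R \<AA> k)
      (carrier (homology_subshift R \<AA> k :: (nat \<Rightarrow> (('d, 'a) tile_pt set, 'g::ab_group_add) gchain set) monoid))"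
    and "\<exists>x\<in>carrier (homology_good \<AA> a k :: (nat \<Rightarrow> (real ^ 'd, 'g) gchain set) monoid).
      homology_signature R \<AA> a k x \<noteq> \<one>\<^bsub>homology_subshift R \<AA> k\<^esub>"
  shows "\<exists>x\<in>carrier (homology_good \<AA> (\<Phi> a) k :: (nat \<Rightarrow> (real ^ 'd, 'g) gchain set) monoid).
      homology_signature R \<AA> (\<Phi> a) k x \<noteq> \<one>\<^bsub>homology_subshift R \<AA> k\<^esub>"
proof -
  obtain x :: "nat \<Rightarrow> (real ^ 'd, 'g) gchain set" where x: "x \<in> carrier (homology_good \<AA> a k)"
    "homology_signature R \<AA> a k x \<noteq> \<one>\<^bsub>homology_subshift R \<AA> k\<^esub>"
    using assms(2) by blast
  have "homology_ca q \<Phi> R \<AA> k (homology_signature R \<AA> a k x) \<noteq> homology_ca q \<Phi> R \<AA> k \<one>\<^bsub>homology_subshift R \<AA> k\<^esub>"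
    using inj_onD[OF inj _ homology_signature_carrier[OF x(1)] homology_one_carrier] x(2) by blast
  then have "homology_signature R \<AA> (\<Phi> a) k (homology_restrict q \<AA> (\<Phi> a) k x) \<noteq> \<one>\<^bsub>homology_subshift R \<AA> k\<^esub>"
    unfolding homology_ca_signature[OF x(1)] homology_ca_one .
  then show ?thesis using homology_restrict_carrier[OF x(1)] by blast
qed

lemma cohomology_ca_class:
  fixes x :: "(('d, 'a) tile_pt set, 'g::ab_group_add) gcochain set"
  assumes "R \<le> r" "x \<in> carrier (cohomology_tile \<AA> k r)"
  shows "cohomology_ca q \<Phi> R \<AA> k (ind_class R (cohomology_tile \<AA> k) (cohomology_zeta \<AA> k) r x) =
    ind_class R (cohomology_tile \<AA> k) (cohomology_zeta \<AA> k) (r + q)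
      (cohomology_induced k (tile_complex \<AA> (r + q)) (tile_ca \<Phi> \<AA> r) x)"
proof -
  have "cohomology_induced k (tile_complex \<AA> (Suc r + q)) (tile_ca \<Phi> \<AA> (Suc r)) (cohomology_zeta \<AA> k r x) =
      cohomology_zeta \<AA> k (r + q) (cohomology_induced k (tile_complex \<AA> (r + q)) (tile_ca \<Phi> \<AA> r) x)"
    if x: "x \<in> carrier (cohomology_tile \<AA> k r)" for r and x :: "(('d, 'a) tile_pt set, 'g) gcochain set"
  proof -
    note ca = continuous_map_tile_ca[OF radius inv] and zeta = continuous_map_tile_zeta[of r "Suc r" \<AA>]
      and zeta' = continuous_map_tile_zeta[of "r + q" "Suc r + q" \<AA>]
    have "cohomology_induced k (tile_complex \<AA> (Suc r + q)) (tile_ca \<Phi> \<AA> (Suc r)) (cohomology_zeta \<AA> k r x) =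
        cohomology_induced k (tile_complex \<AA> (Suc r + q)) (tile_zeta \<AA> r \<circ> tile_ca \<Phi> \<AA> (Suc r)) x"
      using cohomology_induced_compose[OF ca zeta x] by simp
    also have "\<dots> = cohomology_induced k (tile_complex \<AA> (Suc r + q)) (tile_ca \<Phi> \<AA> r \<circ> tile_zeta \<AA> (r + q)) x"
      by (rule cohomology_induced_cong) (use tile_zeta_tile_ca[OF radius inv] in simp)
    also have "\<dots> = cohomology_induced k (tile_complex \<AA> (Suc r + q)) (tile_zeta \<AA> (r + q))
        (cohomology_induced k (tile_complex \<AA> (r + q)) (tile_ca \<Phi> \<AA> r) x)"
      using cohomology_induced_compose[OF zeta' ca x] by simp
    finally show ?thesis by simp
  qed
  from UN_ind_class_map[where u = "\<lambda>r. cohomology_induced k (tile_complex \<AA> (r + q)) (tile_ca \<Phi> \<AA> r)",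
      where N' = R and G' = "cohomology_tile \<AA> k", OF cohomology_zeta_carrier this assms]
  show ?thesis by (simp only: cohomology_ca_def)
qed

text \<open>The arrows are reversed: a class with nontrivial signature for \<open>a\<close> is the
  image of some \<open>A'\<close>, and its signature is the pullback of the signature of
  \<open>A'\<close> for \<open>\<Phi> a\<close>. If the latter were trivial, so would be the
  former.\<close>

lemma cohomology_signature_step:
  assumes surj: "cohomology_ca q \<Phi> R \<AA> k ` carrier (cohomology_subshift R \<AA> k) =
      carrier (cohomology_subshift R \<AA> k :: (nat \<times> (('d, 'a) tile_pt set, 'g::ab_group_add) gcochain set) set monoid)"
    and "\<exists>A\<in>carrier (cohomology_subshift R \<AA> k :: (nat \<times> (('d, 'a) tile_pt set, 'g) gcochain set) set monoid).
      cohomology_signature \<AA> a k A \<noteq> \<one>\<^bsub>cohomology_good \<AA> a k\<^esub>"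
  shows "\<exists>A\<in>carrier (cohomology_subshift R \<AA> k :: (nat \<times> (('d, 'a) tile_pt set, 'g) gcochain set) set monoid).
      cohomology_signature \<AA> (\<Phi> a) k A \<noteq> \<one>\<^bsub>cohomology_good \<AA> (\<Phi> a) k\<^esub>"
proof -
  obtain A :: "(nat \<times> (('d, 'a) tile_pt set, 'g) gcochain set) set"
    where A: "A \<in> carrier (cohomology_subshift R \<AA> k)"
      and nontriv: "cohomology_signature \<AA> a k A \<noteq> \<one>\<^bsub>cohomology_good \<AA> a k\<^esub>"
    using assms(2) by blast
  have "A \<in> cohomology_ca q \<Phi> R \<AA> k ` carrier (cohomology_subshift R \<AA> k)"
    using A surj by simp
  then obtain A' where A': "A' \<in> carrier (cohomology_subshift R \<AA> k)" "A = cohomology_ca q \<Phi> R \<AA> k A'"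
    by blast
  then obtain r x where r: "R \<le> r" "x \<in> carrier (cohomology_tile \<AA> k r)"
    and A'_eq: "A' = ind_class R (cohomology_tile \<AA> k) (cohomology_zeta \<AA> k) r x"
    by (auto simp: cohomology_subshift_def ind_lim_def)
  note sec = continuous_map_tile_section and ca = continuous_map_tile_ca[OF radius inv]
    and incl = continuous_map_good_space_inclusion[OF good_ca[OF radius inv, of a]]
  let ?G = "cohomology_good_level \<AA> a k" and ?f = "cohomology_good_bond \<AA> a k"
  let ?G' = "cohomology_good_level \<AA> (\<Phi> a) k" and ?f' = "cohomology_good_bond \<AA> (\<Phi> a) k"
  \<comment> \<open>Pullback along the inclusion of level s + q of \<open>a\<close> into level s of
    \<open>\<Phi> a\<close>.\<close>
  define v where "v s = (cohomology_induced k (good_space \<AA> a (s + q)) (\<lambda>p. p) ::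
      (real ^ 'd, 'g) gcochain set \<Rightarrow> _)" for s
  define y where "y = cohomology_induced k (good_space \<AA> (\<Phi> a) r) (tile_section \<AA> (\<Phi> a) r) x"
  have y: "y \<in> carrier (?G' r)"
    unfolding y_def by (rule cohomology_induced_carrier[OF sec r(2)])
  have rq: "R \<le> r + q" "cohomology_induced k (tile_complex \<AA> (r + q)) (tile_ca \<Phi> \<AA> r) x \<in> carrier (cohomology_tile \<AA> k (r + q))"
    using r(1) cohomology_induced_carrier[OF ca r(2)] by auto
  have "cohomology_signature \<AA> a k A = ind_class 0 ?G ?f (r + q)
      (cohomology_induced k (good_space \<AA> a (r + q)) (tile_section \<AA> a (r + q))
        (cohomology_induced k (tile_complex \<AA> (r + q)) (tile_ca \<Phi> \<AA> r) x))"
    unfolding A'(2) A'_eq cohomology_ca_class[OF r] by (rule cohomology_signature_class[OF rq])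
  also have "cohomology_induced k (good_space \<AA> a (r + q)) (tile_section \<AA> a (r + q))
        (cohomology_induced k (tile_complex \<AA> (r + q)) (tile_ca \<Phi> \<AA> r) x) =
      cohomology_induced k (good_space \<AA> a (r + q)) (tile_ca \<Phi> \<AA> r \<circ> tile_section \<AA> a (r + q)) x"
    by (rule cohomology_induced_compose[OF sec ca r(2)])
  also have "\<dots> = cohomology_induced k (good_space \<AA> a (r + q)) (tile_section \<AA> (\<Phi> a) r \<circ> (\<lambda>p. p)) x"
    by (rule cohomology_induced_cong) (simp add: tile_ca_section[OF radius inv])
  also have "\<dots> = v r y"
    unfolding v_def y_def by (rule cohomology_induced_compose[OF incl sec r(2), symmetric])
  finally have sig_a: "cohomology_signature \<AA> a k A = ind_class 0 ?G ?f (r + q) (v r y)" .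
  have sig_b: "cohomology_signature \<AA> (\<Phi> a) k A' = ind_class 0 ?G' ?f' r y"
    unfolding A'_eq y_def by (rule cohomology_signature_class[OF r])
  have "cohomology_signature \<AA> (\<Phi> a) k A' \<noteq> \<one>\<^bsub>cohomology_good \<AA> (\<Phi> a) k\<^esub>"
  proof
    assume "cohomology_signature \<AA> (\<Phi> a) k A' = \<one>\<^bsub>cohomology_good \<AA> (\<Phi> a) k\<^esub>"
    then have "ind_class 0 ?G' ?f' r y = ind_class 0 ?G' ?f' 0 \<one>\<^bsub>?G' 0\<^esub>"
      by (simp add: sig_b cohomology_good_def ind_lim_def)
    \<comment> \<open>Equality of classes is turned into equality of elements: the identity at level
      0 belongs to its own class, hence to that of \<open>y\<close>, so both become equal at some
      later level.\<close>
    moreover have "(0, \<one>\<^bsub>?G' 0\<^esub>) \<in> ind_class 0 ?G' ?f' 0 \<one>\<^bsub>?G' 0\<^esub>"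
      by (rule ind_class_self) (auto simp: cohomology_one_carrier)
    ultimately have "(0, \<one>\<^bsub>?G' 0\<^esub>) \<in> ind_class 0 ?G' ?f' r y" by simp
    then obtain m n where mn: "r + m = 0 + n" "bond ?f' r m y = bond ?f' 0 n \<one>\<^bsub>?G' 0\<^esub>"
      by (auto simp: ind_class_def)
    have nat: "v (Suc s) (?f' s z) = ?f (s + q) (v s z)" if z: "z \<in> carrier (?G' s)" for s z
    proof -
      note i1 = continuous_map_good_space_inclusion[OF good_antimono[of s "Suc s" \<AA> "\<Phi> a"]]
        and i2 = continuous_map_good_space_inclusion[OF good_antimono[of "s + q" "Suc (s + q)" \<AA> a]]
      have "v (Suc s) (?f' s z) = cohomology_induced k (good_space \<AA> a (Suc s + q)) ((\<lambda>p. p) \<circ> (\<lambda>p. p)) z"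
        unfolding v_def using cohomology_induced_compose[OF incl[of "Suc s"] i1 z] by simp
      also have "\<dots> = ?f (s + q) (v s z)"
        unfolding v_def using cohomology_induced_compose[OF i2 incl[of s] z] by simp
      finally show ?thesis .
    qed
    \<comment> \<open>The vanishing of \<open>y\<close> at level r + m is carried over to
      \<open>a\<close>, since \<open>v\<close> commutes with the bonding maps.\<close>
    have "bond ?f (r + q) m (v r y) = v (r + m) (bond ?f' r m y)"
      by (rule bond_natural[where N = 0 and G = ?G' and e = q])
        (use cohomology_bond_carrier nat y in auto)
    also have "\<dots> = v (r + m) \<one>\<^bsub>?G' (r + m)\<^esub>"
      using mn by (simp add: bond_cohomology_one)
    also have "\<dots> = \<one>\<^bsub>?G (r + m + q)\<^esub>"
      unfolding v_def by (rule cohomology_induced_one[OF incl])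
    also have "\<dots> = bond ?f 0 (r + m + q) \<one>\<^bsub>?G 0\<^esub>"
      by (simp add: bond_cohomology_one)
    finally have "ind_class 0 ?G ?f (r + q) (v r y) = ind_class 0 ?G ?f 0 \<one>\<^bsub>?G 0\<^esub>"
      by (rule ind_class_eqI[rotated]) simp
    then show False
      using nontriv by (simp add: sig_a cohomology_good_def ind_lim_def)
  qed
  with A'(1) show ?thesis by blast
qed

text \<open>The automaton commutes with restriction of patterns and takes the base point of
  \<open>c\<close> to that of \<open>\<Phi> c\<close>, so the result lies in the group based at
  \<open>\<Phi> c\<close>.\<close>

lemma pi_ca_carrier:
  assumes "\<alpha> \<in> carrier (pi_subshift R \<AA> k c)"
  shows "pi_ca q \<Phi> R \<AA> k c \<alpha> \<in> carrier (pi_subshift R \<AA> k (\<Phi> c))"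
  unfolding pi_ca_def pi_subshift_def
proof (rule mem_proj_limI)
  fix r assume "R \<le> r"
  let ?X = "tile_complex \<AA>"
  have \<alpha>: "\<alpha> r \<in> carrier (homotopy_group k (?X r) (tile_base \<AA> r c))"
      "homotopy_induced k (?X r) (tile_base \<AA> r c) (tile_zeta \<AA> r) (\<alpha> (Suc r)) = \<alpha> r" if "R \<le> r" for r
    using proj_limD[OF assms[unfolded pi_subshift_def] that] by simp_all
  note ca = continuous_map_tile_ca[OF radius inv] tile_ca_base[OF radius inv]
  show "homotopy_induced k (?X r) (tile_base \<AA> r (\<Phi> c)) (tile_ca \<Phi> \<AA> r) (\<alpha> (r + q)) \<in>
      carrier (homotopy_group k (?X r) (tile_base \<AA> r (\<Phi> c)))"
    using \<open>R \<le> r\<close> by (intro homotopy_induced_carrier[OF ca \<alpha>(1)]) simp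
  have "homotopy_induced k (?X r) (tile_base \<AA> r (\<Phi> c)) (tile_zeta \<AA> r)
      (homotopy_induced k (?X (Suc r)) (tile_base \<AA> (Suc r) (\<Phi> c)) (tile_ca \<Phi> \<AA> (Suc r)) (\<alpha> (Suc r + q))) =
    homotopy_induced k (?X r) (tile_base \<AA> r (\<Phi> c)) (tile_ca \<Phi> \<AA> r)
      (homotopy_induced k (?X (r + q)) (tile_base \<AA> (r + q) c) (tile_zeta \<AA> (r + q)) (\<alpha> (Suc r + q)))"
  proof (rule homotopy_induced_square)
    show "continuous_map (?X (Suc r + q)) (?X (Suc r)) (tile_ca \<Phi> \<AA> (Suc r))"
      "continuous_map (?X (r + q)) (?X r) (tile_ca \<Phi> \<AA> r)"
      by (rule ca)+
    show "tile_ca \<Phi> \<AA> (Suc r) (tile_base \<AA> (Suc r + q) c) = tile_base \<AA> (Suc r) (\<Phi> c)"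
      "tile_ca \<Phi> \<AA> r (tile_base \<AA> (r + q) c) = tile_base \<AA> r (\<Phi> c)"
      by (rule ca)+
    show "continuous_map (?X (Suc r)) (?X r) (tile_zeta \<AA> r)"
      "continuous_map (?X (Suc r + q)) (?X (r + q)) (tile_zeta \<AA> (r + q))"
      by (rule continuous_map_tile_zeta; simp)+
    show "tile_zeta \<AA> r (tile_base \<AA> (Suc r) (\<Phi> c)) = tile_base \<AA> r (\<Phi> c)"
      "tile_zeta \<AA> (r + q) (tile_base \<AA> (Suc r + q) c) = tile_base \<AA> (r + q) c"
      by (rule tile_zeta_base; simp)+
    show "\<alpha> (Suc r + q) \<in> carrier (homotopy_group k (?X (Suc r + q)) (tile_base \<AA> (Suc r + q) c))"
      using \<open>R \<le> r\<close> by (intro \<alpha>(1)) simp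
  qed (rule tile_zeta_tile_ca[OF radius inv])
  then show "homotopy_induced k (?X r) (tile_base \<AA> r (\<Phi> c)) (tile_zeta \<AA> r)
      (homotopy_induced k (?X (Suc r)) (tile_base \<AA> (Suc r) (\<Phi> c)) (tile_ca \<Phi> \<AA> (Suc r)) (\<alpha> (Suc r + q))) =
    homotopy_induced k (?X r) (tile_base \<AA> r (\<Phi> c)) (tile_ca \<Phi> \<AA> r) (\<alpha> (r + q))"
    using \<alpha>(2)[of "r + q"] \<open>R \<le> r\<close> by simp
qed

lemma pi_ca_one:
  assumes "c \<in> \<AA>"
  shows "pi_ca q \<Phi> R \<AA> k c \<one>\<^bsub>pi_subshift R \<AA> k c\<^esub> = \<one>\<^bsub>pi_subshift R \<AA> k (\<Phi> c)\<^esub>"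
  unfolding pi_ca_def pi_subshift_def proj_lim_simps
  by (rule restrict_ext)
    (simp add: homotopy_induced_one[OF continuous_map_tile_ca[OF radius inv] tile_ca_base[OF radius inv]
        tile_base_mem_topspace[OF assms]])

text \<open>The map \<open>f\<close> is kept: level r + q of the good set of \<open>a\<close> lies
  in level r of that of \<open>\<Phi> a\<close>, and the automaton carries the homotopy
  along.\<close>

lemma carried_by_section_ca:
  assumes "carried_by_section R \<AA> k a c \<alpha>"
  shows "carried_by_section R \<AA> k (\<Phi> a) (\<Phi> c) (pi_ca q \<Phi> R \<AA> k c \<alpha>)"
  unfolding carried_by_section_def
proof (intro allI impI)
  fix r assume r: "R \<le> r"
  let ?X = "tile_complex \<AA>"
  note ca = continuous_map_tile_ca[OF radius inv] tile_ca_base[OF radius inv]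
  have "R \<le> r + q" using r by simp
  then obtain f h where \<alpha>: "\<alpha> (r + q) = spheroid_class k (?X (r + q)) (tile_base \<AA> (r + q) c) h"
    and h: "spheroid k (?X (r + q)) (tile_base \<AA> (r + q) c) h"
    and f: "continuous_map (kcube k) (good_space \<AA> a (r + q)) f" "constant_on_bd k f"
    and fh: "homotopic_with (constant_on_bd k) (kcube k) (?X (r + q)) (tile_section \<AA> a (r + q) \<circ> f) h"
    using assms unfolding carried_by_section_def by blast
  have "pi_ca q \<Phi> R \<AA> k c \<alpha> r = spheroid_class k (?X r) (tile_base \<AA> r (\<Phi> c)) (tile_ca \<Phi> \<AA> r \<circ> h)"
    using r by (simp add: pi_ca_def \<alpha> homotopy_induced_class[OF ca h])
  moreover have "spheroid k (?X r) (tile_base \<AA> r (\<Phi> c)) (tile_ca \<Phi> \<AA> r \<circ> h)"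
    by (rule spheroid_compose[OF ca h])
  moreover have "continuous_map (kcube k) (good_space \<AA> (\<Phi> a) r) f"
    using f(1) cube_union_mono[OF good_ca[OF radius inv, of a r]] by (auto simp: continuous_map_in_subtopology)
  moreover have "homotopic_with (constant_on_bd k) (kcube k) (?X r) (tile_section \<AA> (\<Phi> a) r \<circ> f) (tile_ca \<Phi> \<AA> r \<circ> h)"
    by (rule homotopic_section_push[OF f ca(1) tile_ca_section[OF radius inv] good_ca[OF radius inv] fh])
  ultimately show "\<exists>f h. pi_ca q \<Phi> R \<AA> k c \<alpha> r = spheroid_class k (?X r) (tile_base \<AA> r (\<Phi> c)) h \<and>
      spheroid k (?X r) (tile_base \<AA> r (\<Phi> c)) h \<and>
      continuous_map (kcube k) (good_space \<AA> (\<Phi> a) r) f \<and> constant_on_bd k f \<and>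
      homotopic_with (constant_on_bd k) (kcube k) (?X r) (tile_section \<AA> (\<Phi> a) r \<circ> f) h"
    using f(2) by blast
qed

text \<open>The base configuration moves from \<open>c\<close> to \<open>\<Phi> c\<close>. Hence the
  invariant quantifies over \<open>c\<close>, and injectivity is assumed at every base
  configuration.\<close>

lemma carried_by_section_step:
  assumes inj: "\<forall>c\<in>\<AA>. inj_on (pi_ca q \<Phi> R \<AA> k c) (carrier (pi_subshift R \<AA> k c))"
    and "\<exists>c\<in>\<AA>. \<exists>\<alpha>\<in>carrier (pi_subshift R \<AA> k c). carried_by_section R \<AA> k a c \<alpha> \<and> \<alpha> \<noteq> \<one>\<^bsub>pi_subshift R \<AA> k c\<^esub>"
  shows "\<exists>c\<in>\<AA>. \<exists>\<alpha>\<in>carrier (pi_subshift R \<AA> k c). carried_by_section R \<AA> k (\<Phi> a) c \<alpha> \<and> \<alpha> \<noteq> \<one>\<^bsub>pi_subshift R \<AA> k c\<^esub>"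
proof -
  obtain c \<alpha> where c: "c \<in> \<AA>" and \<alpha>: "\<alpha> \<in> carrier (pi_subshift R \<AA> k c)"
    "carried_by_section R \<AA> k a c \<alpha>" "\<alpha> \<noteq> \<one>\<^bsub>pi_subshift R \<AA> k c\<^esub>"
    using assms(2) by blast
  have "pi_ca q \<Phi> R \<AA> k c \<alpha> \<noteq> pi_ca q \<Phi> R \<AA> k c \<one>\<^bsub>pi_subshift R \<AA> k c\<^esub>"
    using inj_onD[OF bspec[OF inj c] _ \<alpha>(1) pi_one_carrier[OF c]] \<alpha>(3) by blast
  then have "pi_ca q \<Phi> R \<AA> k c \<alpha> \<noteq> \<one>\<^bsub>pi_subshift R \<AA> k (\<Phi> c)\<^esub>"
    unfolding pi_ca_one[OF c] .
  moreover have "\<Phi> c \<in> \<AA>" using inv c by blast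
  ultimately show ?thesis
    using pi_ca_carrier[OF \<alpha>(1)] carried_by_section_ca[OF \<alpha>(2)] by blast
qed

text \<open>Membership in \<open>tilde\<close> propagates by itself, so \<open>P\<close> only has to
  be preserved by \<open>\<Phi>\<close> and to exclude \<open>\<AA>\<close>.\<close>

lemma persistentI:
  assumes "P a" "a \<in> tilde \<AA>" "\<And>a. P a \<Longrightarrow> P (\<Phi> a)" "\<And>a. P a \<Longrightarrow> a \<notin> \<AA>"
  shows "persistent \<Phi> \<AA> a"
proof -
  have "P ((\<Phi> ^^ t) a) \<and> (\<Phi> ^^ t) a \<in> tilde \<AA>" for t
    by (induction t) (simp_all add: assms tilde_ca[OF radius inv])
  then show ?thesis
    unfolding persistent_def defective_def using assms(4) by blast
qed

end

theorem corollary3p8: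
  fixes \<AA> :: "('d::finite, 'a::finite) config set"
    and \<Phi> :: "('d, 'a) config \<Rightarrow> ('d, 'a) config"
    and R q k :: nat
  assumes "subshift_finite_type \<AA> R"
    and "cellular_automaton \<Phi>" and "has_radius \<Phi> q"
    and "\<Phi> ` \<AA> \<subseteq> \<AA>"
    and "1 \<le> k"
  shows "(basepoint_free R \<AA> k \<longrightarrow>
            (\<forall>c\<in>\<AA>. inj_on (pi_ca q \<Phi> R \<AA> k c) (carrier (pi_subshift R \<AA> k c))) \<longrightarrow>
            (\<forall>a. homotopy_defect R \<AA> k a \<longrightarrow> persistent \<Phi> \<AA> a)) \<and>
         (inj_on (homology_ca q \<Phi> R \<AA> k)
            (carrier (homology_subshift R \<AA> k ::
               (nat \<Rightarrow> (('d, 'a) tile_pt set, 'g::ab_group_add) gchain set) monoid)) \<longrightarrow>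
            (\<forall>a. homology_defect TYPE('g) R \<AA> k a \<longrightarrow> persistent \<Phi> \<AA> a)) \<and>
         (cohomology_ca q \<Phi> R \<AA> k ` carrier (cohomology_subshift R \<AA> k) =
            carrier (cohomology_subshift R \<AA> k ::
               (nat \<times> (('d, 'a) tile_pt set, 'g) gcochain set) set monoid) \<longrightarrow>
            (\<forall>a. cohomology_defect TYPE('g) R \<AA> k a \<longrightarrow> persistent \<Phi> \<AA> a))"
proof (intro conjI impI allI)
  have shift: "subshift \<AA>"
    using assms(1) by (simp add: subshift_finite_type_def)
  note radius = assms(3) and inv = assms(4)
  {
    fix a
    assume inj: "\<forall>c\<in>\<AA>. inj_on (pi_ca q \<Phi> R \<AA> k c) (carrier (pi_subshift R \<AA> k c))"
      and "homotopy_defect R \<AA> k a"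
    then obtain r0 Y \<omega> \<tau> c p x where tilde: "a \<in> tilde \<AA>" and c: "c \<in> \<AA>"
      and hom: "pi_signature R \<AA> a k r0 \<omega> \<tau> c p \<in> hom (pi_good \<AA> a k r0 Y \<omega> \<tau>) (pi_subshift R \<AA> k c)"
      and x: "x \<in> carrier (pi_good \<AA> a k r0 Y \<omega> \<tau>)"
      and nontriv: "pi_signature R \<AA> a k r0 \<omega> \<tau> c p x \<noteq> \<one>\<^bsub>pi_subshift R \<AA> k c\<^esub>"
      unfolding homotopy_defect_def by blast
    \<comment> \<open>The \<open>hom\<close> clause of the definition is what places the signature
      in the limit group.\<close>
    have "pi_signature R \<AA> a k r0 \<omega> \<tau> c p x \<in> carrier (pi_subshift R \<AA> k c)"
      using hom x by (auto simp: hom_def)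
    with c pi_signature_carried_by_section[OF x this] nontriv
    have "\<exists>c\<in>\<AA>. \<exists>\<alpha>\<in>carrier (pi_subshift R \<AA> k c). carried_by_section R \<AA> k a c \<alpha> \<and> \<alpha> \<noteq> \<one>\<^bsub>pi_subshift R \<AA> k c\<^esub>"
      by blast
    then show "persistent \<Phi> \<AA> a"
      using tilde carried_by_section_step[OF radius inv inj] carried_by_section_trivial[OF shift _ assms(5)]
      by (intro persistentI[OF radius inv, where P = "\<lambda>a. \<exists>c\<in>\<AA>. \<exists>\<alpha>\<in>carrier (pi_subshift R \<AA> k c).
            carried_by_section R \<AA> k a c \<alpha> \<and> \<alpha> \<noteq> \<one>\<^bsub>pi_subshift R \<AA> k c\<^esub>"]) blast+
  next
    fix a
    assume inj: "inj_on (homology_ca q \<Phi> R \<AA> k) (carrier (homology_subshift R \<AA> k ::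
               (nat \<Rightarrow> (('d, 'a) tile_pt set, 'g) gchain set) monoid))"
      and defect: "homology_defect TYPE('g) R \<AA> k a"
    show "persistent \<Phi> \<AA> a"
      using defect homology_signature_step[OF radius inv inj] homology_signature_trivial[OF shift _ assms(5)]
      by (intro persistentI[OF radius inv, where P = "\<lambda>a. \<exists>x\<in>carrier (homology_good \<AA> a k ::
            (nat \<Rightarrow> (real ^ 'd, 'g) gchain set) monoid).
            homology_signature R \<AA> a k x \<noteq> \<one>\<^bsub>homology_subshift R \<AA> k\<^esub>"])
        (unfold homology_defect_def, blast+)
  next
    fix a
    assume surj: "cohomology_ca q \<Phi> R \<AA> k ` carrier (cohomology_subshift R \<AA> k) =
            carrier (cohomology_subshift R \<AA> k :: (nat \<times> (('d, 'a) tile_pt set, 'g) gcochain set) set monoid)"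
      and defect: "cohomology_defect TYPE('g) R \<AA> k a"
    show "persistent \<Phi> \<AA> a"
      using defect cohomology_signature_step[OF radius inv surj] cohomology_signature_trivial[OF shift _ assms(5)]
      by (intro persistentI[OF radius inv, where P = "\<lambda>a. \<exists>A\<in>carrier (cohomology_subshift R \<AA> k ::
            (nat \<times> (('d, 'a) tile_pt set, 'g) gcochain set) set monoid).
            cohomology_signature \<AA> a k A \<noteq> \<one>\<^bsub>cohomology_good \<AA> a k\<^esub>"])
        (unfold cohomology_defect_def, blast+)
  }
qed

end
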